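(* Fix a graph $H$, a set of positive rational weights $\Lambda=\{\lambda_i:i\in V(H)\}$, and an even integer $m\ge2$. Then (for each $d$) there is a partition of $\mathrm{Hom}(T_{m,d},H)$ into $|\mathcal{M}_\Lambda(H)|+1$ classes, $$\mathrm{Hom}(T_{m,d},H)=C_\Lambda(0)\cup\bigcup_{(A,B)\in\mathcal{M}_\Lambda(H)}C_\Lambda(A,B),$$ with the following properties: 1. $w_\Lambda(C_\Lambda(0))\le 2^{-\Omega(d)}Z_\Lambda(T_{m,d},H)$. 2. For each $(A,B)\in\mathcal{M}_\Lambda(H)$, $f\in C_\Lambda(A,B)$, $k\in A$ and $\ell\in B$, the proportion of vertices of $\mathcal{E}$ colored $k$ by $f$ is within $2^{-\Omega(d)}$ of $\lambda_k/\lambda_A$, and the proportion of vertices of $\mathcal{O}$ colored $\ell$ by $f$ is within $2^{-\Omega(d)}$ of $\lambda_\ell/\lambda_B$. 3. If $A\ne B$ are such that $(A,B),(B,A)\in\mathcal{M}_\Lambda(H)$, then $w_\Lambda(C_\Lambda(A,B))=w_\Lambda(C_\Lambda(B,A))(1\pm2^{-\Omega(d)})$. 4. If $(A,B),(\tilde A,\tilde B)\in\mathcal{M}_\Lambda(H)$ are such that $\varphi(A)=\tilde A$ and $\varphi(B)=\tilde B$ for some weight-preserving automorphism $\varphi$ of $H$, then $w_\Lambda(C_\Lambda(A,B))=w_\Lambda(C_\Lambda(\tilde A,\tilde B))(1\pm2^{-\Omega(d)})$. 5. For each $(A,B)\in\mathcal{M}_\Lambda(H)$, $x\in\mathcal{E}$,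 $y\in\mathcal{O}$, $k\in A$ and $\ell\in B$, $$p_\Lambda(f(x)=k\mid f\in C_\Lambda(A,B))=\frac{(1\pm2^{-\Omega(d)})\lambda_k}{\lambda_A},\qquad p_\Lambda(f(y)=\ell\mid f\in C_\Lambda(A,B))=\frac{(1\pm2^{-\Omega(d)})\lambda_\ell}{\lambda_B}.$$
   Context: For $d\ge1$ and even $m\ge 2$, the even discrete torus $T_{m,d}$ is the graph with vertex set $V=\{0,1,\dots,m-1\}^d$ in which two strings are adjacent iff they differ by exactly $1$ (mod $m$) in exactly one coordinate and agree in all others. It is bipartite with classes $\mathcal{E}$ (even coordinate sum) and $\mathcal{O}$ (odd coordinate sum). $H$ is a finite graph without multiple edges, possibly with loops. An $H$-coloring of $G$ is a map $f:V(G)\to V(H)$ with $f(u)f(v)\in E(H)$ whenever $uv\in E(G)$; $\mathrm{Hom}(G,H)$ is the set of these; a vertex $v$ is "colored $k$" by $f$ if $f(v)=k$. Given positive weights $\Lambda=\{\lambda_i:i\in V(H)\}$, set $w_\Lambda(f)=\prod_{v\in V}\lambda_{f(v)}$, $w_\Lambda(S)=\sum_{f\in S}w_\Lambda(f)$, $Z_\Lambda(T_{m,d},H)=w_\Lambda(\mathrm{Hom}(T_{m,d},H))$, and $p_\Lambda(f)=w_\Lambda(f)/Z_\Lambda(T_{m,d},H)$ (the probability measure on $\mathrm{Hom}(T_{m,d},H)$ under which $f$ is chosen); $\lambda_T=\sum_{k\in T}\lambda_k$. For $A,B\subseteq V(H)$, $A\sim B$ means every vertex of $A$ is adjacent in $H$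 to every vertex of $B$. Let $\eta_\Lambda(H)=\max\{\lambda_A\lambda_B:A\sim B\}$ and $\mathcal{M}_\Lambda(H)=\{(A,B):A,B\subseteq V(H),A\sim B,\lambda_A\lambda_B=\eta_\Lambda(H)\}$. A weight-preserving automorphism of $H$ is an automorphism $\varphi$ with $\lambda_{\varphi(i)}=\lambda_i$ for all $i$. Asymptotics are as $d\to\infty$ with $m,H,\Lambda$ fixed: $2^{-\Omega(d)}$ denotes a quantity at most $2^{-cd}$ for a constant $c>0$ depending only on $m,H,\Lambda$ (for all sufficiently large $d$), and $X=Y(1\pm2^{-\Omega(d)})$ means $|X/Y-1|\le 2^{-\Omega(d)}$. *)

theory Defs
  imports Complex_Main "HOL-Library.FuncSet" "HOL-Library.Disjoint_Sets" "HOL-Number_Theory.Cong"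
begin

text \<open>Undirected graphs without multiple edges: an edge is a set \<open>{u, v}\<close> of end vertices,
  which is a singleton for a loop.\<close>

record 'a ugraph =
  verts :: "'a set"
  edges :: "'a set set"

definition finite_loop_graph :: "'a ugraph \<Rightarrow> bool" where
  "finite_loop_graph H \<longleftrightarrow>
     finite (verts H) \<and> edges H \<subseteq> {{u, v} | u v. u \<in> verts H \<and> v \<in> verts H}"

definition torus_verts :: "nat \<Rightarrow> nat \<Rightarrow> nat list set" where
  "torus_verts m d = {u. length u = d \<and> set u \<subseteq> {0..<m}}"

definition torus_adj :: "nat \<Rightarrow> nat \<Rightarrow> nat list \<Rightarrow> nat list \<Rightarrow> bool" where
  "torus_adj m d u v \<longleftrightarrow>
     (\<exists>i<d. ([u ! i = v ! i + 1] (mod m) \<or> [v ! i = u ! i + 1] (mod m)) \<and>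
            (\<forall>j<d. j \<noteq> i \<longrightarrow> u ! j = v ! j))"

definition torus :: "nat \<Rightarrow> nat \<Rightarrow> nat list ugraph" where
  "torus m d =
     \<lparr>verts = torus_verts m d,
      edges = {{u, v} | u v. u \<in> torus_verts m d \<and> v \<in> torus_verts m d \<and> torus_adj m d u v}\<rparr>"

definition even_class :: "nat \<Rightarrow> nat \<Rightarrow> nat list set" where
  "even_class m d = {v \<in> torus_verts m d. even (sum_list v)}"

definition odd_class :: "nat \<Rightarrow> nat \<Rightarrow> nat list set" where
  "odd_class m d = {v \<in> torus_verts m d. odd (sum_list v)}"

text \<open>Colorings are taken extensional on the vertex set of \<open>G\<close>, so that each map
  from \<open>verts G\<close> to \<open>verts H\<close> is counted exactly once.\<close>

definition Hom :: "'a ugraph \<Rightarrow> 'b ugraph \<Rightarrow> ('a \<Rightarrow> 'b) set" where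
  "Hom G H = {f \<in> verts G \<rightarrow>\<^sub>E verts H. \<forall>u v. {u, v} \<in> edges G \<longrightarrow> {f u, f v} \<in> edges H}"

definition col_weight :: "'a ugraph \<Rightarrow> ('b \<Rightarrow> real) \<Rightarrow> ('a \<Rightarrow> 'b) \<Rightarrow> real" where
  "col_weight G lam f = (\<Prod>v\<in>verts G. lam (f v))"

definition set_weight :: "'a ugraph \<Rightarrow> ('b \<Rightarrow> real) \<Rightarrow> ('a \<Rightarrow> 'b) set \<Rightarrow> real" where
  "set_weight G lam S = (\<Sum>f\<in>S. col_weight G lam f)"

definition partition_fun :: "'a ugraph \<Rightarrow> 'b ugraph \<Rightarrow> ('b \<Rightarrow> real) \<Rightarrow> real" where
  "partition_fun G H lam = set_weight G lam (Hom G H)"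

definition col_prob :: "'a ugraph \<Rightarrow> 'b ugraph \<Rightarrow> ('b \<Rightarrow> real) \<Rightarrow> ('a \<Rightarrow> 'b) set \<Rightarrow> real" where
  "col_prob G H lam S = (\<Sum>f\<in>S \<inter> Hom G H. col_weight G lam f / partition_fun G H lam)"

definition col_cond_prob ::
  "'a ugraph \<Rightarrow> 'b ugraph \<Rightarrow> ('b \<Rightarrow> real) \<Rightarrow> ('a \<Rightarrow> 'b) set \<Rightarrow> ('a \<Rightarrow> 'b) set \<Rightarrow> real" where
  "col_cond_prob G H lam S C = col_prob G H lam (S \<inter> C) / col_prob G H lam C"

definition fully_adjacent :: "'b ugraph \<Rightarrow> 'b set \<Rightarrow> 'b set \<Rightarrow> bool" where
  "fully_adjacent H A B \<longleftrightarrow> (\<forall>a\<in>A. \<forall>b\<in>B. {a, b} \<in> edges H)"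

definition eta :: "'b ugraph \<Rightarrow> ('b \<Rightarrow> real) \<Rightarrow> real" where
  "eta H lam =
     Max {sum lam A * sum lam B | A B. A \<subseteq> verts H \<and> B \<subseteq> verts H \<and> fully_adjacent H A B}"

definition max_pairs :: "'b ugraph \<Rightarrow> ('b \<Rightarrow> real) \<Rightarrow> ('b set \<times> 'b set) set" where
  "max_pairs H lam =
     {(A, B). A \<subseteq> verts H \<and> B \<subseteq> verts H \<and> fully_adjacent H A B \<and>
              sum lam A * sum lam B = eta H lam}"

definition automorphism :: "'b ugraph \<Rightarrow> ('b \<Rightarrow> 'b) \<Rightarrow> bool" where
  "automorphism H \<phi> \<longleftrightarrow>
     bij_betw \<phi> (verts H) (verts H) \<and>
     (\<forall>u\<in>verts H. \<forall>v\<in>verts H. {\<phi> u, \<phi> v} \<in> edges H \<longleftrightarrow> {u, v} \<in> edges H)"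

definition weight_preserving_automorphism ::
  "'b ugraph \<Rightarrow> ('b \<Rightarrow> real) \<Rightarrow> ('b \<Rightarrow> 'b) \<Rightarrow> bool" where
  "weight_preserving_automorphism H lam \<phi> \<longleftrightarrow>
     automorphism H \<phi> \<and> (\<forall>i\<in>verts H. lam (\<phi> i) = lam i)"

text \<open>\<open>X = Y (1 \<plusminus> \<epsilon>)\<close>. For \<open>Y \<noteq> 0\<close> this says \<open>\<bar>X / Y - 1\<bar> \<le> \<epsilon>\<close>; for \<open>Y = 0\<close> it says \<open>X = 0\<close>,
  which is what is meant when \<open>H\<close> has no edges and all weights of classes vanish.\<close>

definition approx_factor :: "real \<Rightarrow> real \<Rightarrow> real \<Rightarrow> bool" where
  "approx_factor \<epsilon> X Y \<longleftrightarrow> (\<exists>\<delta>. \<bar>\<delta>\<bar> \<le> \<epsilon> \<and> X = Y * (1 + \<delta>))"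

end

theory Submission
  imports Defs "HOL-Combinatorics.Permutations" "HOL-Real_Asymp.Real_Asymp"
begin

text \<open>
  For an odd vertex \<open>v\<close> let \<open>X\<^sub>v\<close> be the set of colours on the neighbours of \<open>v\<close>. Given the colours on
  \<open>\<E>\<close>, those on \<open>\<O>\<close> are independent, the one at \<open>v\<close> living on the common neighbourhood of \<open>X\<^sub>v\<close>; call
  \<open>X\<^sub>v\<close> ideal if it and its common neighbourhood form a maximising pair. Everything reduces to showing
  that, outside a set of weight \<open>2\<^sup>-\<^sup>\<Omega>\<^sup>(\<^sup>d\<^sup>)\<close>, all but a fraction \<open>2\<^sup>-\<^sup>\<Omega>\<^sup>(\<^sup>d\<^sup>)\<close> of the \<open>X\<^sub>v\<close> equal one ideal set:
  Chebyshev's inequality then gives the colour frequencies, and the classes are simply defined by them, so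
  that the symmetry statements hold exactly.

  This is a counting argument. Let \<open>q(f)\<close> be the proportion of pairs \<open>v, w\<close> with a common neighbour
  (along different coordinates) such that \<open>X\<^sub>v \<noteq> X\<^sub>w\<close> or \<open>X\<^sub>v\<close> is not ideal. Fix a code \<open>T \<subseteq> \<O>\<close> of density
  \<open>O(1/d)\<close> such that every even \<open>u\<close> has a bounded but large number of neighbours in \<open>T\<close>. The sets \<open>X\<^sub>v\<close> with
  \<open>v \<in> T\<close> confine \<open>f(u)\<close> to the intersection \<open>I\<^sub>u\<close> of the sampled \<open>X\<^sub>v\<close>, so the weight of the colourings with a given
  pattern on \<open>T\<close> is at most the product over all edges \<open>uv\<close> of \<open>(\<lambda>(I\<^sub>u) \<lambda>(N(X\<^sub>v)))\<^sup>1\<^sup>/\<^sup>D\<close>. A factor with \<open>I\<^sub>u \<subseteq> X\<^sub>v\<close>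
  is at most \<open>\<eta>\<close>, with a definite loss unless \<open>I\<^sub>u = X\<^sub>v\<close> is ideal; a random automorphism of the torus makes \<open>v\<close>
  exchangeable with the sample, and leaving out one element at a time shows that \<open>I\<^sub>u \<subseteq> X\<^sub>v\<close> fails much less often
  than the loss occurs. Hence a pattern gains a factor \<open>exp(-\<Omega>(q m\<^sup>d))\<close>. The patterns are cheap: a second code of
  density \<open>O(1/d\<^sup>2)\<close> and a single reference vertex predict \<open>X\<close> on \<open>T\<close> up to a fraction \<open>O(q)\<close> of errors, at a total cost of
  \<open>exp(O(q m\<^sup>d log(1/q) / d))\<close>. So \<open>q\<close> is exponentially small, and a path argument makes \<open>X\<close> nearly constant.
\<close>

subsection \<open>The torus and its coordinatewise automorphisms\<close>

text \<open>The code \<open>T\<close> is fixed, while a colouring may be badly placed relative to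
  it. The gain is therefore proved on average over \<open>autos\<close>; some automorphism achieves
  it, and the union bound over \<open>autos\<close> costs at most \<open>(2 m d)^d\<close>,
  negligible against \<open>exp (q m^d)\<close> for the \<open>q\<close> in question. The code
  densities balance the description cost. A vertex of \<open>T\<close> disagrees with its predictor,
  two steps away, with frequency at most \<open>q\<close>; a vertex of the second code disagrees
  with the reference vertex with frequency at most \<open>m d q\<close>. Densities of order
  \<open>1/d\<close> and \<open>1/d^2\<close> make both expected error counts
  \<open>O(q m^d / d)\<close>. Errors are handled by a price \<open>\<theta> = c0 d\<close> each,
  which uses up at most half of the gain; summing \<open>exp (- \<theta> * errors)\<close> over all
  patterns gives only \<open>exp (O (m^d exp (- c0 d)))\<close>. This is harmless once
  \<open>q\<close> is at least \<open>exp (- c1 d)\<close> with \<open>c1 < c0\<close>, which is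
  where the exponential rate comes from. All this sees only the sets at odd vertices. The even side
  follows through an automorphism exchanging the parities, and the two pairs found must then be
  shown to coincide.\<close>

locale even_torus =
  fixes m d :: nat
  assumes m_even: "even m" and m_ge2: "m \<ge> 2"
begin

abbreviation V where "V \<equiv> torus_verts m d"
abbreviation Ev where "Ev \<equiv> even_class m d"
abbreviation Od where "Od \<equiv> odd_class m d"

text \<open>The steps \<open>\<plusminus>1\<close> as residues; they coincide for \<open>m = 2\<close>.\<close>

definition Sg :: "nat set" where "Sg = {1, m - 1}"

definition nb :: "nat \<Rightarrow> nat \<Rightarrow> nat list \<Rightarrow> nat list" where
  "nb i s u = u[i := (u ! i + s) mod m]"

definition nbrs :: "nat list \<Rightarrow> nat list set" where
  "nbrs v = {nb i s v | i s. i < d \<and> s \<in> Sg}"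

lemma Sg_one: "1 \<in> Sg" by (simp add: Sg_def)

lemma finite_Sg: "finite Sg" by (simp add: Sg_def)

lemma card_Sg: "card Sg \<ge> 1" "card Sg \<le> 2"
  by (auto simp: Sg_def card_insert_if)

lemma Sg_range: "s \<in> Sg \<Longrightarrow> 1 \<le> s \<and> s < m"
  using m_ge2 by (auto simp: Sg_def)

lemma Sg_odd: "s \<in> Sg \<Longrightarrow> odd s"
  using m_ge2 m_even by (auto simp: Sg_def)

lemma Sg_neg: "s \<in> Sg \<Longrightarrow> m - s \<in> Sg"
  using m_ge2 by (auto simp: Sg_def)

lemma pred_square_mod: "(m - 1) * (m - 1) mod m = 1"
proof -
  obtain k where k: "m = k + 2" using m_ge2 by (metis add.commute le_Suc_ex)
  have "(m - 1) * (m - 1) = k * m + 1" by (simp add: k algebra_simps)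
  then have "(m - 1) * (m - 1) mod m = 1 mod m" by (metis mod_mult_self3)
  then show ?thesis using m_ge2 by simp
qed

lemma Sg_mult: "s \<in> Sg \<Longrightarrow> r \<in> Sg \<Longrightarrow> (s * r) mod m \<in> Sg"
  using m_ge2 pred_square_mod by (auto simp: Sg_def)

lemma Sg_square: "s \<in> Sg \<Longrightarrow> (s * s) mod m = 1"
  using m_ge2 pred_square_mod by (auto simp: Sg_def)

lemma even_mod_m: "even (x mod m) \<longleftrightarrow> even x"
  using m_even by (metis dvd_mod_iff)

lemma V_nth: "v \<in> V \<Longrightarrow> i < d \<Longrightarrow> v ! i < m"
  unfolding torus_verts_def by (auto simp: subset_iff)

lemma V_length: "v \<in> V \<Longrightarrow> length v = d"
  by (simp add: torus_verts_def)

lemma V_I: "length v = d \<Longrightarrow> (\<And>i. i < d \<Longrightarrow> v ! i < m) \<Longrightarrow> v \<in> V"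
  unfolding torus_verts_def by (auto simp: in_set_conv_nth)

lemma V_eqI: "v \<in> V \<Longrightarrow> w \<in> V \<Longrightarrow> (\<And>i. i < d \<Longrightarrow> v ! i = w ! i) \<Longrightarrow> v = w"
  by (auto intro!: nth_equalityI simp: V_length)

lemma finite_V: "finite V" and card_V: "card V = m ^ d"
proof -
  have "V = {xs. set xs \<subseteq> {0..<m} \<and> length xs = d}" unfolding torus_verts_def by auto
  then show "finite V" "card V = m ^ d"
    by (simp_all add: finite_lists_length_eq card_lists_length_eq)
qed

lemma Ev_V: "v \<in> Ev \<Longrightarrow> v \<in> V" and Od_V: "v \<in> Od \<Longrightarrow> v \<in> V"
  by (auto simp: even_class_def odd_class_def)

lemma Ev_Od: "Ev \<union> Od = V" "Ev \<inter> Od = {}"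
  by (auto simp: even_class_def odd_class_def)

lemma Od_not_Ev: "v \<in> Od \<Longrightarrow> v \<notin> Ev"
  by (simp add: even_class_def odd_class_def)

lemma finite_Ev: "finite Ev" and finite_Od: "finite Od"
  using finite_V Ev_Od(1) by (metis finite_Un)+

lemma zero_in_Ev: "replicate d 0 \<in> Ev"
  using m_ge2 by (auto simp: even_class_def torus_verts_def sum_list_replicate)

lemma sum_list_nths: "v \<in> V \<Longrightarrow> sum_list v = (\<Sum>n<d. v ! n)"
  by (simp add: sum_list_sum_nth V_length atLeast0LessThan)

lemma nb_nth: "u \<in> V \<Longrightarrow> i < d \<Longrightarrow> nb i s u ! j = (if j = i then (u ! i + s) mod m else u ! j)"
  by (simp add: nb_def V_length nth_list_update)

lemma nb_in_V: "u \<in> V \<Longrightarrow> i < d \<Longrightarrow> nb i s u \<in> V"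
  using m_ge2 by (intro V_I) (auto simp: nb_nth V_nth, simp add: nb_def V_length)

lemma nb_parity:
  assumes "u \<in> V" "i < d" "s \<in> Sg"
  shows "even (sum_list (nb i s u)) \<longleftrightarrow> odd (sum_list u)"
proof -
  have "sum_list (nb i s u) = (u ! i + s) mod m + (\<Sum>n\<in>{..<d} - {i}. u ! n)"
    using assms by (subst sum_list_nths, simp add: nb_in_V, subst sum.remove[of _ i]) (auto simp: nb_nth)
  moreover have "sum_list u = u ! i + (\<Sum>n\<in>{..<d} - {i}. u ! n)"
    using assms by (subst sum_list_nths, simp, subst sum.remove[of _ i]) auto
  ultimately show ?thesis using Sg_odd[OF assms(3)] by (auto simp: even_mod_m)
qed

lemma nb_Ev: "u \<in> Ev \<Longrightarrow> i < d \<Longrightarrow> s \<in> Sg \<Longrightarrow> nb i s u \<in> Od"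
  and nb_Od: "u \<in> Od \<Longrightarrow> i < d \<Longrightarrow> s \<in> Sg \<Longrightarrow> nb i s u \<in> Ev"
  by (auto simp: even_class_def odd_class_def nb_parity nb_in_V)

lemma nb_inv:
  assumes "u \<in> V" "i < d" "s \<in> Sg"
  shows "nb i (m - s) (nb i s u) = u"
proof (rule V_eqI)
  fix j assume "j < d"
  have "(u ! i + s + (m - s)) mod m = u ! i"
    using Sg_range[OF assms(3)] V_nth[OF assms(1,2)] by simp
  then show "nb i (m - s) (nb i s u) ! j = u ! j"
    using assms by (simp add: nb_nth nb_in_V mod_add_left_eq)
qed (use assms in \<open>auto intro!: nb_in_V\<close>)

lemma nb_inv':
  assumes "u \<in> V" "i < d" "s \<in> Sg"
  shows "nb i s (nb i (m - s) u) = u"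
  using nb_inv[OF assms(1,2) Sg_neg[OF assms(3)]] Sg_range[OF assms(3)] by simp

lemma nbrs_I: "i < d \<Longrightarrow> s \<in> Sg \<Longrightarrow> nb i s v \<in> nbrs v"
  by (auto simp: nbrs_def)

lemma nbrs_sym: "u \<in> V \<Longrightarrow> v \<in> nbrs u \<Longrightarrow> u \<in> nbrs v"
  unfolding nbrs_def using nb_inv Sg_neg by (auto) metis

lemma nbrs_V: "u \<in> V \<Longrightarrow> nbrs u \<subseteq> V"
  by (auto simp: nbrs_def nb_in_V)

lemma nbrs_Ev: "u \<in> Ev \<Longrightarrow> nbrs u \<subseteq> Od" and nbrs_Od: "u \<in> Od \<Longrightarrow> nbrs u \<subseteq> Ev"
  by (auto simp: nbrs_def nb_Ev nb_Od)

lemma finite_nbrs: "finite (nbrs v)"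
proof -
  have "nbrs v = (\<lambda>(i, s). nb i s v) ` ({..<d} \<times> Sg)" by (auto simp: nbrs_def)
  then show ?thesis by (simp add: finite_Sg)
qed

lemma card_nbrs_le: "card (nbrs v) \<le> 2 * d"
proof -
  have "nbrs v = (\<lambda>(i, s). nb i s v) ` ({..<d} \<times> Sg)" by (auto simp: nbrs_def)
  then have "card (nbrs v) \<le> card ({..<d} \<times> Sg)" by (metis card_image_le finite_Sg finite_cartesian_product finite_lessThan)
  also have "\<dots> \<le> 2 * d" using card_Sg by (simp add: card_cartesian_product)
  finally show ?thesis .
qed

lemma adj_iff_nbrs:
  assumes "u \<in> V" "v \<in> V"
  shows "torus_adj m d u v \<longleftrightarrow> v \<in> nbrs u"
proof
  assume "torus_adj m d u v"
  then obtain i where i: "i < d" "[u ! i = v ! i + 1] (mod m) \<or> [v ! i = u ! i + 1] (mod m)"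
    and eq: "\<forall>j<d. j \<noteq> i \<longrightarrow> u ! j = v ! j" unfolding torus_adj_def by blast
  have lt: "u ! i < m" "v ! i < m" using assms i V_nth by auto
  from i(2) show "v \<in> nbrs u"
  proof
    assume "[u ! i = v ! i + 1] (mod m)"
    then have "u ! i = (v ! i + 1) mod m" using lt by (simp add: unique_euclidean_semiring_class.cong_def)
    then have "u = nb i 1 v" using assms eq i(1) by (intro V_eqI) (auto simp: nb_nth nb_in_V)
    then show ?thesis using nbrs_sym nbrs_I assms i(1) Sg_one by blast
  next
    assume "[v ! i = u ! i + 1] (mod m)"
    then have "v ! i = (u ! i + 1) mod m" using lt by (simp add: unique_euclidean_semiring_class.cong_def)
    then have "v = nb i 1 u" using assms eq i(1) by (intro V_eqI) (auto simp: nb_nth nb_in_V)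
    then show ?thesis using nbrs_I i(1) Sg_one by blast
  qed
next
  assume "v \<in> nbrs u"
  then obtain i s where ix: "i < d" "s \<in> Sg" "v = nb i s u" by (auto simp: nbrs_def)
  have "[u ! i = v ! i + 1] (mod m) \<or> [v ! i = u ! i + 1] (mod m)"
  proof (cases "s = 1")
    case True
    then show ?thesis using ix assms by (simp add: nb_nth unique_euclidean_semiring_class.cong_def)
  next
    case False
    then have s: "s = m - 1" using ix(2) by (simp add: Sg_def)
    have "(u ! i + (m - 1) + 1) mod m = u ! i mod m" using m_ge2 by simp
    then show ?thesis using ix assms s by (simp add: nb_nth unique_euclidean_semiring_class.cong_def mod_add_left_eq mod_Suc_eq)
  qed
  then show "torus_adj m d u v"
    unfolding torus_adj_def using ix assms by (intro exI[of _ i]) (auto simp: nb_nth)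
qed

lemma verts_torus: "verts (torus m d) = V"
  by (simp add: torus_def)

lemma edge_iff: "{u, v} \<in> edges (torus m d) \<longleftrightarrow> u \<in> V \<and> v \<in> nbrs u"
proof
  assume "{u, v} \<in> edges (torus m d)"
  then obtain a b where ab: "{u, v} = {a, b}" "a \<in> V" "b \<in> V" "torus_adj m d a b"
    by (auto simp: torus_def)
  then have "b \<in> nbrs a" using adj_iff_nbrs by blast
  then show "u \<in> V \<and> v \<in> nbrs u" using ab nbrs_sym by (metis doubleton_eq_iff)
next
  assume "u \<in> V \<and> v \<in> nbrs u"
  then have "u \<in> V" "v \<in> V" "torus_adj m d u v" using adj_iff_nbrs nbrs_V by auto
  then show "{u, v} \<in> edges (torus m d)" unfolding torus_def by auto
qed

lemma bij_nb_Ev: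
  assumes "i < d" "s \<in> Sg"
  shows "bij_betw (nb i s) Ev Od"
  by (rule bij_betw_byWitness[where f' = "nb i (m - s)"])
    (use assms in \<open>auto simp: nb_inv nb_inv' Ev_V Od_V nb_Ev nb_Od Sg_neg\<close>)

lemma card_Ev_Od:
  assumes "d \<ge> 1"
  shows "card Ev = card Od" "2 * card Ev = m ^ d"
proof -
  show eq: "card Ev = card Od"
    using bij_betw_same_card[OF bij_nb_Ev[of 0 1]] assms Sg_one by simp
  have "card V = card Ev + card Od"
    using card_Un_disjoint[OF finite_Ev finite_Od Ev_Od(2)] Ev_Od(1) by simp
  then show "2 * card Ev = m ^ d" using eq card_V by simp
qed

text \<open>Each step \<open>nb i s\<close> is a bijection from \<open>Ev\<close> to
  \<open>Od\<close>, so every vertex occurs in exactly \<open>d * card Sg\<close> terms. Applied to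
  logarithms, the identity spreads a product over the vertices evenly over the edges.\<close>

lemma sum_over_edges:
  fixes a b :: "nat list \<Rightarrow> real"
  shows "(\<Sum>u\<in>Ev. \<Sum>i<d. \<Sum>s\<in>Sg. a u + b (nb i s u))
       = real (d * card Sg) * ((\<Sum>u\<in>Ev. a u) + (\<Sum>v\<in>Od. b v))"
proof -
  have "(\<Sum>u\<in>Ev. \<Sum>i<d. \<Sum>s\<in>Sg. b (nb i s u)) = (\<Sum>i<d. \<Sum>u\<in>Ev. \<Sum>s\<in>Sg. b (nb i s u))"
    by (rule sum.swap)
  also have "\<dots> = (\<Sum>i<d. \<Sum>s\<in>Sg. \<Sum>u\<in>Ev. b (nb i s u))"
    by (intro sum.cong refl sum.swap)
  also have "\<dots> = (\<Sum>i<d. \<Sum>s\<in>Sg. \<Sum>v\<in>Od. b v)"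
    by (intro sum.cong refl sum.reindex_bij_betw bij_nb_Ev) auto
  finally show ?thesis
    by (simp add: sum.distrib sum_distrib_left algebra_simps)
qed

section \<open>Signed coordinate permutations combined with translations\<close>

definition aff :: "(nat \<Rightarrow> nat) \<Rightarrow> (nat \<Rightarrow> nat) \<Rightarrow> (nat \<Rightarrow> nat) \<Rightarrow> nat list \<Rightarrow> nat list" where
  "aff \<pi> \<sigma> t v = map (\<lambda>n. (t n + \<sigma> n * v ! (\<pi> n)) mod m) [0..<d]"

lemma aff_nth: "n < d \<Longrightarrow> aff \<pi> \<sigma> t v ! n = (t n + \<sigma> n * v ! (\<pi> n)) mod m"
  by (simp add: aff_def)

lemma aff_in_V: "aff \<pi> \<sigma> t v \<in> V"
  using m_ge2 by (intro V_I) (auto simp: aff_nth, simp add: aff_def)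

context
  fixes \<pi> \<sigma> :: "nat \<Rightarrow> nat"
  assumes perm: "\<pi> permutes {..<d}" and sgn: "\<And>n. \<sigma> n \<in> Sg"
begin

lemma perm_lt: "n < d \<Longrightarrow> \<pi> n < d"
  using permutes_in_image[OF perm] by auto

lemma perm_obtain: assumes "i < d" obtains n where "n < d" "\<pi> n = i"
  using permutes_image[OF perm] assms by (metis imageE lessThan_iff)

text \<open>Signs in \<open>Sg\<close> are odd and \<open>m\<close> is even, so neither the signs
  nor the reduction modulo \<open>m\<close> affect parity; only the total translation
  matters.\<close>

lemma aff_parity:
  assumes "v \<in> V"
  shows "even (sum_list (aff \<pi> \<sigma> t v)) \<longleftrightarrow> even ((\<Sum>n<d. t n) + sum_list v)"
proof -
  have "even (\<Sum>n\<in>S. (t n + \<sigma> n * v ! \<pi> n) mod m) \<longleftrightarrow> even (\<Sum>n\<in>S. t n + v ! \<pi> n)"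
    if "finite S" for S
    using that by (induction) (use Sg_odd[OF sgn] in \<open>auto simp: even_mod_m\<close>)
  moreover have "(\<Sum>n<d. v ! \<pi> n) = (\<Sum>n<d. v ! n)"
    using sum.permute[OF perm, of "\<lambda>n. v ! n"] by (simp add: comp_def)
  moreover have "sum_list (aff \<pi> \<sigma> t v) = (\<Sum>n<d. (t n + \<sigma> n * v ! \<pi> n) mod m)"
    by (subst sum_list_nths) (auto simp: aff_in_V aff_nth)
  ultimately show ?thesis using assms by (simp add: sum_list_nths sum.distrib)
qed

lemma aff_nb:
  assumes "v \<in> V" "n < d"
  shows "aff \<pi> \<sigma> t (nb (\<pi> n) s v) = nb n ((\<sigma> n * s) mod m) (aff \<pi> \<sigma> t v)"
proof (rule V_eqI)
  fix j assume j: "j < d"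
  have "\<pi> j = \<pi> n \<longleftrightarrow> j = n" using permutes_inj[OF perm] by (auto dest: injD)
  moreover have "(t n + \<sigma> n * ((v ! \<pi> n + s) mod m)) mod m
      = (t n + \<sigma> n * v ! \<pi> n + \<sigma> n * s) mod m"
    by (metis add.assoc distrib_left mod_add_right_eq mod_mult_right_eq)
  ultimately show "aff \<pi> \<sigma> t (nb (\<pi> n) s v) ! j = nb n ((\<sigma> n * s) mod m) (aff \<pi> \<sigma> t v) ! j"
    using assms j perm_lt by (auto simp: aff_nth nb_nth aff_in_V mod_simps)
qed (use assms in \<open>auto intro!: aff_in_V nb_in_V\<close>)

lemma aff_inj: "inj_on (aff \<pi> \<sigma> t) V"
proof (rule inj_onI, rule V_eqI)
  fix v w i assume vw: "v \<in> V" "w \<in> V" "aff \<pi> \<sigma> t v = aff \<pi> \<sigma> t w" and "i < d"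
  then obtain n where n: "n < d" "\<pi> n = i" using perm_obtain by blast
  have "[t n + \<sigma> n * v ! i = t n + \<sigma> n * w ! i] (mod m)"
    using vw(3) n aff_nth unfolding unique_euclidean_semiring_class.cong_def by metis
  then have "[\<sigma> n * v ! i = \<sigma> n * w ! i] (mod m)" by (simp add: cong_add_lcancel_nat)
  then have "[\<sigma> n * (\<sigma> n * v ! i) = \<sigma> n * (\<sigma> n * w ! i)] (mod m)" by (rule cong_scalar_left)
  then have "[(\<sigma> n * \<sigma> n) mod m * v ! i = (\<sigma> n * \<sigma> n) mod m * w ! i] (mod m)"
    by (simp add: unique_euclidean_semiring_class.cong_def mod_simps mult.assoc)
  then show "v ! i = w ! i" using Sg_square[OF sgn] V_nth vw(1,2) \<open>i < d\<close>
    by (simp add: unique_euclidean_semiring_class.cong_def)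
qed auto

lemma aff_bij: "bij_betw (aff \<pi> \<sigma> t) V V"
  unfolding bij_betw_def using aff_inj endo_inj_surj[OF finite_V _ aff_inj] aff_in_V by blast

lemma aff_nbrs:
  assumes "v \<in> V"
  shows "aff \<pi> \<sigma> t ` nbrs v = nbrs (aff \<pi> \<sigma> t v)"
proof (intro equalityI subsetI)
  fix x assume "x \<in> aff \<pi> \<sigma> t ` nbrs v"
  then obtain i s where ix: "i < d" "s \<in> Sg" "x = aff \<pi> \<sigma> t (nb i s v)" by (auto simp: nbrs_def)
  obtain n where "n < d" "\<pi> n = i" using perm_obtain ix(1) by blast
  then show "x \<in> nbrs (aff \<pi> \<sigma> t v)"
    using ix aff_nb[OF assms, of n t s] nbrs_I Sg_mult[OF sgn ix(2)] by auto
next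
  fix x assume "x \<in> nbrs (aff \<pi> \<sigma> t v)"
  then obtain n r where nr: "n < d" "r \<in> Sg" "x = nb n r (aff \<pi> \<sigma> t v)" by (auto simp: nbrs_def)
  have "(\<sigma> n * ((\<sigma> n * r) mod m)) mod m = ((\<sigma> n * \<sigma> n) mod m * r) mod m"
    by (simp add: mod_simps mult.assoc)
  then have "(\<sigma> n * ((\<sigma> n * r) mod m)) mod m = r"
    using Sg_square[OF sgn] Sg_range[OF nr(2)] by simp
  then have "x = aff \<pi> \<sigma> t (nb (\<pi> n) ((\<sigma> n * r) mod m) v)"
    using aff_nb[OF assms nr(1)] nr(3) by metis
  then show "x \<in> aff \<pi> \<sigma> t ` nbrs v"
    using nbrs_I[OF perm_lt[OF nr(1)] Sg_mult[OF sgn nr(2)]] by blast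
qed

end

text \<open>Restriction to \<open>V\<close> makes this a finite set of functions, in which parameter
  triples with the same action count once. Evenness of the total translation keeps \<open>Ev\<close>
  and \<open>Od\<close> invariant; it is meaningful for unreduced \<open>t\<close> because
  \<open>m\<close> is even.\<close>

definition autos :: "(nat list \<Rightarrow> nat list) set" where
  "autos = {restrict (aff \<pi> \<sigma> t) V | \<pi> \<sigma> t.
     \<pi> permutes {..<d} \<and> (\<forall>n. \<sigma> n \<in> Sg) \<and> even (\<Sum>n<d. t n)}"

lemma autos_cases:
  assumes "g \<in> autos"
  obtains \<pi> \<sigma> t where "\<pi> permutes {..<d}" "\<And>n. \<sigma> n \<in> Sg" "even (\<Sum>n<d. t n)"
    "g = restrict (aff \<pi> \<sigma> t) V"
  using assms unfolding autos_def by blast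

lemma autos_bij: "g \<in> autos \<Longrightarrow> bij_betw g V V"
  by (erule autos_cases) (simp add: aff_bij)

lemma autos_in_V: "g \<in> autos \<Longrightarrow> v \<in> V \<Longrightarrow> g v \<in> V"
  using autos_bij bij_betwE by blast

lemma autos_nbrs: "g \<in> autos \<Longrightarrow> v \<in> V \<Longrightarrow> g ` nbrs v = nbrs (g v)"
proof (erule autos_cases, goal_cases)
  case (1 \<pi> \<sigma> t)
  have "g ` nbrs v = aff \<pi> \<sigma> t ` nbrs v"
    using 1(5) nbrs_V[OF 1(1)] by (intro image_cong) auto
  then show ?case using 1 aff_nbrs[OF 1(2,3,1)] by simp
qed

lemma autos_parity: "g \<in> autos \<Longrightarrow> v \<in> V \<Longrightarrow> even (sum_list (g v)) \<longleftrightarrow> even (sum_list v)"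
  by (erule autos_cases) (simp add: aff_parity)

lemma autos_Ev: "g \<in> autos \<Longrightarrow> v \<in> Ev \<Longrightarrow> g v \<in> Ev"
  and autos_Od: "g \<in> autos \<Longrightarrow> v \<in> Od \<Longrightarrow> g v \<in> Od"
  by (auto simp: even_class_def odd_class_def autos_parity autos_in_V)

lemma id_in_autos: "restrict id V \<in> autos"
proof -
  have "restrict (aff id (\<lambda>_. 1) (\<lambda>_. 0)) V = restrict id V"
    by (rule restrict_ext) (rule V_eqI, auto simp: aff_nth aff_in_V V_nth)
  then show ?thesis
    unfolding autos_def using Sg_one permutes_id
    by (intro CollectI exI[of _ id] exI[of _ "\<lambda>_. 1"] exI[of _ "\<lambda>_. 0"]) auto
qed

lemma autos_compose:
  assumes "g \<in> autos" "h \<in> autos"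
  shows "compose V g h \<in> autos"
proof -
  obtain \<pi> \<sigma> t where g: "\<pi> permutes {..<d}" "\<And>n. \<sigma> n \<in> Sg" "even (\<Sum>n<d. t n)"
    "g = restrict (aff \<pi> \<sigma> t) V" using assms(1) autos_cases by blast
  obtain \<pi>' \<sigma>' t' where h: "\<pi>' permutes {..<d}" "\<And>n. \<sigma>' n \<in> Sg" "even (\<Sum>n<d. t' n)"
    "h = restrict (aff \<pi>' \<sigma>' t') V" using assms(2) autos_cases by blast
  define \<sigma>'' where "\<sigma>'' n = (\<sigma> n * \<sigma>' (\<pi> n)) mod m" for n
  define t'' where "t'' n = t n + \<sigma> n * t' (\<pi> n)" for n
  have eq: "aff \<pi> \<sigma> t (aff \<pi>' \<sigma>' t' v) = aff (\<pi>' \<circ> \<pi>) \<sigma>'' t'' v" for v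
  proof (rule V_eqI)
    fix n assume n: "n < d"
    then have "\<pi> n < d" using perm_lt[OF g(1)] g(2) by blast
    then have "aff \<pi> \<sigma> t (aff \<pi>' \<sigma>' t' v) ! n
        = (t n + \<sigma> n * (t' (\<pi> n) + \<sigma>' (\<pi> n) * v ! \<pi>' (\<pi> n))) mod m"
      using n by (simp add: aff_nth) (metis mod_add_right_eq mod_mult_right_eq)
    also have "\<dots> = (t'' n + \<sigma> n * \<sigma>' (\<pi> n) * v ! \<pi>' (\<pi> n)) mod m"
      by (simp add: t''_def algebra_simps)
    also have "\<dots> = aff (\<pi>' \<circ> \<pi>) \<sigma>'' t'' v ! n"
      using n by (simp add: aff_nth \<sigma>''_def) (metis mod_add_right_eq mod_mult_left_eq)
    finally show "aff \<pi> \<sigma> t (aff \<pi>' \<sigma>' t' v) ! n = aff (\<pi>' \<circ> \<pi>) \<sigma>'' t'' v ! n" .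
  qed (auto intro: aff_in_V)
  have "even (\<Sum>n\<in>S. \<sigma> n * t' (\<pi> n)) \<longleftrightarrow> even (\<Sum>n\<in>S. t' (\<pi> n))" if "finite S" for S
    using that by induction (use Sg_odd[OF g(2)] in auto)
  moreover have "(\<Sum>n<d. t' (\<pi> n)) = (\<Sum>n<d. t' n)"
    using sum.permute[OF g(1), of t'] by (simp add: comp_def)
  ultimately have ev: "even (\<Sum>n<d. t'' n)"
    using g(3) h(3) by (simp add: t''_def sum.distrib)
  have "compose V g h = restrict (aff (\<pi>' \<circ> \<pi>) \<sigma>'' t'') V"
    unfolding compose_def g(4) h(4) by (rule restrict_ext) (simp add: aff_in_V eq)
  moreover have "\<forall>n. \<sigma>'' n \<in> Sg" unfolding \<sigma>''_def using Sg_mult g(2) h(2) by blast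
  ultimately show ?thesis
    unfolding autos_def using permutes_compose[OF g(1) h(1)] ev by blast
qed

lemma autos_subset_image:
  "autos \<subseteq> (\<lambda>(\<pi>, \<sigma>, t). restrict (aff \<pi> \<sigma> t) V) `
     ((\<Pi>\<^sub>E n\<in>{..<d}. {..<d}) \<times> (\<Pi>\<^sub>E n\<in>{..<d}. Sg) \<times> (\<Pi>\<^sub>E n\<in>{..<d}. {..<m}))"
  (is "_ \<subseteq> ?f ` ?P")
proof
  fix g assume "g \<in> autos"
  then obtain \<pi> \<sigma> t where g: "\<pi> permutes {..<d}" "\<And>n. \<sigma> n \<in> Sg"
    "g = restrict (aff \<pi> \<sigma> t) V" using autos_cases by blast
  let ?p = "(restrict \<pi> {..<d}, restrict \<sigma> {..<d}, restrict (\<lambda>n. t n mod m) {..<d})"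
  have "aff \<pi> \<sigma> t v = aff (restrict \<pi> {..<d}) (restrict \<sigma> {..<d}) (restrict (\<lambda>n. t n mod m) {..<d}) v" for v
    by (rule V_eqI) (auto simp: aff_nth aff_in_V mod_simps)
  then have "g = ?f ?p" unfolding g(3) by (auto intro!: restrict_ext)
  moreover have "?p \<in> ?P" using g perm_lt[OF g(1)] m_ge2 by auto
  ultimately show "g \<in> ?f ` ?P" by blast
qed

text \<open>Permutations are counted crudely among all \<open>d ^ d\<close> self-maps of the
  coordinates: the union bound in \<open>defect_tail\<close> tolerates any factor
  \<open>exp (O (d ln d))\<close>.\<close>

lemma finite_autos: "finite autos" and card_autos: "card autos \<le> (2 * m * d) ^ d"
proof -
  let ?P = "(\<Pi>\<^sub>E n\<in>{..<d}. {..<d}) \<times> (\<Pi>\<^sub>E n\<in>{..<d}. Sg) \<times> (\<Pi>\<^sub>E n\<in>{..<d}. {..<m})"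
  have fin: "finite ?P" by (intro finite_cartesian_product finite_PiE) (auto simp: finite_Sg)
  then show "finite autos" using autos_subset_image finite_surj by blast
  have "card autos \<le> card ?P" using surj_card_le[OF fin autos_subset_image] .
  also have "\<dots> = d ^ d * (card Sg ^ d * m ^ d)"
    by (simp add: card_cartesian_product card_PiE)
  also have "\<dots> \<le> d ^ d * (2 ^ d * m ^ d)"
    using card_Sg by (intro mult_le_mono power_mono) auto
  finally show "card autos \<le> (2 * m * d) ^ d" by (simp add: power_mult_distrib algebra_simps)
qed

lemma card_autos_pos: "card autos > 0"
  using finite_autos id_in_autos card_gt_0_iff by blast

lemma autos_extensional: "g \<in> autos \<Longrightarrow> g \<in> extensional V"
  by (auto simp: autos_def)

lemma bij_compose_autos:
  assumes "h \<in> autos"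
  shows "bij_betw (\<lambda>g. compose V g h) autos autos"
proof -
  have inj: "inj_on (\<lambda>g. compose V g h) autos"
  proof (rule inj_onI)
    fix g g' assume g: "g \<in> autos" "g' \<in> autos" "compose V g h = compose V g' h"
    show "g = g'"
    proof (rule extensionalityI[of _ V])
      show "g \<in> extensional V" "g' \<in> extensional V" using g autos_extensional by auto
      fix x assume "x \<in> V"
      then obtain y where "y \<in> V" "x = h y" using autos_bij[OF assms] by (auto simp: bij_betw_def)
      then show "g x = g' x" using g(3) by (metis compose_eq)
    qed
  qed
  have "(\<lambda>g. compose V g h) ` autos = autos"
    by (rule endo_inj_surj[OF finite_autos _ inj]) (use autos_compose assms in auto)
  then show ?thesis using inj by (simp add: bij_betw_def)
qed

text \<open>Right multiplication by \<open>h\<close> permutes \<open>autos\<close>. This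
  substitution is what makes averages over \<open>autos\<close> exchangeable.\<close>

lemma sum_autos_shift:
  "h \<in> autos \<Longrightarrow> (\<Sum>g\<in>autos. F (compose V g h)) = (\<Sum>g\<in>autos. F g)"
  by (rule sum.reindex_bij_betw[OF bij_compose_autos])

text \<open>Permutation and signs are free, and the translation is then forced by \<open>u\<close>
  and \<open>u'\<close>; equality of the parities is exactly what makes it even. The last clause
  records the action on every neighbour of \<open>u\<close>.\<close>

lemma ex_auto:
  assumes "u \<in> V" "u' \<in> V" "even (sum_list u) \<longleftrightarrow> even (sum_list u')"
    and perm: "\<pi> permutes {..<d}" and sgn: "\<And>n. \<sigma> n \<in> Sg"
  shows "\<exists>h\<in>autos. h u = u' \<and> (\<forall>n<d. \<forall>s. h (nb (\<pi> n) s u) = nb n ((\<sigma> n * s) mod m) u')"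
proof -
  \<comment> \<open>\<open>m - u ! (\<pi> n)\<close> stands for the negative coordinate modulo
    \<open>m\<close>, so that the translation stays in the naturals.\<close>
  define t where "t n = u' ! n + \<sigma> n * (m - u ! (\<pi> n))" for n
  have u': "aff \<pi> \<sigma> t u = u'"
  proof (rule V_eqI)
    fix n assume n: "n < d"
    then have "u ! \<pi> n < m" using V_nth[OF assms(1)] perm_lt[OF perm sgn] by blast
    then have "t n + \<sigma> n * u ! \<pi> n = u' ! n + \<sigma> n * m"
      unfolding t_def by (metis add.assoc distrib_left le_add_diff_inverse2 less_imp_le)
    then show "aff \<pi> \<sigma> t u ! n = u' ! n"
      using n V_nth[OF assms(2)] by (simp add: aff_nth)
  qed (use assms in \<open>auto intro: aff_in_V\<close>)
  have "even (sum_list u') \<longleftrightarrow> even ((\<Sum>n<d. t n) + sum_list u)"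
    using aff_parity[where \<sigma> = \<sigma> and t = t, OF perm sgn assms(1)] unfolding u' .
  then have "even (\<Sum>n<d. t n)" using assms(3) by auto
  then have "restrict (aff \<pi> \<sigma> t) V \<in> autos" unfolding autos_def using perm sgn by blast
  moreover have "restrict (aff \<pi> \<sigma> t) V u = u'" using u' assms(1) by simp
  moreover have "restrict (aff \<pi> \<sigma> t) V (nb (\<pi> n) s u) = nb n ((\<sigma> n * s) mod m) u'" if "n < d" for n s
    using aff_nb[where \<sigma> = \<sigma>, OF perm sgn assms(1) that] u' perm_lt[OF perm sgn that] assms(1)
    by (simp add: nb_in_V)
  ultimately show ?thesis by blast
qed

lemma transitive_auto:
  assumes "u \<in> V" "u' \<in> V" "even (sum_list u) \<longleftrightarrow> even (sum_list u')"
  shows "\<exists>h\<in>autos. h u = u'"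
proof -
  have "\<And>n. (\<lambda>_. 1) n \<in> Sg" by (simp only: Sg_one)
  from ex_auto[OF assms permutes_id this] show ?thesis by blast
qed

lemma swap_auto:
  assumes "u \<in> V" "i < d" "j < d" "i \<noteq> j" "s \<in> Sg" "r \<in> Sg"
  obtains h where "h \<in> autos" "h (nb i s u) = nb j r u" "h (nb j r u) = nb i s u"
    "\<And>n q. n < d \<Longrightarrow> n \<noteq> i \<Longrightarrow> n \<noteq> j \<Longrightarrow> q \<in> Sg \<Longrightarrow> h (nb n q u) = nb n q u"
proof -
  define \<pi> where "\<pi> = transpose i j"
  \<comment> \<open>Signs square to one modulo \<open>m\<close>, so the single sign
    \<open>s * r\<close> on both coordinates turns \<open>s\<close> into \<open>r\<close> and
    \<open>r\<close> into \<open>s\<close>.\<close>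
  define \<sigma> where "\<sigma> n = (if n = i \<or> n = j then (s * r) mod m else 1)" for n
  have \<sigma>: "\<sigma> n \<in> Sg" for n using Sg_mult[OF assms(5,6)] Sg_one by (simp add: \<sigma>_def)
  have "\<pi> permutes {..<d}" unfolding \<pi>_def using assms by (intro permutes_swap_id) auto
  from ex_auto[where \<sigma> = \<sigma>, OF assms(1) assms(1) refl this \<sigma>]
  obtain h where h: "h \<in> autos"
    "\<And>n s. n < d \<Longrightarrow> h (nb (\<pi> n) s u) = nb n ((\<sigma> n * s) mod m) u" by blast
  have sq: "(s * r mod m * s) mod m = r" "(s * r mod m * r) mod m = s"
  proof -
    have "(s * r mod m * s) mod m = ((s * s) mod m * r) mod m" by (simp add: mod_simps algebra_simps)
    then show "(s * r mod m * s) mod m = r" using Sg_square[OF assms(5)] Sg_range[OF assms(6)] by simp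
    have "(s * r mod m * r) mod m = ((r * r) mod m * s) mod m" by (simp add: mod_simps algebra_simps)
    then show "(s * r mod m * r) mod m = s" using Sg_square[OF assms(6)] Sg_range[OF assms(5)] by simp
  qed
  show thesis
  proof
    show "h \<in> autos" by fact
    show "h (nb i s u) = nb j r u" using h(2)[OF assms(3), of s] sq by (simp add: \<pi>_def \<sigma>_def)
    show "h (nb j r u) = nb i s u" using h(2)[OF assms(2), of r] sq by (simp add: \<pi>_def \<sigma>_def)
    show "h (nb n q u) = nb n q u" if "n < d" "n \<noteq> i" "n \<noteq> j" "q \<in> Sg" for n q
      using h(2)[OF that(1), of q] that Sg_range[OF that(4)] by (simp add: \<pi>_def \<sigma>_def)
  qed
qed

lemma pair_auto:
  assumes "u \<in> Ev" "k < d" "l < d" "k \<noteq> l" "r \<in> Sg" "r' \<in> Sg"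
  obtains h where "h \<in> autos" "h (nb 0 1 (replicate d 0)) = nb k r u"
    "h (nb 1 1 (replicate d 0)) = nb l r' u"
proof -
  have d: "0 < d" "1 < d" using assms by auto
  \<comment> \<open>\<open>x\<close> is where the first transposition sends \<open>l\<close>. The
    composite then maps \<open>k\<close> to \<open>0\<close> and \<open>l\<close> to
    \<open>1\<close>, also when these indices overlap with \<open>0\<close> and
    \<open>1\<close>.\<close>
  define x where "x = transpose 0 k l"
  define \<pi> where "\<pi> = transpose 1 x \<circ> transpose 0 k"
  have x: "x < d" "x \<noteq> 0" using assms d by (auto simp: x_def transpose_def)
  have perm: "\<pi> permutes {..<d}" unfolding \<pi>_def
    using assms d x by (intro permutes_compose permutes_swap_id) auto
  have \<pi>: "\<pi> k = 0" "\<pi> l = 1" using x by (auto simp: \<pi>_def transpose_def x_def)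
  define \<sigma> where "\<sigma> n = (if n = k then r else r')" for n
  have \<sigma>: "\<sigma> n \<in> Sg" for n using assms by (simp add: \<sigma>_def)
  have Z: "replicate d 0 \<in> V" "even (sum_list (replicate d (0::nat))) \<longleftrightarrow> even (sum_list u)"
    using zero_in_Ev assms(1) by (auto simp: even_class_def)
  from ex_auto[where \<sigma> = \<sigma>, OF Z(1) Ev_V[OF assms(1)] Z(2) perm \<sigma>]
  obtain h where h: "h \<in> autos"
    "\<And>n s. n < d \<Longrightarrow> h (nb (\<pi> n) s (replicate d 0)) = nb n ((\<sigma> n * s) mod m) u" by blast
  show thesis
  proof
    show "h \<in> autos" by fact
    show "h (nb 0 1 (replicate d 0)) = nb k r u" 
      using h(2)[OF assms(2), of 1] \<pi> Sg_range[OF assms(5)] by (simp add: \<sigma>_def)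
    show "h (nb 1 1 (replicate d 0)) = nb l r' u"
      using h(2)[OF assms(3), of 1] \<pi> Sg_range[OF assms(6)] assms(4) by (simp add: \<sigma>_def)
  qed
qed

text \<open>The witness is the translation by one along coordinate \<open>0\<close>, whose total
  translation is odd. It carries statements about \<open>Od\<close> over to
  \<open>Ev\<close>.\<close>

lemma ex_class_swap:
  assumes "d \<ge> 1"
  obtains t where "bij_betw t V V" "\<And>v. v \<in> V \<Longrightarrow> t ` nbrs v = nbrs (t v)"
    "bij_betw t Ev Od" "bij_betw t Od Ev"
proof -
  define t where "t = aff id (\<lambda>_. 1) (\<lambda>n. if n = 0 then 1 else 0)"
  have bij: "bij_betw t V V" unfolding t_def using Sg_one by (intro aff_bij permutes_id)
  have par: "even (sum_list (t v)) \<longleftrightarrow> odd (sum_list v)" if "v \<in> V" for v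
    unfolding t_def using assms Sg_one that by (subst aff_parity[OF permutes_id]) (auto simp: sum.delta)
  have V: "t v \<in> V" for v by (simp add: t_def aff_in_V)
  have EO: "t ` Ev \<subseteq> Od" "t ` Od \<subseteq> Ev" by (auto simp: even_class_def odd_class_def par V)
  have inj: "inj_on t Ev" "inj_on t Od" 
    using inj_on_subset[OF bij_betw_imp_inj_on[OF bij]] Ev_V Od_V by blast+
  have "t ` Ev = Od" using EO(1) card_Ev_Od[OF assms] card_image[OF inj(1)] finite_Od
    by (metis card_subset_eq)
  moreover have "t ` Od = Ev" using EO(2) card_Ev_Od[OF assms] card_image[OF inj(2)] finite_Ev
    by (metis card_subset_eq)
  moreover have "t ` nbrs v = nbrs (t v)" if "v \<in> V" for v
    unfolding t_def using that Sg_one by (intro aff_nbrs permutes_id)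
  ultimately show thesis using that bij inj by (auto simp: bij_betw_def)
qed

end

subsection \<open>Two covering codes\<close>

lemma finite_pigeonhole_small_fibre:
  assumes "finite S" "finite G" "G \<noteq> {}"
  shows "\<exists>\<gamma>\<in>G. card {v \<in> S. \<chi> v = \<gamma>} * card G \<le> card S"
proof (rule ccontr)
  assume "\<not> ?thesis"
  then have lt: "\<And>\<gamma>. \<gamma> \<in> G \<Longrightarrow> card S < card {v \<in> S. \<chi> v = \<gamma>} * card G" by force
  have "card G * card S = (\<Sum>\<gamma>\<in>G. card S)" by simp
  also have "\<dots> < (\<Sum>\<gamma>\<in>G. card {v \<in> S. \<chi> v = \<gamma>} * card G)"
    using assms lt by (intro sum_strict_mono) auto
  also have "\<dots> = (\<Sum>\<gamma>\<in>G. card {v \<in> S. \<chi> v = \<gamma>}) * card G" by (simp add: sum_distrib_right)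
  also have "(\<Sum>\<gamma>\<in>G. card {v \<in> S. \<chi> v = \<gamma>}) = card (\<Union>\<gamma>\<in>G. {v \<in> S. \<chi> v = \<gamma>})"
    using assms by (intro card_UN_disjoint[symmetric]) auto
  also have "\<dots> \<le> card S" using assms(1) by (intro card_mono) auto
  finally show False by (simp add: mult.commute)
qed

lemma ex_power_scale:
  fixes m K n :: nat
  assumes "m \<ge> 2" "K \<ge> 1" "n \<ge> K"
  shows "\<exists>r. m ^ r * K \<le> n \<and> n < m * m ^ r * K"
proof -
  define r where "r = (GREATEST r. m ^ r * K \<le> n)"
  have bd: "r \<le> n" if "m ^ r * K \<le> n" for r
  proof -
    have "r < 2 ^ r" by (rule less_exp)
    also have "(2::nat) ^ r \<le> m ^ r" using assms(1) by (rule power_mono) simp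
    also have "\<dots> \<le> m ^ r * K" using assms(2) by simp
    finally show ?thesis using that by simp
  qed
  have "m ^ 0 * K \<le> n" using assms by simp
  then have 1: "m ^ r * K \<le> n" unfolding r_def using bd by (rule GreatestI_nat)
  have "\<not> m ^ Suc r * K \<le> n"
  proof
    assume "m ^ Suc r * K \<le> n"
    then have "Suc r \<le> r" unfolding r_def[symmetric]
      using Greatest_le_nat[of "\<lambda>r. m ^ r * K \<le> n" "Suc r" n] bd r_def by blast
    then show False by simp
  qed
  then show ?thesis using 1 by (intro exI[of _ r]) (simp add: not_le)
qed

context even_torus
begin

text \<open>A linear syndrome map to \<open>(\<int>/m)^r\<close> whose column set covers every syndrome at least \<open>K\<close> times.\<close>

lemma ex_syndrome:
  assumes "K \<ge> 1" "len \<ge> K" "lo + len \<le> d"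
  obtains G :: "nat list set" and \<chi> where "finite G" "G \<noteq> {}" "len < m * card G * K"
    "\<And>v \<gamma>. v \<in> V \<Longrightarrow> \<gamma> \<in> G \<Longrightarrow> K \<le> card {i. lo \<le> i \<and> i < lo + len \<and> \<chi> (nb i 1 v) = \<gamma>}"
    "\<And>v i. v \<in> V \<Longrightarrow> i < d \<Longrightarrow> \<not> (lo \<le> i \<and> i < lo + len) \<Longrightarrow> \<chi> (nb i 1 v) = \<chi> v"
proof -
  obtain r where r: "m ^ r * K \<le> len" "len < m * m ^ r * K"
    using ex_power_scale[OF m_ge2 assms(1,2)] by blast
  define n where "n = m ^ r"
  have n: "n > 0" using m_ge2 by (simp add: n_def)
  define G where "G = torus_verts m r"
  interpret R: even_torus m r by unfold_locales (rule m_even, rule m_ge2)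
  have finG: "finite G" and cardG: "card G = n" by (simp_all add: G_def R.finite_V R.card_V n_def)
  then obtain b where b: "bij_betw b {0..<n} G" using ex_bij_betw_nat_finite by metis
  \<comment> \<open>The columns run cyclically through all of \<open>G\<close>. The window has
    length at least \<open>n * K\<close>, so each column occurs in it at least \<open>K\<close>
    times.\<close>
  define a where "a i = b ((i - lo) mod n)" for i
  define J where "J = {i. lo \<le> i \<and> i < lo + len}"
  have J: "finite J" "J \<subseteq> {..<d}" using assms(3) by (auto simp: J_def)
  define \<chi> where "\<chi> v = map (\<lambda>t. (\<Sum>i\<in>J. a i ! t * v ! i) mod m) [0..<r]" for v
  have \<chi>_nth: "\<chi> v ! t = (\<Sum>i\<in>J. a i ! t * v ! i) mod m" if "t < r" for v t
    using that by (simp add: \<chi>_def)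
  have \<chi>G: "\<chi> v \<in> G" for v
    unfolding G_def using m_ge2 by (intro R.V_I) (auto simp: \<chi>_nth, simp add: \<chi>_def)
  have step: "\<chi> (nb i 1 v) ! t = (a i ! t + \<chi> v ! t) mod m" if "i \<in> J" "v \<in> V" "t < r" for i v t
  proof -
    have id: "i < d" using that J by auto
    have "(\<Sum>j\<in>J. a j ! t * nb i 1 v ! j) = a i ! t * ((v ! i + 1) mod m) + (\<Sum>j\<in>J - {i}. a j ! t * v ! j)"
      using that J id by (subst sum.remove[of _ i]) (auto simp: nb_nth)
    moreover have "(\<Sum>j\<in>J. a j ! t * v ! j) = a i ! t * v ! i + (\<Sum>j\<in>J - {i}. a j ! t * v ! j)"
      using that J by (subst sum.remove[of _ i]) auto
    moreover have "(a i ! t * ((v ! i + 1) mod m) + z) mod m = (a i ! t + (a i ! t * v ! i + z)) mod m" for z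
    proof -
      have "(a i ! t * ((v ! i + 1) mod m) + z) mod m = (a i ! t * (v ! i + 1) + z) mod m"
        by (metis mod_add_left_eq mod_mult_right_eq)
      then show ?thesis by (simp add: algebra_simps)
    qed
    ultimately show ?thesis using that by (simp add: \<chi>_nth mod_add_right_eq)
  qed
  have many: "K \<le> card {i \<in> J. \<chi> (nb i 1 v) = \<gamma>}" if v: "v \<in> V" and \<gamma>: "\<gamma> \<in> G" for v \<gamma>
  proof -
    \<comment> \<open>A unit step in coordinate \<open>i\<close> adds the column \<open>a i\<close>
      to the syndrome. The column required is thus \<open>\<gamma> - \<chi> v\<close>, and it stands
      at the offsets \<open>c + n * k\<close>.\<close>
    define w where "w = map (\<lambda>t. (\<gamma> ! t + (m - \<chi> v ! t)) mod m) [0..<r]"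
    have "w \<in> G" unfolding G_def using m_ge2 by (intro R.V_I) (auto simp: w_def)
    then obtain c where c: "c < n" "b c = w" using b by (auto simp: bij_betw_def)
    have "(\<lambda>k. lo + (c + n * k)) ` {..<K} \<subseteq> {i \<in> J. \<chi> (nb i 1 v) = \<gamma>}"
    proof (rule image_subsetI)
      fix k assume k: "k \<in> {..<K}"
      let ?i = "lo + (c + n * k)"
      have "c + n * k < n + n * k" using c by simp
      also have "\<dots> = n * Suc k" by simp
      also have "\<dots> \<le> n * K" using k by (intro mult_le_mono2) auto
      also have "\<dots> \<le> len" using r by (simp add: n_def)
      finally have iJ: "?i \<in> J" by (simp add: J_def)
      have ai: "a ?i = w" using c by (simp add: a_def)
      have "\<chi> (nb ?i 1 v) = \<gamma>"
      proof (rule R.V_eqI)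
        fix t assume t: "t < r"
        have "\<chi> v ! t < m" "\<gamma> ! t < m" using R.V_nth \<chi>G \<gamma> t unfolding G_def by auto
        moreover have "\<chi> (nb ?i 1 v) ! t = ((\<gamma> ! t + (m - \<chi> v ! t)) mod m + \<chi> v ! t) mod m"
          using step[OF iJ v t] ai t by (simp add: w_def)
        moreover have "((\<gamma> ! t + (m - \<chi> v ! t)) mod m + \<chi> v ! t) mod m
          = (\<gamma> ! t + (m - \<chi> v ! t) + \<chi> v ! t) mod m" by (rule mod_add_left_eq)
        ultimately show "\<chi> (nb ?i 1 v) ! t = \<gamma> ! t" by simp
      qed (use \<chi>G \<gamma> G_def in auto)
      then show "?i \<in> {i \<in> J. \<chi> (nb i 1 v) = \<gamma>}" using iJ by simp
    qed
    moreover have "inj_on (\<lambda>k. lo + (c + n * k)) {..<K}" using n by (auto intro!: inj_onI)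
    ultimately show ?thesis
      using card_mono[of "{i \<in> J. \<chi> (nb i 1 v) = \<gamma>}" "(\<lambda>k. lo + (c + n * k)) ` {..<K}"] J
      by (simp add: card_image)
  qed
  have same: "\<chi> (nb i 1 v) = \<chi> v" if "v \<in> V" "i < d" "i \<notin> J" for v i
    unfolding \<chi>_def using that by (intro map_cong refl arg_cong2[where f = "(mod)"] sum.cong) (auto simp: nb_nth)
  have ne: "G \<noteq> {}" using \<chi>G by blast
  show thesis
  proof (rule that)
    show "finite G" "G \<noteq> {}" by fact+
    show "len < m * card G * K" using r by (simp add: cardG n_def)
    show "K \<le> card {i. lo \<le> i \<and> i < lo + len \<and> \<chi> (nb i 1 v) = \<gamma>}" if "v \<in> V" "\<gamma> \<in> G" for v \<gamma>
      using many[OF that] by (simp add: J_def conj_assoc)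
    show "\<chi> (nb i 1 v) = \<chi> v" if "v \<in> V" "i < d" "\<not> (lo \<le> i \<and> i < lo + len)" for v i
      using same that by (simp add: J_def)
  qed
qed

text \<open>\<open>T\<close> is a fibre of the syndrome on \<open>Od\<close>. Covering holds for
  every syndrome value, so the value can be chosen by pigeonhole to make the fibre small.\<close>

lemma ex_sample_code:
  assumes "K \<ge> 1" "d \<ge> K"
  shows "\<exists>T\<subseteq>Od. card T * d \<le> card Od * (m * K) \<and>
     (\<forall>u\<in>Ev. K \<le> card {i. i < d \<and> nb i 1 u \<in> T})"
proof -
  have le0d: "0 + d \<le> d" by simp
  obtain G :: "nat list set" and \<chi> where G: "finite G" "G \<noteq> {}" "d < m * card G * K"
    and many: "\<And>v \<gamma>. v \<in> V \<Longrightarrow> \<gamma> \<in> G \<Longrightarrow> K \<le> card {i. 0 \<le> i \<and> i < 0 + d \<and> \<chi> (nb i 1 v) = \<gamma>}"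
  proof (rule ex_syndrome[of K d 0, OF assms le0d], goal_cases)
    case (1 G \<chi>)
    show ?case by (rule that[of G \<chi>]) (use 1 in auto)
  qed
  obtain \<gamma> where \<gamma>: "\<gamma> \<in> G" "card {v \<in> Od. \<chi> v = \<gamma>} * card G \<le> card Od"
    using finite_pigeonhole_small_fibre[OF finite_Od G(1,2)] by blast
  let ?T = "{v \<in> Od. \<chi> v = \<gamma>}"
  have "card ?T * d \<le> card ?T * (m * card G * K)" using G(3) by (intro mult_le_mono2) simp
  also have "\<dots> = card ?T * card G * (m * K)" by (simp add: algebra_simps)
  also have "\<dots> \<le> card Od * (m * K)" using \<gamma>(2) by (rule mult_le_mono1)
  finally have c: "card ?T * d \<le> card Od * (m * K)" .
  have "K \<le> card {i. i < d \<and> nb i 1 u \<in> ?T}" if u: "u \<in> Ev" for u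
  proof -
    have "{i. i < d \<and> nb i 1 u \<in> ?T} = {i. 0 \<le> i \<and> i < 0 + d \<and> \<chi> (nb i 1 u) = \<gamma>}"
      using nb_Ev[OF u _ Sg_one] by auto
    then show ?thesis using many[OF Ev_V[OF u] \<gamma>(1)] by metis
  qed
  then show ?thesis using c by (intro exI[of _ ?T]) auto
qed

text \<open>Two syndromes use the two halves of the coordinates. A step in the first half corrects
  the first syndrome; a step in the second half then corrects the second without disturbing the
  first. The two directions differ automatically, as \<open>dis_two_step\<close> demands.\<close>

lemma ex_sparse_code:
  assumes "d \<ge> 2"
  shows "\<exists>S\<subseteq>Od. card S * d ^ 2 \<le> card Od * (9 * m ^ 2) \<and>
     (\<forall>v\<in>Od. \<exists>i<d. \<exists>j<d. i \<noteq> j \<and> nb j 1 (nb i 1 v) \<in> S)"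
proof -
  define k where "k = d div 2"
  \<comment> \<open>The factors \<open>3\<close> absorb the rounding in the halving
    (\<open>d = 3\<close> is the tight case) and multiply to the \<open>9\<close> of the
    statement.\<close>
  have k: "k \<ge> 1" "k + (d - k) \<le> d" "d \<le> 3 * k" "d - k \<ge> 1" "d \<le> 3 * (d - k)" "0 + k \<le> d"
    using assms by (auto simp: k_def)
  obtain G :: "nat list set" and \<chi> where G: "finite G" "G \<noteq> {}" "k < m * card G * 1"
    and many: "\<And>v \<gamma>. v \<in> V \<Longrightarrow> \<gamma> \<in> G \<Longrightarrow> 1 \<le> card {i. 0 \<le> i \<and> i < 0 + k \<and> \<chi> (nb i 1 v) = \<gamma>}"
    and fixd: "\<And>v i. v \<in> V \<Longrightarrow> i < d \<Longrightarrow> \<not> (0 \<le> i \<and> i < 0 + k) \<Longrightarrow> \<chi> (nb i 1 v) = \<chi> v"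
  proof (rule ex_syndrome[of 1 k 0, OF le_refl k(1) k(6)], goal_cases)
    case (1 G \<chi>)
    show ?case by (rule that[of G \<chi>]) (use 1 in auto)
  qed
  obtain G' :: "nat list set" and \<chi>' where G': "finite G'" "G' \<noteq> {}" "d - k < m * card G' * 1"
    and many': "\<And>v \<gamma>. v \<in> V \<Longrightarrow> \<gamma> \<in> G' \<Longrightarrow> 1 \<le> card {i. k \<le> i \<and> i < k + (d - k) \<and> \<chi>' (nb i 1 v) = \<gamma>}"
  proof (rule ex_syndrome[of 1 "d - k" k, OF le_refl k(4) k(2)], goal_cases)
    case (1 G \<chi>)
    show ?case by (rule that[of G \<chi>]) (use 1 in auto)
  qed
  obtain \<gamma> where \<gamma>: "\<gamma> \<in> G \<times> G'" "card {v \<in> Od. (\<chi> v, \<chi>' v) = \<gamma>} * card (G \<times> G') \<le> card Od"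
    using finite_pigeonhole_small_fibre[OF finite_Od, of "G \<times> G'" "\<lambda>v. (\<chi> v, \<chi>' v)"] G G' by blast
  let ?S = "{v \<in> Od. (\<chi> v, \<chi>' v) = \<gamma>}"
  have "d ^ 2 \<le> (3 * k) * (3 * (d - k))" unfolding power2_eq_square using k by (intro mult_le_mono)
  also have "\<dots> \<le> (3 * (m * card G)) * (3 * (m * card G'))"
    using G(3) G'(3) by (intro mult_le_mono) auto
  finally have "d ^ 2 \<le> 9 * m ^ 2 * card (G \<times> G')"
    by (simp add: card_cartesian_product power2_eq_square algebra_simps)
  then have "card ?S * d ^ 2 \<le> card ?S * (9 * m ^ 2 * card (G \<times> G'))" by (rule mult_le_mono2)
  also have "\<dots> = card ?S * card (G \<times> G') * (9 * m ^ 2)" by (simp add: algebra_simps)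
  also have "\<dots> \<le> card Od * (9 * m ^ 2)" using \<gamma>(2) by (rule mult_le_mono1)
  finally have c: "card ?S * d ^ 2 \<le> card Od * (9 * m ^ 2)" .
  have "\<exists>i<d. \<exists>j<d. i \<noteq> j \<and> nb j 1 (nb i 1 v) \<in> ?S" if v: "v \<in> Od" for v
  proof -
    have "{i. 0 \<le> i \<and> i < 0 + k \<and> \<chi> (nb i 1 v) = fst \<gamma>} \<noteq> {}"
      using many[OF Od_V[OF v], of "fst \<gamma>"] \<gamma>(1) by (metis card.empty mem_Times_iff not_one_le_zero)
    then obtain i where i: "i < k" "\<chi> (nb i 1 v) = fst \<gamma>" by auto
    have id: "i < d" using i k by auto
    have vi: "nb i 1 v \<in> Ev" using nb_Od[OF v id Sg_one] .
    have "{j. k \<le> j \<and> j < k + (d - k) \<and> \<chi>' (nb j 1 (nb i 1 v)) = snd \<gamma>} \<noteq> {}"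
      using many'[OF Ev_V[OF vi], of "snd \<gamma>"] \<gamma>(1) by (metis card.empty mem_Times_iff not_one_le_zero)
    then obtain j where j: "k \<le> j" "j < d" "\<chi>' (nb j 1 (nb i 1 v)) = snd \<gamma>" by auto
    have "\<chi> (nb j 1 (nb i 1 v)) = fst \<gamma>" using fixd[OF Ev_V[OF vi] j(2)] j(1) i(2) by simp
    then have "nb j 1 (nb i 1 v) \<in> ?S" using j(3) nb_Ev[OF vi j(2) Sg_one] by (cases \<gamma>) simp
    then show ?thesis using id j i by (intro exI[of _ i] conjI exI[of _ j]) auto
  qed
  then show ?thesis using c by (intro exI[of _ ?S]) auto
qed

end

subsection \<open>Averaging over automorphisms\<close>

lemma card_filter_eq_sum: "finite A \<Longrightarrow> real (card {x \<in> A. P x}) = (\<Sum>x\<in>A. of_bool (P x))"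
  by (simp add: of_bool_def sum.If_cases Int_def)

text \<open>An upper bound for \<open>log (\<lambda>(I) \<lambda>(N(Q)) / \<eta>)\<close>; see \<open>ex_psi_constants\<close>.\<close>

definition psi :: "real \<Rightarrow> real \<Rightarrow> ('b set \<Rightarrow> bool) \<Rightarrow> 'b set \<Rightarrow> 'b set \<Rightarrow> real" where
  "psi L \<kappa> P I Q = (if \<not> I \<subseteq> Q then L else if I = Q \<and> P Q then 0 else - \<kappa>)"

text \<open>At most \<open>|W|\<close> indices \<open>j\<close> can violate \<open>(\<Inter>i\<noteq>j. x i) \<subseteq> x j\<close>, since each of them owns an element missing only
  from \<open>x j\<close>; and if there is one, every other index contributes \<open>-\<kappa>\<close>.\<close>

lemma sum_psi_leave_one_out:
  fixes x :: "'a \<Rightarrow> 'b set"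
  assumes J: "finite J" "a \<in> J" "b \<in> J" "a \<noteq> b" and W: "finite W" "\<And>j. j \<in> J \<Longrightarrow> x j \<subseteq> W"
    and L: "L \<ge> 0" "\<kappa> > 0" "real (card W) * L + \<kappa> \<le> \<kappa> * (real (card J) - real (card W))"
  shows "(\<Sum>j\<in>J. psi L \<kappa> P (\<Inter>i\<in>J - {j}. x i) (x j)) \<le> - \<kappa> * of_bool (x a \<noteq> x b \<or> \<not> P (x a))"
proof -
  define I where "I j = (\<Inter>i\<in>J - {j}. x i)" for j
  define Piv where "Piv = {j \<in> J. \<not> I j \<subseteq> x j}"
  have finP: "finite Piv" using J by (simp add: Piv_def)
  have PivJ: "Piv \<subseteq> J" by (auto simp: Piv_def)
  show ?thesis
  proof (cases "Piv = {}")
    case True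
    then have sub: "\<And>j. j \<in> J \<Longrightarrow> I j \<subseteq> x j" by (auto simp: Piv_def)
    then have eq: "I j = (\<Inter>i\<in>J. x i)" if "j \<in> J" for j using that by (auto simp: I_def)
    have le0: "psi L \<kappa> P (I j) (x j) \<le> 0" if "j \<in> J" for j using sub[OF that] L by (simp add: psi_def)
    show ?thesis
    proof (cases "x a \<noteq> x b \<or> \<not> P (x a)")
      case True
      have "\<exists>j\<in>J. psi L \<kappa> P (I j) (x j) = - \<kappa>"
      proof (cases "P (x a)")
        case True
        then have "x a \<noteq> x b" using \<open>x a \<noteq> x b \<or> \<not> P (x a)\<close> by simp
        then have "x a \<noteq> (\<Inter>i\<in>J. x i) \<or> x b \<noteq> (\<Inter>i\<in>J. x i)" by metis
        then obtain j where "j \<in> J" "x j \<noteq> (\<Inter>i\<in>J. x i)" using J by blast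
        then show ?thesis using eq[of j] sub[of j] by (intro bexI[of _ j]) (auto simp: psi_def)
      next
        case False
        then show ?thesis using J sub[of a] by (intro bexI[of _ a]) (auto simp: psi_def)
      qed
      then obtain j where j: "j \<in> J" "psi L \<kappa> P (I j) (x j) = - \<kappa>" by blast
      have "(\<Sum>j\<in>J. psi L \<kappa> P (I j) (x j)) = - \<kappa> + (\<Sum>j\<in>J - {j}. psi L \<kappa> P (I j) (x j))"
        using J j by (subst sum.remove[of _ j]) auto
      also have "\<dots> \<le> - \<kappa>" using sum_nonpos[of "J - {j}" "\<lambda>j. psi L \<kappa> P (I j) (x j)"] le0 by simp
      finally show ?thesis using True by (simp add: I_def)
    next
      case False
      then show ?thesis using sum_nonpos[of J "\<lambda>j. psi L \<kappa> P (I j) (x j)"] le0 by (simp add: I_def)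
    qed
  next
    case False
    then obtain p where p: "p \<in> J" "\<not> I p \<subseteq> x p" by (auto simp: Piv_def)
    have "\<forall>j\<in>Piv. \<exists>e. e \<in> I j \<and> e \<notin> x j" by (auto simp: Piv_def)
    then obtain e where e: "\<And>j. j \<in> Piv \<Longrightarrow> e j \<in> I j \<and> e j \<notin> x j" by metis
    have "inj_on e Piv"
    proof (rule inj_onI, rule ccontr)
      fix i j assume ij: "i \<in> Piv" "j \<in> Piv" "e i = e j" "i \<noteq> j"
      then have "e i \<in> x j" using e[of i] PivJ by (auto simp: I_def)
      then show False using e[of j] ij by simp
    qed
    moreover have "e ` Piv \<subseteq> W"
    proof (rule image_subsetI)
      fix j assume j: "j \<in> Piv"
      obtain i where "i \<in> J" "i \<noteq> j" using J by metis
      then show "e j \<in> W" using e[OF j] W(2) by (auto simp: I_def)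
    qed
    ultimately have cP: "card Piv \<le> card W" using W card_inj_on_le by blast
    have neg: "psi L \<kappa> P (I j) (x j) = - \<kappa>" if j: "j \<in> J - Piv" for j
    proof -
      have sub: "I j \<subseteq> x j" using j by (auto simp: Piv_def)
      have "j \<noteq> p" using j p by (auto simp: Piv_def)
      then have "I p \<subseteq> x j" "I j \<subseteq> x p" using j p by (auto simp: I_def)
      then have "I j \<noteq> x j" using p(2) by blast
      then show ?thesis using sub by (simp add: psi_def)
    qed
    have "(\<Sum>j\<in>J. psi L \<kappa> P (I j) (x j)) = (\<Sum>j\<in>J - Piv. psi L \<kappa> P (I j) (x j)) + (\<Sum>j\<in>Piv. psi L \<kappa> P (I j) (x j))"
      using J PivJ by (simp add: sum.subset_diff)
    also have "(\<Sum>j\<in>Piv. psi L \<kappa> P (I j) (x j)) = card Piv * L"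
      by (simp add: psi_def Piv_def)
    also have "(\<Sum>j\<in>J - Piv. psi L \<kappa> P (I j) (x j)) = - \<kappa> * (real (card J) - real (card Piv))"
      using neg J PivJ finP by (simp add: card_Diff_subset card_mono of_nat_diff)
    also have "- \<kappa> * (real (card J) - real (card Piv)) + card Piv * L
        \<le> - \<kappa> * (real (card J) - real (card W)) + card W * L"
      using cP L by (intro add_mono mult_right_mono mult_left_mono_neg) auto
    also have "\<dots> \<le> - \<kappa>" using L(3) by simp
    also have "\<dots> \<le> - \<kappa> * of_bool (x a \<noteq> x b \<or> \<not> P (x a))" using L by simp
    finally show ?thesis by (simp add: I_def)
  qed
qed

section \<open>Disagreement along paths of odd vertices\<close>

context even_torus
begin

definition dis :: "(nat list \<Rightarrow> 'c) \<Rightarrow> nat list \<Rightarrow> nat list \<Rightarrow> nat" where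
  "dis X v w = card {g \<in> autos. X (g v) \<noteq> X (g w)}"

text \<open>\<open>defect X P / card autos\<close> is the quantity \<open>q\<close> of the introduction: by transitivity the choice of the
  two reference neighbours is immaterial.\<close>

definition defect :: "(nat list \<Rightarrow> 'c) \<Rightarrow> ('c \<Rightarrow> bool) \<Rightarrow> nat" where
  "defect X P = card {g \<in> autos. X (g (nb 0 1 (replicate d 0))) \<noteq> X (g (nb 1 1 (replicate d 0)))
     \<or> \<not> P (X (g (nb 0 1 (replicate d 0))))}"

lemma dis_triangle: "dis X v w \<le> dis X v y + dis X y w"
proof -
  have "{g \<in> autos. X (g v) \<noteq> X (g w)} \<subseteq> {g \<in> autos. X (g v) \<noteq> X (g y)} \<union> {g \<in> autos. X (g y) \<noteq> X (g w)}"
    by auto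
  then have "dis X v w \<le> card ({g \<in> autos. X (g v) \<noteq> X (g y)} \<union> {g \<in> autos. X (g y) \<noteq> X (g w)})"
    unfolding dis_def using finite_autos by (intro card_mono) auto
  also have "\<dots> \<le> dis X v y + dis X y w" unfolding dis_def by (rule card_Un_le)
  finally show ?thesis .
qed

lemma card_autos_pair_shift:
  assumes "h \<in> autos" "a \<in> V" "b \<in> V"
  shows "card {g \<in> autos. R (g (h a)) (g (h b))} = card {g \<in> autos. R (g a) (g b)}"
proof -
  have "real (card {g \<in> autos. R (g (h a)) (g (h b))}) = (\<Sum>g\<in>autos. of_bool (R (compose V g h a) (compose V g h b)))"
    using assms finite_autos by (simp add: card_filter_eq_sum compose_eq)
  also have "\<dots> = (\<Sum>g\<in>autos. of_bool (R (g a) (g b)))"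
    by (rule sum_autos_shift[OF assms(1)])
  also have "\<dots> = real (card {g \<in> autos. R (g a) (g b)})"
    using finite_autos by (simp add: card_filter_eq_sum)
  finally show ?thesis by simp
qed

lemma defect_pair:
  assumes "u \<in> Ev" "k < d" "l < d" "k \<noteq> l" "r \<in> Sg" "r' \<in> Sg"
  shows "card {g \<in> autos. X (g (nb k r u)) \<noteq> X (g (nb l r' u)) \<or> \<not> P (X (g (nb k r u)))} = defect X P"
proof -
  obtain h where h: "h \<in> autos" "h (nb 0 1 (replicate d 0)) = nb k r u"
    "h (nb 1 1 (replicate d 0)) = nb l r' u" using pair_auto[OF assms] .
  have "nb 0 1 (replicate d 0) \<in> V" "nb 1 1 (replicate d 0) \<in> V"
    using assms Ev_V[OF zero_in_Ev] by (simp_all add: nb_in_V)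
  from card_autos_pair_shift[OF h(1) this, of "\<lambda>a b. X a \<noteq> X b \<or> \<not> P (X a)"]
  show ?thesis unfolding h defect_def .
qed

lemma dis_nbrs_le_defect:
  assumes "u \<in> Ev" "k < d" "l < d" "k \<noteq> l" "r \<in> Sg" "r' \<in> Sg"
  shows "dis X (nb k r u) (nb l r' u) \<le> defect X P"
  unfolding dis_def defect_pair[OF assms, of X P, symmetric]
  by (intro card_mono) (use finite_autos in auto)

text \<open>Both ends are neighbours of the even vertex \<open>nb i s v\<close> in different
  directions: \<open>v\<close> is recovered from it by the step \<open>m - s\<close>.\<close>

lemma dis_two_step:
  assumes "v \<in> Od" "i < d" "j < d" "i \<noteq> j" "s \<in> Sg" "r \<in> Sg"
  shows "dis X v (nb j r (nb i s v)) \<le> defect X P"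
proof -
  have "nb i s v \<in> Ev" using assms nb_Od by blast
  from dis_nbrs_le_defect[OF this assms(2,3,4) Sg_neg[OF assms(5)] assms(6), of X P]
  show ?thesis using nb_inv[OF Od_V[OF assms(1)] assms(2,5)] by simp
qed

text \<open>To stay in \<open>Od\<close>, every increment of coordinate \<open>k\<close> is paired
  with a step in another coordinate. The last coordinate serves for this throughout and is left
  uncontrolled here.\<close>

lemma dis_path_coord:
  assumes "v \<in> Od" "k < d - 1"
  shows "\<exists>y\<in>Od. y ! k = (v ! k + n) mod m \<and> (\<forall>i<d - 1. i \<noteq> k \<longrightarrow> y ! i = v ! i) \<and> dis X v y \<le> n * defect X P"
proof (induction n)
  case 0
  show ?case using assms V_nth[OF Od_V[OF assms(1)], of k]
    by (intro bexI[of _ v]) (auto simp: dis_def)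
next
  case (Suc n)
  then obtain y where y: "y \<in> Od" "y ! k = (v ! k + n) mod m" "\<And>i. i < d - 1 \<Longrightarrow> i \<noteq> k \<Longrightarrow> y ! i = v ! i"
    "dis X v y \<le> n * defect X P" by blast
  let ?z = "nb (d - 1) 1 (nb k 1 y)"
  have kd: "k < d" "d - 1 < d" "k \<noteq> d - 1" using assms by auto
  have z: "?z \<in> Od" using y kd by (intro nb_Ev nb_Od Sg_one)
  have yV: "y \<in> V" "nb k 1 y \<in> V" using Od_V[OF y(1)] kd by (simp_all add: nb_in_V)
  have "dis X v ?z \<le> n * defect X P + defect X P"
    using dis_triangle[of X v ?z y] y(4) dis_two_step[OF y(1) kd(1,2,3) Sg_one Sg_one, of X P] by linarith
  moreover have "?z ! k = (v ! k + Suc n) mod m"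
    using yV kd y(2) by (simp add: nb_nth mod_Suc_eq)
  moreover have "?z ! i = v ! i" if "i < d - 1" "i \<noteq> k" for i
    using yV kd y(3) that by (simp add: nb_nth)
  ultimately show ?case using z by (intro bexI[of _ ?z]) auto
qed

lemma dis_path_prefix:
  assumes "v \<in> Od" "w \<in> V" "k \<le> d - 1"
  shows "\<exists>y\<in>Od. (\<forall>i<k. y ! i = w ! i) \<and> dis X v y \<le> m * k * defect X P"
  using assms(3)
proof (induction k)
  case 0
  show ?case using assms by (intro bexI[of _ v]) (auto simp: dis_def)
next
  case (Suc k)
  then obtain y where y: "y \<in> Od" "\<And>i. i < k \<Longrightarrow> y ! i = w ! i" "dis X v y \<le> m * k * defect X P" by auto
  define n where "n = (w ! k + (m - y ! k)) mod m"
  have n: "n < m" using m_ge2 by (simp add: n_def)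
  obtain z where z: "z \<in> Od" "z ! k = (y ! k + n) mod m" "\<And>i. i < d - 1 \<Longrightarrow> i \<noteq> k \<Longrightarrow> z ! i = y ! i"
    "dis X y z \<le> n * defect X P"
    using dis_path_coord[OF y(1), of k n X P] Suc.prems by auto
  have lt: "y ! k < m" "w ! k < m" using Suc.prems y(1) assms by (auto intro!: V_nth Od_V)
  have "(y ! k + n) mod m = (y ! k + (w ! k + (m - y ! k))) mod m" unfolding n_def by (rule mod_add_right_eq)
  then have "z ! k = w ! k" using z(2) lt by simp
  then have "z ! i = w ! i" if "i < Suc k" for i
    using that z(3)[of i] y(2)[of i] Suc.prems by (cases "i = k") auto
  moreover have "dis X v z \<le> m * Suc k * defect X P"
  proof -
    have "n * defect X P \<le> m * defect X P" using n by (intro mult_le_mono1) simp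
    then have "dis X v z \<le> m * k * defect X P + m * defect X P"
      using dis_triangle[of X v z y] y(3) z(4) by linarith
    then show ?thesis by (simp add: algebra_simps)
  qed
  ultimately show ?case using z(1) by blast
qed

text \<open>With the other coordinates fixed, parity permits only even shifts of the last one. Two
  two-step moves achieve a shift by two: coordinate \<open>0\<close> goes up and then down, each
  time together with an increment of the last coordinate.\<close>

lemma dis_path_last:
  assumes "v \<in> Od" "d \<ge> 2"
  shows "\<exists>y\<in>Od. y ! (d - 1) = (v ! (d - 1) + 2 * n) mod m \<and> (\<forall>i<d - 1. y ! i = v ! i) \<and> dis X v y \<le> 2 * n * defect X P"
proof (induction n)
  case 0
  show ?case using assms V_nth[OF Od_V[OF assms(1)], of "d - 1"]
    by (intro bexI[of _ v]) (auto simp: dis_def)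
next
  case (Suc n)
  then obtain y where y: "y \<in> Od" "y ! (d - 1) = (v ! (d - 1) + 2 * n) mod m" "\<And>i. i < d - 1 \<Longrightarrow> y ! i = v ! i"
    "dis X v y \<le> 2 * n * defect X P" by blast
  let ?l = "d - 1"
  have kd: "0 < d" "?l < d" "0 \<noteq> ?l" using assms by auto
  have sg: "m - 1 \<in> Sg" by (simp add: Sg_def)
  let ?x = "nb ?l 1 (nb 0 1 y)"
  let ?z = "nb ?l 1 (nb 0 (m - 1) ?x)"
  have x: "?x \<in> Od" using y kd by (intro nb_Ev nb_Od Sg_one)
  have z: "?z \<in> Od" by (rule nb_Ev[OF nb_Od[OF x kd(1) sg] kd(2) Sg_one])
  have yV: "y \<in> V" "nb 0 1 y \<in> V" "?x \<in> V" "nb 0 (m - 1) ?x \<in> V" using Od_V[OF y(1)] kd by (simp_all add: nb_in_V)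
  have "dis X v ?z \<le> 2 * n * defect X P + (defect X P + defect X P)"
    using dis_triangle[of X v ?z y] dis_triangle[of X y ?z ?x] y(4)
      dis_two_step[OF y(1) kd Sg_one Sg_one, of X P] dis_two_step[OF x kd sg Sg_one, of X P] by linarith
  moreover have "?z ! ?l = (v ! ?l + 2 * Suc n) mod m"
    using yV kd y(2) by (simp add: nb_nth mod_Suc_eq)
  moreover have "?z ! i = v ! i" if "i < ?l" for i
  proof (cases "i = 0")
    case True
    have "(y ! 0 + 1 + (m - 1)) mod m = y ! 0" using m_ge2 V_nth[OF yV(1) kd(1)] by simp
    then have "((y ! 0 + 1) mod m + (m - 1)) mod m = y ! 0" by (simp only: mod_add_left_eq)
    then show ?thesis using True yV kd y(3)[of 0] that by (simp add: nb_nth)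
  next
    case False
    then show ?thesis using yV kd y(3) that by (simp add: nb_nth)
  qed
  ultimately show ?case using z by (intro bexI[of _ ?z]) auto
qed

text \<open>All coordinates but the last are corrected with fewer than \<open>m\<close> moves each.
  Two odd vertices that agree there differ in the last coordinate by an even residue, which fewer
  than \<open>m\<close> further moves correct.\<close>

lemma dis_le_diameter:
  assumes "v \<in> Od" "w \<in> Od" "d \<ge> 2"
  shows "dis X v w \<le> m * d * defect X P"
proof -
  let ?l = "d - 1"
  have wV: "w \<in> V" using assms Od_V by blast
  obtain y where y: "y \<in> Od" "\<And>i. i < ?l \<Longrightarrow> y ! i = w ! i" "dis X v y \<le> m * ?l * defect X P"
    using dis_path_prefix[OF assms(1) wV, of ?l X P] by auto
  have yV: "y \<in> V" using y Od_V by blast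
  have lt: "y ! ?l < m" "w ! ?l < m" using assms yV wV by (auto intro!: V_nth)
  have split: "sum_list x = x ! ?l + (\<Sum>i<?l. x ! i)" if "x \<in> V" for x
  proof -
    have "sum_list x = (\<Sum>i<Suc ?l. x ! i)" using that assms by (simp add: sum_list_nths)
    then show ?thesis by simp
  qed
  have par: "even (y ! ?l) \<longleftrightarrow> even (w ! ?l)"
  proof -
    have "odd (sum_list y)" "odd (sum_list w)" using y(1) assms(2) by (auto simp: odd_class_def)
    moreover have "(\<Sum>i<?l. y ! i) = (\<Sum>i<?l. w ! i)" using y(2) by (intro sum.cong) auto
    ultimately show ?thesis using split[OF yV] split[OF wV] by auto
  qed
  define e where "e = (w ! ?l + (m - y ! ?l)) mod m"
  have "even e" using par m_even lt by (simp add: e_def even_mod_m)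
  then obtain n where n: "e = 2 * n" by (elim evenE)
  have "e < m" using m_ge2 by (simp add: e_def)
  obtain z where z: "z \<in> Od" "z ! ?l = (y ! ?l + 2 * n) mod m" "\<And>i. i < ?l \<Longrightarrow> z ! i = y ! i"
    "dis X y z \<le> 2 * n * defect X P" using dis_path_last[OF y(1) assms(3), of n X P] by auto
  have "(y ! ?l + e) mod m = (y ! ?l + (w ! ?l + (m - y ! ?l))) mod m"
    unfolding e_def by (rule mod_add_right_eq)
  then have zl: "z ! ?l = w ! ?l" using z(2) lt n by simp
  have "z = w"
  proof (rule V_eqI[OF Od_V[OF z(1)] wV])
    fix i assume "i < d"
    then show "z ! i = w ! i" using zl y(2)[of i] z(3)[of i] by (cases "i = ?l") auto
  qed
  have "2 * n * defect X P \<le> m * defect X P" using n \<open>e < m\<close> by (intro mult_le_mono1) simp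
  then have "dis X v w \<le> m * ?l * defect X P + m * defect X P"
    using dis_triangle[of X v w y] y(3) z(4) unfolding \<open>z = w\<close> by linarith
  also have "\<dots> = m * (?l + 1) * defect X P" by (simp add: algebra_simps)
  finally show ?thesis using assms(3) by simp
qed

lemma autos_bij_Od:
  assumes "g \<in> autos"
  shows "bij_betw g Od Od"
proof -
  have inj: "inj_on g Od" using autos_bij[OF assms] Od_V by (meson bij_betw_def inj_on_subset subsetI)
  then have "g ` Od = Od" using autos_Od[OF assms] by (intro endo_inj_surj[OF finite_Od]) auto
  then show ?thesis using inj by (simp add: bij_betw_def)
qed

text \<open>Reindexing \<open>w\<close> by \<open>g\<close> turns the sum over \<open>g\<close> of
  the number of \<open>w\<close> with \<open>X w \<noteq> X (g v0)\<close> into the sum over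
  \<open>w\<close> of \<open>dis X w v0\<close>, each term of which obeys the diameter bound. Some
  vertex \<open>g v0\<close> does no worse than the average.\<close>

lemma ex_majority:
  assumes "d \<ge> 2"
  shows "\<exists>v\<in>Od. card autos * card {w \<in> Od. X w \<noteq> X v} \<le> m * d * defect X P * card Od"
proof -
  have d: "0 < d" using assms by simp
  define v0 where "v0 = nb 0 1 (replicate d 0)"
  have v0: "v0 \<in> Od" unfolding v0_def using zero_in_Ev d Sg_one by (intro nb_Ev)
  have "(\<Sum>g\<in>autos. real (card {w \<in> Od. X w \<noteq> X (g v0)})) = (\<Sum>g\<in>autos. \<Sum>w\<in>Od. of_bool (X (g w) \<noteq> X (g v0)))"
  proof (rule sum.cong[OF refl])
    fix g assume g: "g \<in> autos"
    show "real (card {w \<in> Od. X w \<noteq> X (g v0)}) = (\<Sum>w\<in>Od. of_bool (X (g w) \<noteq> X (g v0)))"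
      unfolding card_filter_eq_sum[OF finite_Od]
      by (rule sum.reindex_bij_betw[OF autos_bij_Od[OF g], of "\<lambda>w. of_bool (X w \<noteq> X (g v0))", symmetric])
  qed
  also have "\<dots> = (\<Sum>w\<in>Od. \<Sum>g\<in>autos. of_bool (X (g w) \<noteq> X (g v0)))" by (rule sum.swap)
  also have "\<dots> = (\<Sum>w\<in>Od. real (dis X w v0))"
    unfolding dis_def using finite_autos by (simp add: card_filter_eq_sum)
  also have "\<dots> \<le> (\<Sum>w\<in>Od. real (m * d * defect X P))"
    using dis_le_diameter[OF _ v0 assms, of _ X P] by (intro sum_mono of_nat_mono) auto
  finally have tot: "(\<Sum>g\<in>autos. real (card {w \<in> Od. X w \<noteq> X (g v0)})) \<le> real (m * d * defect X P * card Od)"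
    by (simp add: algebra_simps)
  show ?thesis
  proof (rule ccontr)
    assume "\<not> ?thesis"
    then have lt: "m * d * defect X P * card Od < card autos * card {w \<in> Od. X w \<noteq> X (g v0)}" if "g \<in> autos" for g
      using autos_Od[OF that v0] by (meson not_le)
    have "card autos * real (m * d * defect X P * card Od) = (\<Sum>g\<in>autos. real (m * d * defect X P * card Od))"
      by simp
    also have "\<dots> < (\<Sum>g\<in>autos. real (card autos * card {w \<in> Od. X w \<noteq> X (g v0)}))"
      using lt card_autos_pos finite_autos by (intro sum_strict_mono) (auto simp only: of_nat_less_iff card_gt_0_iff)
    also have "\<dots> = card autos * (\<Sum>g\<in>autos. real (card {w \<in> Od. X w \<noteq> X (g v0)}))"
      by (simp add: sum_distrib_left)
    also have "\<dots> \<le> card autos * real (m * d * defect X P * card Od)"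
      using tot by (intro mult_left_mono) auto
    finally show False by simp
  qed
qed

end

section \<open>Average gain against average description cost\<close>

context even_torus
begin

text \<open>Among the neighbours in the directions \<open>insert j smp\<close>, any one can play the
  tested vertex: \<open>swap_auto\<close> exchanges it with \<open>nb j s u\<close>, and shifting
  the sum over \<open>autos\<close> shows that the total does not change. The left side is therefore
  the total of all leave-one-out sums, which \<open>sum_psi_leave_one_out\<close> bounds for each
  \<open>g\<close> separately.\<close>

lemma sum_psi_exchange:
  assumes u: "u \<in> Ev" and smp: "smp \<subseteq> {..<d}" "smp \<noteq> {}" and j: "j < d" "j \<notin> smp" and s: "s \<in> Sg"
    and W: "finite W" "\<And>v. v \<in> Od \<Longrightarrow> X v \<subseteq> W"
    and L: "L \<ge> 0" "\<kappa> > 0" "real (card W) * L + \<kappa> \<le> \<kappa> * (real (Suc (card smp)) - real (card W))"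
  shows "real (Suc (card smp)) * (\<Sum>g\<in>autos. psi L \<kappa> P (\<Inter>i\<in>smp. X (g (nb i 1 u))) (X (g (nb j s u))))
    \<le> - \<kappa> * defect X P"
proof -
  define J where "J = insert j smp"
  define y where "y i = nb i (if i = j then s else 1) u" for i
  define F where "F i g = psi L \<kappa> P (\<Inter>l\<in>J - {i}. X (g (y l))) (X (g (y i)))" for i g
  have fin: "finite smp" "finite J" using smp finite_subset by (auto simp: J_def)
  have cJ: "card J = Suc (card smp)" using fin j by (simp add: J_def)
  have Jd: "i < d" if "i \<in> J" for i using that smp j by (auto simp: J_def)
  have y_Od: "y i \<in> Od" if "i \<in> J" for i
    using nb_Ev[OF u Jd[OF that]] s Sg_one by (simp add: y_def del: One_nat_def)
  have eq: "(\<Sum>g\<in>autos. F i g) = (\<Sum>g\<in>autos. F j g)" if i: "i \<in> J" for i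
  proof (cases "i = j")
    case False
    obtain h where h: "h \<in> autos" "h (nb i 1 u) = nb j s u" "h (nb j s u) = nb i 1 u"
      "\<And>n q. n < d \<Longrightarrow> n \<noteq> i \<Longrightarrow> n \<noteq> j \<Longrightarrow> q \<in> Sg \<Longrightarrow> h (nb n q u) = nb n q u"
      using swap_auto[OF Ev_V[OF u] Jd[OF i] j(1) False Sg_one s] by blast
    have hy: "h (y l) = y (transpose i j l)" if "l \<in> J" for l
      using h False Jd[OF that] Sg_one by (auto simp: y_def transpose_def simp del: One_nat_def)
    have "F i (compose V g h) = F j g" for g
    proof -
      have c: "compose V g h (y l) = g (y (transpose i j l))" if "l \<in> J" for l
        using hy[OF that] Od_V[OF y_Od[OF that]] by (simp add: compose_eq)
      have "(\<Inter>l\<in>J - {i}. X (compose V g h (y l))) = (\<Inter>l\<in>J - {i}. X (g (y (transpose i j l))))"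
        using c by auto
      also have "\<dots> = (\<Inter>l\<in>transpose i j ` (J - {i}). X (g (y l)))" by simp
      also have "transpose i j ` (J - {i}) = J - {j}"
      proof -
        have "j \<in> J" by (simp add: J_def)
        then show ?thesis using i by (auto simp: transpose_def image_iff split: if_splits)
      qed
      finally show ?thesis using c[OF i] by (simp add: F_def)
    qed
    then show ?thesis using sum_autos_shift[OF h(1), of "F i"] by simp
  qed simp
  obtain b where b: "b \<in> smp" using smp by blast
  have bj: "b \<noteq> j" "b < d" using b j smp by auto
  have "real (card J) * (\<Sum>g\<in>autos. F j g) = (\<Sum>i\<in>J. \<Sum>g\<in>autos. F i g)" using eq by simp
  also have "\<dots> = (\<Sum>g\<in>autos. \<Sum>i\<in>J. F i g)" by (rule sum.swap)
  also have "\<dots> \<le> (\<Sum>g\<in>autos. - \<kappa> * of_bool (X (g (y j)) \<noteq> X (g (y b)) \<or> \<not> P (X (g (y j)))))"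
    unfolding F_def
    by (intro sum_mono sum_psi_leave_one_out)
      (use fin b bj W L y_Od autos_Od in \<open>auto simp: J_def cJ[unfolded J_def]\<close>)
  also have "\<dots> = - \<kappa> * (\<Sum>g\<in>autos. of_bool (X (g (y j)) \<noteq> X (g (y b)) \<or> \<not> P (X (g (y j)))))"
    by (simp only: sum_distrib_left)
  also have "(\<Sum>g\<in>autos. of_bool (X (g (y j)) \<noteq> X (g (y b)) \<or> \<not> P (X (g (y j))))) = real (defect X P)"
    using card_filter_eq_sum[OF finite_autos, of "\<lambda>g. X (g (y j)) \<noteq> X (g (y b)) \<or> \<not> P (X (g (y j)))"]
      defect_pair[OF u j(1) bj(2) bj(1)[symmetric] s Sg_one, of X P] bj
    by (simp add: y_def)
  finally have "real (card J) * (\<Sum>g\<in>autos. F j g) \<le> - \<kappa> * defect X P" .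
  moreover have "F j g = psi L \<kappa> P (\<Inter>i\<in>smp. X (g (nb i 1 u))) (X (g (nb j s u)))" for g
  proof -
    have "J - {j} = smp" using j by (auto simp: J_def)
    moreover have "\<And>i. i \<in> smp \<Longrightarrow> y i = nb i 1 u" using j by (auto simp: y_def)
    ultimately show ?thesis by (simp add: F_def y_def del: One_nat_def cong: INF_cong)
  qed
  ultimately show ?thesis by (simp add: cJ)
qed

text \<open>Exchangeability fails when the tested neighbour lies in a sampled direction, but there are few of those.\<close>

lemma sum_psi_conflict:
  assumes u: "u \<in> Ev" and smp: "smp \<subseteq> {..<d}" "i \<in> smp" "i \<noteq> j" and j: "j < d" and s: "s \<in> Sg"
    and L: "L \<ge> 0" "\<kappa> > 0"
  shows "(\<Sum>g\<in>autos. psi L \<kappa> P (\<Inter>i\<in>smp. X (g (nb i 1 u))) (X (g (nb j s u)))) \<le> L * defect X P"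
proof -
  have i: "i < d" using smp by auto
  have "(\<Sum>g\<in>autos. psi L \<kappa> P (\<Inter>i\<in>smp. X (g (nb i 1 u))) (X (g (nb j s u))))
      \<le> (\<Sum>g\<in>autos. L * of_bool (X (g (nb j s u)) \<noteq> X (g (nb i 1 u))))"
    using smp L by (intro sum_mono) (auto simp: psi_def)
  also have "\<dots> = L * dis X (nb j s u) (nb i 1 u)"
    unfolding dis_def card_filter_eq_sum[OF finite_autos] by (rule sum_distrib_left[symmetric])
  also have "\<dots> \<le> L * defect X P"
    using dis_nbrs_le_defect[OF u j i smp(3)[symmetric] s Sg_one, of X P] L by (intro mult_left_mono) auto
  finally show ?thesis .
qed

definition Psi :: "real \<Rightarrow> real \<Rightarrow> ('b set \<Rightarrow> bool) \<Rightarrow> (nat list \<Rightarrow> nat set) \<Rightarrow> (nat list \<Rightarrow> 'b set) \<Rightarrow> real" where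
  "Psi L \<kappa> P smp X = (\<Sum>u\<in>Ev. \<Sum>j<d. \<Sum>s\<in>Sg. psi L \<kappa> P (\<Inter>i\<in>smp u. X (nb i 1 u)) (X (nb j s u)))"

text \<open>In units of the defect, a direction outside the sample gains \<open>\<kappa> / k\<close>
  and a sampled one loses at most \<open>L\<close>. Only \<open>k - 1\<close> directions per vertex
  are sampled, so for \<open>d\<close> as large as \<open>dk\<close> requires they spoil at most
  half of the gain.\<close>

lemma sum_Psi_le:
  assumes smp: "\<And>u. u \<in> Ev \<Longrightarrow> smp u \<subseteq> {..<d} \<and> Suc (card (smp u)) = k" and k: "k \<ge> 3"
    and W: "finite W" "\<And>v. v \<in> Od \<Longrightarrow> X v \<subseteq> W"
    and L: "L \<ge> 0" "\<kappa> > 0" "real (card W) * L + \<kappa> \<le> \<kappa> * (real k - real (card W))"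
    and dk: "real k * (L + \<kappa>) \<le> real d * (\<kappa> / (2 * real k))"
  shows "(\<Sum>g\<in>autos. Psi L \<kappa> P smp (X \<circ> g)) \<le> - (\<kappa> / (2 * real k)) * real (d * card Sg) * card Ev * defect X P"
proof -
  define q where "q = real (defect X P)"
  define F where "F u j s = (\<Sum>g\<in>autos. psi L \<kappa> P (\<Inter>i\<in>smp u. X (g (nb i 1 u))) (X (g (nb j s u))))" for u j s
  have "q \<ge> 0" by (simp add: q_def)
  have F: "F u j s \<le> (if j \<in> smp u then L * q else - (\<kappa> / real k) * q)"
    if u: "u \<in> Ev" and j: "j < d" and s: "s \<in> Sg" for u j s
  proof (cases "j \<in> smp u")
    case True
    have fin: "finite (smp u)" using smp[OF u] finite_subset by blast
    \<comment> \<open>\<open>k \<ge> 3\<close> means at least two sampled directions, hence one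
      other than \<open>j\<close> to compare with.\<close>
    have "\<not> smp u \<subseteq> {j}"
    proof
      assume "smp u \<subseteq> {j}"
      then have "card (smp u) \<le> card {j}" by (intro card_mono) auto
      then show False using smp[OF u] k by simp
    qed
    then obtain i where "i \<in> smp u" "i \<noteq> j" by blast
    then show ?thesis unfolding F_def q_def
      using sum_psi_conflict[OF u _ _ _ j s L(1,2), of "smp u" i P X] smp[OF u] True by simp
  next
    case False
    have "smp u \<noteq> {}" using smp[OF u] k by auto
    from sum_psi_exchange[where X = X and P = P, OF u _ this j False s W L(1,2)] smp[OF u] L(3)
    have "real k * F u j s \<le> - \<kappa> * q" unfolding F_def q_def by simp
    then have "F u j s \<le> - \<kappa> * q / real k" using k by (simp add: field_simps)
    then show ?thesis using False by simp
  qed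
  have inner: "(\<Sum>j<d. \<Sum>s\<in>Sg. F u j s) \<le> - (\<kappa> / (2 * real k)) * real (d * card Sg) * q" if u: "u \<in> Ev" for u
  proof -
    have "(\<Sum>j<d. \<Sum>s\<in>Sg. F u j s) \<le> (\<Sum>j<d. \<Sum>s\<in>Sg. if j \<in> smp u then L * q else - (\<kappa> / real k) * q)"
      using F[OF u] by (intro sum_mono) auto
    also have "\<dots> = card Sg * (\<Sum>j<d. if j \<in> smp u then L * q else - (\<kappa> / real k) * q)"
      by (simp add: sum_distrib_left)
    also have "(\<Sum>j<d. if j \<in> smp u then L * q else - (\<kappa> / real k) * q)
        = card (smp u) * (L * q) + (real d - card (smp u)) * (- (\<kappa> / real k) * q)"
    proof -
      have sub: "smp u \<subseteq> {..<d}" and fin: "finite (smp u)" using smp[OF u] finite_subset by auto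
      have "card ({..<d} - smp u) = d - card (smp u)" using sub fin by (simp add: card_Diff_subset)
      moreover have "card (smp u) \<le> d" using card_mono[OF _ sub] by simp
      moreover have "{..<d} \<inter> smp u = smp u" "{..<d} \<inter> - smp u = {..<d} - smp u" using sub by auto
      ultimately show ?thesis using fin by (simp add: sum.If_cases of_nat_diff del: Diff_eq_empty_iff)
    qed
    also have "\<dots> = (card (smp u) * (L + \<kappa> / real k) - real d * (\<kappa> / real k)) * q"
      by (simp add: algebra_simps)
    also have "\<dots> \<le> (real k * (L + \<kappa>) - real d * (\<kappa> / real k)) * q"
    proof -
      have "card (smp u) \<le> k" using smp[OF u] by simp
      moreover have "\<kappa> / real k \<le> \<kappa>" using k L by (simp add: field_simps)
      ultimately have "card (smp u) * (L + \<kappa> / real k) \<le> real k * (L + \<kappa>)"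
        using L k by (intro mult_mono) auto
      then show ?thesis using \<open>q \<ge> 0\<close> by (intro mult_right_mono) auto
    qed
    also have "\<dots> \<le> (real d * (\<kappa> / (2 * real k)) - real d * (\<kappa> / real k)) * q"
      using dk \<open>q \<ge> 0\<close> by (intro mult_right_mono diff_right_mono)
    also have "\<dots> = - (\<kappa> / (2 * real k)) * real d * q" using k by (simp add: field_simps)
    finally have "(\<Sum>j<d. \<Sum>s\<in>Sg. F u j s) \<le> card Sg * (- (\<kappa> / (2 * real k)) * real d * q)"
      by (simp add: mult_left_mono)
    then show ?thesis by (simp add: algebra_simps)
  qed
  have "(\<Sum>g\<in>autos. Psi L \<kappa> P smp (X \<circ> g)) = (\<Sum>u\<in>Ev. \<Sum>j<d. \<Sum>s\<in>Sg. F u j s)"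
  proof -
    have "(\<Sum>g\<in>autos. Psi L \<kappa> P smp (X \<circ> g))
      = (\<Sum>u\<in>Ev. \<Sum>g\<in>autos. \<Sum>j<d. \<Sum>s\<in>Sg. psi L \<kappa> P (\<Inter>i\<in>smp u. X (g (nb i 1 u))) (X (g (nb j s u))))"
      unfolding Psi_def comp_def by (rule sum.swap)
    also have "\<dots> = (\<Sum>u\<in>Ev. \<Sum>j<d. \<Sum>g\<in>autos. \<Sum>s\<in>Sg. psi L \<kappa> P (\<Inter>i\<in>smp u. X (g (nb i 1 u))) (X (g (nb j s u))))"
      by (intro sum.cong refl sum.swap)
    also have "\<dots> = (\<Sum>u\<in>Ev. \<Sum>j<d. \<Sum>s\<in>Sg. F u j s)"
      unfolding F_def by (intro sum.cong refl sum.swap)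
    finally show ?thesis .
  qed
  also have "\<dots> \<le> (\<Sum>u\<in>Ev. - (\<kappa> / (2 * real k)) * real (d * card Sg) * q)"
    using inner by (intro sum_mono) auto
  finally show ?thesis by (simp add: q_def algebra_simps)
qed

text \<open>Counts the errors of a two-level prediction: values on \<open>T\<close> are guessed from
  their partners \<open>s0\<close>, which are to lie in \<open>S\<close>, and values on
  \<open>S\<close> from the single vertex \<open>v0\<close>.\<close>

definition penalty :: "(nat list \<Rightarrow> nat list) \<Rightarrow> nat list set \<Rightarrow> nat list set \<Rightarrow> nat list \<Rightarrow> (nat list \<Rightarrow> 'c) \<Rightarrow> real" where
  "penalty s0 T S v0 X = real (card {v \<in> T. X v \<noteq> X (s0 v)}) + real (card {v \<in> S. X v \<noteq> X v0})"

text \<open>A first-moment argument for a linear combination. The errors, priced at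
  \<open>\<theta>\<close>, use at most half of the average gain from \<open>sum_Psi_le\<close>, and
  some automorphism is no worse than the average. The factor \<open>d * card Sg\<close> on the price
  is a change of units: \<open>Psi\<close> counts edges, \<open>penalty\<close> counts
  vertices.\<close>

lemma ex_good_auto:
  assumes smp: "\<And>u. u \<in> Ev \<Longrightarrow> smp u \<subseteq> {..<d} \<and> Suc (card (smp u)) = k" and k: "k \<ge> 3"
    and W: "finite W" "\<And>v. v \<in> Od \<Longrightarrow> X v \<subseteq> W"
    and L: "L \<ge> 0" "\<kappa> > 0" "real (card W) * L + \<kappa> \<le> \<kappa> * (real k - real (card W))"
    and dk: "real k * (L + \<kappa>) \<le> real d * (\<kappa> / (2 * real k))" and d2: "d \<ge> 2"
    and T: "T \<subseteq> Od" "\<And>v. v \<in> T \<Longrightarrow> \<exists>i<d. \<exists>j<d. i \<noteq> j \<and> s0 v = nb j 1 (nb i 1 v)"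
    and S: "S \<subseteq> Od" "v0 \<in> Od"
    and \<theta>: "\<theta> \<ge> 0" "\<theta> * (card T + card S * (real m * real d)) \<le> \<kappa> / (4 * real k) * card Ev"
  shows "\<exists>g\<in>autos. Psi L \<kappa> P smp (X \<circ> g) + \<theta> * real (d * card Sg) * penalty s0 T S v0 (X \<circ> g)
     \<le> - (\<kappa> / (4 * real k)) * real (d * card Sg) * card Ev * (defect X P / card autos)"
proof (rule ccontr)
  assume neg: "\<not> ?thesis"
  define q where "q = real (defect X P)"
  define D where "D = real (d * card Sg)"
  define R where "R = - (\<kappa> / (4 * real k)) * D * card Ev * (q / card autos)"
  have q0: "q \<ge> 0" "D \<ge> 0" by (auto simp: q_def D_def)
  have fin: "finite T" "finite S" using T S finite_Od finite_subset by auto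
  have "(\<Sum>g\<in>autos. real (card {v \<in> T. (X \<circ> g) v \<noteq> (X \<circ> g) (s0 v)})) = (\<Sum>v\<in>T. real (dis X v (s0 v)))"
    unfolding dis_def card_filter_eq_sum[OF fin(1)] card_filter_eq_sum[OF finite_autos] comp_def by (rule sum.swap)
  also have "\<dots> \<le> (\<Sum>v\<in>T. q)"
  proof (rule sum_mono)
    fix v assume v: "v \<in> T"
    then obtain i j where "i < d" "j < d" "i \<noteq> j" "s0 v = nb j 1 (nb i 1 v)" using T(2) by blast
    then show "real (dis X v (s0 v)) \<le> q"
      using dis_two_step[of v i j 1 1 X P] v T(1) Sg_one unfolding q_def by (simp add: subset_iff)
  qed
  finally have sT: "(\<Sum>g\<in>autos. real (card {v \<in> T. (X \<circ> g) v \<noteq> (X \<circ> g) (s0 v)})) \<le> card T * q" by simp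
  have "(\<Sum>g\<in>autos. real (card {v \<in> S. (X \<circ> g) v \<noteq> (X \<circ> g) v0})) = (\<Sum>v\<in>S. real (dis X v v0))"
    unfolding dis_def card_filter_eq_sum[OF fin(2)] card_filter_eq_sum[OF finite_autos] comp_def by (rule sum.swap)
  also have "\<dots> \<le> (\<Sum>v\<in>S. real (m * d * defect X P))"
    using dis_le_diameter[OF _ S(2) d2, of _ X P] S(1) by (intro sum_mono of_nat_mono) auto
  finally have sS: "(\<Sum>g\<in>autos. real (card {v \<in> S. (X \<circ> g) v \<noteq> (X \<circ> g) v0})) \<le> card S * (real m * real d) * q"
    by (simp add: q_def algebra_simps)
  have pen: "(\<Sum>g\<in>autos. penalty s0 T S v0 (X \<circ> g)) \<le> (card T + card S * (real m * real d)) * q"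
    unfolding penalty_def sum.distrib using sT sS by (simp add: algebra_simps)
  have "R * card autos = (\<Sum>g\<in>autos. R)" by simp
  also have "\<dots> < (\<Sum>g\<in>autos. Psi L \<kappa> P smp (X \<circ> g) + \<theta> * D * penalty s0 T S v0 (X \<circ> g))"
    using neg finite_autos id_in_autos unfolding R_def D_def q_def
    by (intro sum_strict_mono) (auto simp: not_le)
  also have "\<dots> = (\<Sum>g\<in>autos. Psi L \<kappa> P smp (X \<circ> g)) + \<theta> * D * (\<Sum>g\<in>autos. penalty s0 T S v0 (X \<circ> g))"
    by (simp add: sum.distrib sum_distrib_left)
  also have "\<dots> \<le> - (\<kappa> / (2 * real k)) * D * card Ev * q + \<theta> * D * ((card T + card S * (real m * real d)) * q)"
    using sum_Psi_le[where X = X and P = P and smp = smp, OF smp k W L dk] pen \<theta>(1) q0 unfolding q_def D_def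
    by (intro add_mono mult_left_mono mult_nonneg_nonneg) auto
  also have "\<theta> * D * ((card T + card S * (real m * real d)) * q)
      = (\<theta> * (card T + card S * (real m * real d))) * (D * q)" by (simp add: algebra_simps)
  also have "\<dots> \<le> (\<kappa> / (4 * real k) * card Ev) * (D * q)"
    using \<theta>(2) q0 by (intro mult_right_mono) auto
  also have "- (\<kappa> / (2 * real k)) * D * card Ev * q + (\<kappa> / (4 * real k) * card Ev) * (D * q) = R * card autos"
    using card_autos_pos k by (simp add: R_def field_simps)
  finally show False by simp
qed

end

subsection \<open>Weighted colourings and the counting bound\<close>

lemma sum_prod_PiE:
  fixes F :: "'a \<Rightarrow> 'b \<Rightarrow> real"
  assumes "finite S" "\<And>v. v \<in> S \<Longrightarrow> finite (B v)"
  shows "(\<Sum>f\<in>PiE S B. \<Prod>v\<in>S. F v (f v)) = (\<Prod>v\<in>S. \<Sum>b\<in>B v. F v b)"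
  by (rule prod_sum_PiE[OF assms, symmetric])

text \<open>The sum factorises over \<open>T\<close>: at each vertex the predicted value contributes
  at most \<open>1\<close> and every other value \<open>exp (- \<theta>)\<close>. This replaces an
  entropy count for each separate number of errors.\<close>

lemma sum_exp_mismatch_le:
  fixes \<Omega> :: "'b set"
  assumes "finite T" "finite \<Omega>"
  shows "(\<Sum>\<tau>\<in>T \<rightarrow>\<^sub>E \<Omega>. exp (- \<theta> * real (card {v \<in> T. \<tau> v \<noteq> c v})))
    \<le> (1 + card \<Omega> * exp (- \<theta>)) ^ card T"
proof -
  have "exp (- \<theta> * real (card {v \<in> T. \<tau> v \<noteq> c v})) = (\<Prod>v\<in>T. if \<tau> v \<noteq> c v then exp (- \<theta>) else 1)" for \<tau>
  proof -
    have "(\<Prod>v\<in>T. if \<tau> v \<noteq> c v then exp (- \<theta>) else 1) = exp (- \<theta>) ^ card {v \<in> T. \<tau> v \<noteq> c v}"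
      using assms(1) by (simp add: prod.If_cases Int_def)
    then show ?thesis by (simp add: exp_of_nat_mult[symmetric] mult.commute)
  qed
  then have "(\<Sum>\<tau>\<in>T \<rightarrow>\<^sub>E \<Omega>. exp (- \<theta> * real (card {v \<in> T. \<tau> v \<noteq> c v})))
      = (\<Prod>v\<in>T. \<Sum>x\<in>\<Omega>. if x \<noteq> c v then exp (- \<theta>) else 1)"
    using sum_prod_PiE[OF assms(1), of "\<lambda>_. \<Omega>" "\<lambda>v x. if x \<noteq> c v then exp (- \<theta>) else 1"] assms(2) by simp
  also have "\<dots> \<le> (\<Prod>v\<in>T. 1 + card \<Omega> * exp (- \<theta>))"
  proof (rule prod_mono, intro conjI)
    fix v
    show "0 \<le> (\<Sum>x\<in>\<Omega>. if x \<noteq> c v then exp (- \<theta>) else 1)" by (intro sum_nonneg) auto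
    have "(\<Sum>x\<in>\<Omega>. if x \<noteq> c v then exp (- \<theta>) else 1) \<le> (\<Sum>x\<in>\<Omega>. exp (- \<theta>) + of_bool (x = c v))"
      by (intro sum_mono) auto
    also have "\<dots> = card \<Omega> * exp (- \<theta>) + real (card {x \<in> \<Omega>. x = c v})"
      unfolding sum.distrib card_filter_eq_sum[OF assms(2)] by simp
    also have "real (card {x \<in> \<Omega>. x = c v}) \<le> 1"
      using card_mono[of "{c v}" "{x \<in> \<Omega>. x = c v}"] by fastforce
    finally show "(\<Sum>x\<in>\<Omega>. if x \<noteq> c v then exp (- \<theta>) else 1) \<le> 1 + card \<Omega> * exp (- \<theta>)" by simp
  qed
  finally show ?thesis by simp
qed

section \<open>Maximising pairs of the target graph\<close>

locale weighted_target =
  fixes H :: "'b ugraph" and lam :: "'b \<Rightarrow> real"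
  assumes fin_graph: "finite_loop_graph H" and lam_pos: "\<And>i. i \<in> verts H \<Longrightarrow> lam i > 0"
    and has_edge: "edges H \<noteq> {}"
begin

abbreviation W where "W \<equiv> verts H"

definition cn :: "'b set \<Rightarrow> 'b set" where
  "cn Q = {b \<in> W. \<forall>a\<in>Q. {a, b} \<in> edges H}"

definition ideal :: "'b set \<Rightarrow> bool" where
  "ideal Q \<longleftrightarrow> Q \<subseteq> W \<and> sum lam Q * sum lam (cn Q) = eta H lam"

lemma finite_W: "finite W" using fin_graph by (simp add: finite_loop_graph_def)

lemma fin_sub: "A \<subseteq> W \<Longrightarrow> finite A" using finite_W finite_subset by blast

lemma cn_sub: "cn Q \<subseteq> W" by (auto simp: cn_def)

lemma cn_antimono: "A \<subseteq> B \<Longrightarrow> cn B \<subseteq> cn A" by (auto simp: cn_def)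

lemma cn_adj: "fully_adjacent H Q (cn Q)" by (auto simp: fully_adjacent_def cn_def)

lemma sub_cn: "B \<subseteq> W \<Longrightarrow> fully_adjacent H A B \<Longrightarrow> B \<subseteq> cn A"
  by (auto simp: fully_adjacent_def cn_def)

lemma lam_sum_nonneg: "A \<subseteq> W \<Longrightarrow> sum lam A \<ge> 0"
  using lam_pos by (intro sum_nonneg) (meson less_imp_le subsetD)

lemma lam_sum_pos: "A \<subseteq> W \<Longrightarrow> A \<noteq> {} \<Longrightarrow> sum lam A > 0"
  using lam_pos fin_sub by (intro sum_pos) auto

lemma lam_sum_mono: "A \<subseteq> B \<Longrightarrow> B \<subseteq> W \<Longrightarrow> sum lam A \<le> sum lam B"
  using lam_pos fin_sub by (intro sum_mono2) (auto intro: less_imp_le)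

lemma lam_sum_strict: "A \<subset> B \<Longrightarrow> B \<subseteq> W \<Longrightarrow> sum lam A < sum lam B"
proof -
  assume a: "A \<subset> B" "B \<subseteq> W"
  then have "sum lam B = sum lam A + sum lam (B - A)"
    using fin_sub[OF a(2)] sum.subset_diff[of A B lam] by simp
  moreover have "sum lam (B - A) > 0" using a by (intro lam_sum_pos) auto
  ultimately show ?thesis by simp
qed

lemma finite_eta_set:
  "finite {sum lam A * sum lam B | A B. A \<subseteq> W \<and> B \<subseteq> W \<and> fully_adjacent H A B}"
proof (rule finite_subset)
  show "{sum lam A * sum lam B | A B. A \<subseteq> W \<and> B \<subseteq> W \<and> fully_adjacent H A B}
      \<subseteq> (\<lambda>(A, B). sum lam A * sum lam B) ` (Pow W \<times> Pow W)" by auto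
  show "finite ((\<lambda>(A, B). sum lam A * sum lam B) ` (Pow W \<times> Pow W))" using finite_W by auto
qed

lemma eta_ge: "A \<subseteq> W \<Longrightarrow> B \<subseteq> W \<Longrightarrow> fully_adjacent H A B \<Longrightarrow> sum lam A * sum lam B \<le> eta H lam"
  unfolding eta_def using finite_eta_set by (intro Max_ge) auto

lemma eta_ge_cn: "A \<subseteq> W \<Longrightarrow> sum lam A * sum lam (cn A) \<le> eta H lam"
  using eta_ge cn_sub cn_adj by blast

lemma eta_pos: "eta H lam > 0"
proof -
  obtain e where "e \<in> edges H" using has_edge by blast
  then obtain a b where ab: "{a, b} \<in> edges H" "a \<in> W" "b \<in> W"
    using fin_graph by (auto simp: finite_loop_graph_def)
  then have "sum lam {a} * sum lam {b} \<le> eta H lam" by (intro eta_ge) (auto simp: fully_adjacent_def)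
  moreover have "sum lam {a} * sum lam {b} > 0" using ab lam_pos by simp
  ultimately show ?thesis by linarith
qed

lemma ex_max_pair: "\<exists>A B. (A, B) \<in> max_pairs H lam"
proof -
  have "eta H lam \<in> {sum lam A * sum lam B | A B. A \<subseteq> W \<and> B \<subseteq> W \<and> fully_adjacent H A B}"
    unfolding eta_def using finite_eta_set
    by (intro Max_in) (auto intro!: exI[of _ "{}"] simp: fully_adjacent_def)
  then show ?thesis by (auto simp: max_pairs_def) metis
qed

text \<open>Since weights are positive, enlarging \<open>B\<close> to a strictly larger
  \<open>cn A\<close> would increase the product. A maximising pair is thus determined by its first
  component, and these components are exactly the ideal sets (see
  \<open>ideal_max_pair\<close>).\<close>

lemma max_pairD:
  assumes "(A, B) \<in> max_pairs H lam"
  shows "A \<subseteq> W" "B \<subseteq> W" "A \<noteq> {}" "B \<noteq> {}" "sum lam A > 0" "sum lam B > 0" "B = cn A" "ideal A"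
    "sum lam A * sum lam B = eta H lam"
proof -
  show A: "A \<subseteq> W" and B: "B \<subseteq> W" and eq: "sum lam A * sum lam B = eta H lam"
    using assms by (auto simp: max_pairs_def)
  show "A \<noteq> {}" "B \<noteq> {}" using eq eta_pos by auto
  then show p: "sum lam A > 0" "sum lam B > 0" using A B lam_sum_pos by auto
  have sub: "B \<subseteq> cn A" using assms B sub_cn by (auto simp: max_pairs_def)
  show cn: "B = cn A"
  proof (rule ccontr)
    assume "B \<noteq> cn A"
    then have "sum lam B < sum lam (cn A)" using sub cn_sub by (intro lam_sum_strict) auto
    then have "sum lam A * sum lam B < sum lam A * sum lam (cn A)" using p by simp
    then show False using eq eta_ge_cn[OF A] by simp
  qed
  show "ideal A" using A eq cn by (simp add: ideal_def)
qed

lemma ideal_max_pair: "ideal A \<Longrightarrow> (A, cn A) \<in> max_pairs H lam"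
  using cn_sub cn_adj by (auto simp: ideal_def max_pairs_def)

text \<open>If \<open>I\<close> is a proper subset of \<open>Q\<close>, its weight is strictly
  smaller, so the product falls below \<open>eta\<close> (it is \<open>0\<close> when
  \<open>cn Q\<close> is empty); if \<open>I = Q\<close> is not ideal, it falls below by definition.
  There are finitely many such pairs, so one gap \<open>\<kappa>\<close> serves all. Without
  inclusion only the trivial bound by \<open>sum lam W\<close> squared remains, which gives
  \<open>L\<close>.\<close>

lemma ex_psi_constants:
  obtains L \<kappa> :: real where "L \<ge> 0" "\<kappa> > 0"
    "\<And>I Q. I \<subseteq> W \<Longrightarrow> Q \<subseteq> W \<Longrightarrow> sum lam I * sum lam (cn Q) \<le> eta H lam * exp (psi L \<kappa> ideal I Q)"
proof -
  define L where "L = max 0 (ln ((sum lam W)\<^sup>2 / eta H lam))"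
  have L: "(sum lam W)\<^sup>2 \<le> eta H lam * exp L"
  proof (cases "sum lam W = 0")
    case False
    then have "(sum lam W)\<^sup>2 / eta H lam = exp (ln ((sum lam W)\<^sup>2 / eta H lam))"
      using eta_pos by (simp add: exp_ln)
    also have "\<dots> \<le> exp L" by (simp add: L_def)
    finally show ?thesis using eta_pos by (simp add: field_simps)
  qed (use eta_pos in simp)
  define Vs where "Vs = (\<lambda>(I, Q). sum lam I * sum lam (cn Q)) `
     {(I, Q). I \<subseteq> Q \<and> Q \<subseteq> W \<and> \<not> (I = Q \<and> ideal Q)}"
  have "{(I, Q). I \<subseteq> Q \<and> Q \<subseteq> W \<and> \<not> (I = Q \<and> ideal Q)} \<subseteq> Pow W \<times> Pow W" by auto
  then have finV: "finite Vs" unfolding Vs_def using finite_W by (intro finite_imageI) (auto elim: finite_subset)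
  have lt: "x < eta H lam" if x: "x \<in> Vs" for x
  proof -
    obtain I Q where IQ: "I \<subseteq> Q" "Q \<subseteq> W" "\<not> (I = Q \<and> ideal Q)" "x = sum lam I * sum lam (cn Q)"
      using x unfolding Vs_def by auto
    have le: "sum lam Q * sum lam (cn Q) \<le> eta H lam" using eta_ge_cn[OF IQ(2)] .
    show ?thesis
    proof (cases "I = Q")
      case True
      then show ?thesis using IQ le by (auto simp: ideal_def)
    next
      case False
      then have s: "sum lam I < sum lam Q" using IQ by (intro lam_sum_strict) auto
      show ?thesis
      proof (cases "cn Q = {}")
        case True
        then show ?thesis using IQ eta_pos by simp
      next
        case False
        then have "x < sum lam Q * sum lam (cn Q)" using s IQ(4) lam_sum_pos[OF cn_sub False] by simp
        then show ?thesis using le by simp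
      qed
    qed
  qed
  \<comment> \<open>Inserting \<open>eta H lam / 2\<close> keeps the maximum positive even if
    \<open>Vs\<close> is empty or contains only \<open>0\<close>, so that
    \<open>ln (eta H lam / M)\<close> makes sense.\<close>
  define M where "M = Max (insert (eta H lam / 2) Vs)"
  have M: "M < eta H lam" "\<And>x. x \<in> Vs \<Longrightarrow> x \<le> M"
    unfolding M_def using finV lt eta_pos by auto
  have "M \<ge> eta H lam / 2" unfolding M_def using finV by (intro Max_ge) auto
  from less_le_trans[OF half_gt_zero[OF eta_pos] this] have Mpos: "M > 0" .
  define \<kappa> where "\<kappa> = ln (eta H lam / M)"
  have quot: "eta H lam / M > 1" using M(1) Mpos by (simp add: less_divide_eq)
  then have "exp (- \<kappa>) = M / eta H lam"
    unfolding \<kappa>_def exp_minus by (subst exp_ln) (auto intro: less_trans[OF zero_less_one])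
  then have \<kappa>: "\<kappa> > 0" "eta H lam * exp (- \<kappa>) = M"
    unfolding \<kappa>_def using quot eta_pos by (simp_all only: ln_gt_zero) (simp add: field_simps)
  show thesis
  proof (rule that[of L \<kappa>])
    show "L \<ge> 0" "\<kappa> > 0" using \<kappa> by (auto simp: L_def)
    fix I Q assume IQ: "I \<subseteq> W" "Q \<subseteq> W"
    show "sum lam I * sum lam (cn Q) \<le> eta H lam * exp (psi L \<kappa> ideal I Q)"
    proof (cases "I \<subseteq> Q")
      case False
      have "sum lam I * sum lam (cn Q) \<le> sum lam W * sum lam W"
        using IQ cn_sub by (intro mult_mono lam_sum_mono lam_sum_nonneg) auto
      then show ?thesis using False L by (simp add: psi_def power2_eq_square)
    next
      case True
      show ?thesis
      proof (cases "I = Q \<and> ideal Q")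
        case True
        then show ?thesis by (simp add: psi_def ideal_def)
      next
        case False
        then have "sum lam I * sum lam (cn Q) \<in> Vs" 
          unfolding Vs_def using True IQ by (intro image_eqI[of _ _ "(I, Q)"]) auto
        from M(2)[OF this] show ?thesis using True False \<kappa>(2) by (auto simp: psi_def)
      qed
    qed
  qed
qed

end

locale torus_colouring = even_torus m d + weighted_target H lam
  for m d :: nat and H :: "'b ugraph" and lam :: "'b \<Rightarrow> real"
begin

abbreviation G where "G \<equiv> torus m d"
abbreviation Homs where "Homs \<equiv> Hom (torus m d) H"
abbreviation wt where "wt S a \<equiv> (\<Prod>v\<in>S. lam (a v))"

definition cset :: "(nat list \<Rightarrow> 'b) \<Rightarrow> nat list \<Rightarrow> 'b set" where
  "cset f v = f ` nbrs v"

lemma Hom_iff: "f \<in> Homs \<longleftrightarrow> f \<in> V \<rightarrow>\<^sub>E W \<and> (\<forall>v\<in>Od. f v \<in> cn (cset f v))"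
proof
  assume f: "f \<in> Homs"
  then have PiE: "f \<in> V \<rightarrow>\<^sub>E W" by (simp add: Hom_def verts_torus)
  have "f v \<in> cn (cset f v)" if v: "v \<in> Od" for v
  proof -
    have "{f u, f v} \<in> edges H" if "u \<in> nbrs v" for u
    proof -
      have "{u, v} \<in> edges G" using that v Od_V edge_iff by (metis insert_commute)
      then show ?thesis using f by (auto simp: Hom_def)
    qed
    then show ?thesis using PiE v Od_V by (auto simp: cn_def cset_def)
  qed
  then show "f \<in> V \<rightarrow>\<^sub>E W \<and> (\<forall>v\<in>Od. f v \<in> cn (cset f v))" using PiE by blast
next
  assume f: "f \<in> V \<rightarrow>\<^sub>E W \<and> (\<forall>v\<in>Od. f v \<in> cn (cset f v))"
  have "{f u, f v} \<in> edges H" if e: "{u, v} \<in> edges G" for u v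
  proof -
    have uv: "u \<in> V" "v \<in> nbrs u" using e edge_iff by auto
    then have vu: "u \<in> nbrs v" using nbrs_sym by blast
    show ?thesis
    proof (cases "u \<in> Od")
      case True
      then have "{f v, f u} \<in> edges H" using f uv by (auto simp: cn_def cset_def)
      then show ?thesis by (metis insert_commute)
    next
      case False
      then have "u \<in> Ev" using uv Ev_Od by blast
      then have "v \<in> Od" using uv nbrs_Ev by blast
      then show ?thesis using f vu by (auto simp: cn_def cset_def)
    qed
  qed
  then show "f \<in> Homs" using f by (simp add: Hom_def verts_torus)
qed

lemma finite_Homs: "finite Homs"
proof (rule finite_subset)
  show "Homs \<subseteq> V \<rightarrow>\<^sub>E W" using Hom_iff by blast
  show "finite (V \<rightarrow>\<^sub>E W)" using finite_V finite_W by (intro finite_PiE) auto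
qed

lemma col_weight_eq: "col_weight G lam f = wt Ev f * wt Od f"
proof -
  have "wt (Ev \<union> Od) f = wt Ev f * wt Od f"
    using finite_Ev finite_Od Ev_Od(2) by (rule prod.union_disjoint)
  then show ?thesis by (simp add: col_weight_def verts_torus Ev_Od)
qed

lemma col_weight_pos: "f \<in> Homs \<Longrightarrow> col_weight G lam f > 0"
  unfolding col_weight_def verts_torus using lam_pos
  by (intro prod_pos) (auto simp: Hom_iff PiE_iff)

lemma set_weight_nonneg: "S \<subseteq> Homs \<Longrightarrow> set_weight G lam S \<ge> 0"
  unfolding set_weight_def using col_weight_pos by (intro sum_nonneg) (auto intro: less_imp_le)

lemma set_weight_mono: "S \<subseteq> S' \<Longrightarrow> S' \<subseteq> Homs \<Longrightarrow> set_weight G lam S \<le> set_weight G lam S'"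
  unfolding set_weight_def using col_weight_pos finite_Homs
  by (intro sum_mono2) (auto intro: less_imp_le finite_subset)

lemma cset_restrict: "v \<in> Od \<Longrightarrow> cset (restrict f Ev) v = cset f v"
  using nbrs_Od unfolding cset_def by (intro image_cong) auto

lemma cset_sub: "f \<in> V \<rightarrow>\<^sub>E W \<Longrightarrow> v \<in> V \<Longrightarrow> cset f v \<subseteq> W"
  using nbrs_V unfolding cset_def by (auto simp: PiE_iff)

lemma sum_Homs_factor:
  fixes F :: "(nat list \<Rightarrow> 'b) \<Rightarrow> (nat list \<Rightarrow> 'b) \<Rightarrow> real"
  shows "(\<Sum>f\<in>Homs. F (restrict f Ev) (restrict f Od))
    = (\<Sum>a\<in>Ev \<rightarrow>\<^sub>E W. \<Sum>b\<in>PiE Od (\<lambda>v. cn (cset a v)). F a b)"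
proof -
  let ?glue = "\<lambda>(a, b). \<lambda>v\<in>V. if v \<in> Ev then a v else b v"
  have "(\<Sum>f\<in>Homs. F (restrict f Ev) (restrict f Od))
      = (\<Sum>(a, b)\<in>(SIGMA a:(Ev \<rightarrow>\<^sub>E W). PiE Od (\<lambda>v. cn (cset a v))). F a b)"
  proof (rule sum.reindex_bij_witness[where i = ?glue and j = "\<lambda>f. (restrict f Ev, restrict f Od)"])
    fix f assume "f \<in> Homs"
    then have f: "f \<in> V \<rightarrow>\<^sub>E W" "\<And>v. v \<in> Od \<Longrightarrow> f v \<in> cn (cset f v)" using Hom_iff by auto
    show "?glue (restrict f Ev, restrict f Od) = f"
    proof
      fix v show "?glue (restrict f Ev, restrict f Od) v = f v"
        using f(1) Ev_Od by (cases "v \<in> V") (auto simp: PiE_iff extensional_def)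
    qed
    show "(restrict f Ev, restrict f Od) \<in> (SIGMA a:(Ev \<rightarrow>\<^sub>E W). PiE Od (\<lambda>v. cn (cset a v)))"
      using f Ev_V by (auto simp: cset_restrict PiE_iff)
  next
    fix p assume "p \<in> (SIGMA a:(Ev \<rightarrow>\<^sub>E W). PiE Od (\<lambda>v. cn (cset a v)))"
    then obtain a b where p: "p = (a, b)" "a \<in> Ev \<rightarrow>\<^sub>E W" "b \<in> PiE Od (\<lambda>v. cn (cset a v))" by auto
    have ra: "restrict (?glue p) Ev = a"
    proof
      fix v show "restrict (?glue p) Ev v = a v"
        using p Ev_V by (cases "v \<in> Ev") (auto simp: PiE_iff extensional_def)
    qed
    have rb: "restrict (?glue p) Od = b"
    proof
      fix v show "restrict (?glue p) Od v = b v"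
        using p Od_V Od_not_Ev by (cases "v \<in> Od") (auto simp: PiE_iff extensional_def)
    qed
    show "(restrict (?glue p) Ev, restrict (?glue p) Od) = p" using ra rb p by simp
    have "cset (?glue p) v = cset a v" if "v \<in> Od" for v using cset_restrict[OF that, of "?glue p"] ra by simp
    moreover have "?glue p v = b v" if "v \<in> Od" for v using p(1) that Od_V Od_not_Ev by simp
    moreover have "?glue p \<in> V \<rightarrow>\<^sub>E W"
    proof (rule PiE_I)
      fix v assume "v \<in> V"
      then consider "v \<in> Ev" | "v \<in> Od" using Ev_Od(1) by blast
      then show "?glue p v \<in> W"
      proof cases
        case 1
        then show ?thesis using p(1) PiE_mem[OF p(2)] Ev_V by simp
      next
        case 2
        then have "b v \<in> W" using PiE_mem[OF p(3)] cn_sub by blast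
        then show ?thesis using 2 p(1) Od_V Od_not_Ev by simp
      qed
    qed (use p in auto)
    ultimately show "?glue p \<in> Homs" unfolding Hom_iff using PiE_mem[OF p(3)] by simp
  qed auto
  also have "\<dots> = (\<Sum>a\<in>Ev \<rightarrow>\<^sub>E W. \<Sum>b\<in>PiE Od (\<lambda>v. cn (cset a v)). F a b)"
    using finite_Ev finite_Od finite_W fin_sub[OF cn_sub]
    by (subst sum.Sigma) (auto intro!: finite_PiE)
  finally show ?thesis .
qed

lemma set_weight_factor:
  "set_weight G lam {f \<in> Homs. R (restrict f Ev) (restrict f Od)}
    = (\<Sum>a\<in>Ev \<rightarrow>\<^sub>E W. \<Sum>b\<in>PiE Od (\<lambda>v. cn (cset a v)). of_bool (R a b) * (wt Ev a * wt Od b))"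
proof -
  have "set_weight G lam {f \<in> Homs. R (restrict f Ev) (restrict f Od)}
      = (\<Sum>f\<in>Homs. of_bool (R (restrict f Ev) (restrict f Od)) * (wt Ev (restrict f Ev) * wt Od (restrict f Od)))"
    unfolding set_weight_def col_weight_eq using finite_Homs
    by (simp add: sum.inter_filter of_bool_def if_distrib[of "\<lambda>x. x * _"] cong: if_cong)
  then show ?thesis
    using sum_Homs_factor[of "\<lambda>a b. of_bool (R a b) * (wt Ev a * wt Od b)"] by simp
qed

lemma wt_PiE: "finite S \<Longrightarrow> (\<And>v. v \<in> S \<Longrightarrow> B v \<subseteq> W) \<Longrightarrow> (\<Sum>b\<in>PiE S B. wt S b) = (\<Prod>v\<in>S. sum lam (B v))"
  using sum_prod_PiE[of S B "\<lambda>_. lam"] fin_sub by simp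

lemma set_weight_factor_Ev:
  "set_weight G lam {f \<in> Homs. R (restrict f Ev)}
    = (\<Sum>a\<in>Ev \<rightarrow>\<^sub>E W. of_bool (R a) * (wt Ev a * (\<Prod>v\<in>Od. sum lam (cn (cset a v)))))"
  unfolding set_weight_factor[of "\<lambda>a b. R a"] sum_distrib_left[symmetric]
  by (simp add: wt_PiE[OF finite_Od cn_sub])

text \<open>For one maximising pair, the colourings sending \<open>Ev\<close> into \<open>A\<close>
  and \<open>Od\<close> into \<open>B\<close> already have this weight. The upper bounds of the
  counting argument carry the same power of \<open>eta\<close>, and the two cancel.\<close>

lemma partition_fun_ge:
  assumes "d \<ge> 1"
  shows "eta H lam ^ card Ev \<le> partition_fun G H lam"
proof -
  obtain A B where AB: "(A, B) \<in> max_pairs H lam" using ex_max_pair by blast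
  note AB = max_pairD[OF this]
  have "eta H lam ^ card Ev = (\<Prod>v\<in>Ev. sum lam A) * (\<Prod>v\<in>Od. sum lam B)"
    using AB(9) card_Ev_Od[OF assms] by (simp add: power_mult_distrib[symmetric])
  also have "\<dots> = (\<Sum>a\<in>Ev \<rightarrow>\<^sub>E A. wt Ev a * (\<Prod>v\<in>Od. sum lam B))"
    using wt_PiE[OF finite_Ev, of "\<lambda>_. A"] AB(1) by (simp add: sum_distrib_right[symmetric])
  also have "\<dots> \<le> (\<Sum>a\<in>Ev \<rightarrow>\<^sub>E A. wt Ev a * (\<Prod>v\<in>Od. sum lam (cn (cset a v))))"
  proof (intro sum_mono mult_left_mono prod_mono conjI)
    fix a v assume a: "a \<in> Ev \<rightarrow>\<^sub>E A" and v: "v \<in> Od"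
    show "0 \<le> sum lam B" using AB by simp
    have "cset a v \<subseteq> A" using a nbrs_Od[OF v] by (auto simp: cset_def PiE_iff)
    then have "B \<subseteq> cn (cset a v)" using cn_antimono AB(7) by blast
    then show "sum lam B \<le> sum lam (cn (cset a v))" using cn_sub by (intro lam_sum_mono)
  next
    fix a assume "a \<in> Ev \<rightarrow>\<^sub>E A"
    then show "0 \<le> wt Ev a" using AB(1) lam_pos by (intro prod_nonneg) (auto simp: PiE_iff intro: less_imp_le)
  qed
  also have "\<dots> \<le> (\<Sum>a\<in>Ev \<rightarrow>\<^sub>E W. wt Ev a * (\<Prod>v\<in>Od. sum lam (cn (cset a v))))"
    using finite_Ev finite_W AB(1) lam_pos cn_sub
    by (intro sum_mono2 finite_PiE mult_nonneg_nonneg prod_nonneg lam_sum_nonneg PiE_mono)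
      (auto simp: PiE_iff intro: less_imp_le)
  also have "\<dots> = set_weight G lam Homs" using set_weight_factor_Ev[of "\<lambda>_. True"] by simp
  finally show ?thesis by (simp add: partition_fun_def)
qed

end

section \<open>Weight of the colourings with a prescribed pattern\<close>

context torus_colouring
begin

lemma cset_compose:
  assumes "v \<in> V" "g ` nbrs v = nbrs (g v)"
  shows "cset (compose V f g) v = cset f (g v)"
proof -
  have "cset (compose V f g) v = (\<lambda>u. f (g u)) ` nbrs v"
    unfolding cset_def using nbrs_V[OF assms(1)] by (intro image_cong) (auto simp: compose_eq)
  then show ?thesis using assms(2) by (simp add: cset_def flip: image_image)
qed

context
  fixes g
  assumes g: "bij_betw g V V" "\<And>v. v \<in> V \<Longrightarrow> g ` nbrs v = nbrs (g v)"
begin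

lemma compose_Homs:
  assumes f: "f \<in> Homs"
  shows "compose V f g \<in> Homs"
proof -
  have "{compose V f g u, compose V f g v} \<in> edges H" if "{u, v} \<in> edges G" for u v
  proof -
    have uv: "u \<in> V" "v \<in> nbrs u" using that edge_iff by auto
    then have vV: "v \<in> V" using nbrs_V by blast
    have "g u \<in> V" using g(1) uv bij_betwE by blast
    moreover have "g v \<in> nbrs (g u)" using uv g(2) by blast
    ultimately have "{g u, g v} \<in> edges G" using edge_iff by blast
    then show ?thesis using f uv vV by (simp add: Hom_def compose_eq)
  qed
  moreover have "compose V f g \<in> V \<rightarrow>\<^sub>E W"
    using f g(1) by (auto simp: Hom_iff compose_def bij_betwE PiE_iff)
  ultimately show ?thesis by (simp add: Hom_def verts_torus)
qed

lemma col_weight_compose: "col_weight G lam (compose V f g) = col_weight G lam f"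
proof -
  have "(\<Prod>v\<in>V. lam (compose V f g v)) = (\<Prod>v\<in>V. lam (f (g v)))"
    by (intro prod.cong) (auto simp: compose_eq)
  also have "\<dots> = (\<Prod>v\<in>V. lam (f v))" by (rule prod.reindex_bij_betw[OF g(1)])
  finally show ?thesis by (simp add: col_weight_def verts_torus)
qed

lemma bij_compose_Homs: "bij_betw (\<lambda>f. compose V f g) Homs Homs"
proof -
  have inj: "inj_on (\<lambda>f. compose V f g) Homs"
  proof (rule inj_onI)
    fix f f' assume f: "f \<in> Homs" "f' \<in> Homs" "compose V f g = compose V f' g"
    show "f = f'"
    proof (rule extensionalityI[of _ V])
      show "f \<in> extensional V" "f' \<in> extensional V" using f(1,2) by (auto simp: Hom_iff PiE_iff)
      fix x assume "x \<in> V"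
      then obtain y where "y \<in> V" "x = g y" using g(1) by (auto simp: bij_betw_def)
      then show "f x = f' x" using f(3) by (metis compose_eq)
    qed
  qed
  have "(\<lambda>f. compose V f g) ` Homs = Homs"
    by (rule endo_inj_surj[OF finite_Homs _ inj]) (use compose_Homs in auto)
  then show ?thesis using inj by (simp add: bij_betw_def)
qed

lemma set_weight_compose:
  "set_weight G lam {f \<in> Homs. Q (compose V f g)} = set_weight G lam {f \<in> Homs. Q f}"
proof -
  have "set_weight G lam {f \<in> Homs. Q (compose V f g)}
      = (\<Sum>f\<in>Homs. if Q (compose V f g) then col_weight G lam (compose V f g) else 0)"
    unfolding set_weight_def col_weight_compose using finite_Homs by (simp add: sum.inter_filter)
  also have "\<dots> = (\<Sum>f\<in>Homs. if Q f then col_weight G lam f else 0)"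
    by (rule sum.reindex_bij_betw[OF bij_compose_Homs])
  also have "\<dots> = set_weight G lam {f \<in> Homs. Q f}"
    unfolding set_weight_def using finite_Homs by (simp add: sum.inter_filter)
  finally show ?thesis .
qed

end

text \<open>As \<open>u\<close> is adjacent to its sampled neighbours, \<open>f u\<close> lies in
  \<open>I u\<close>, a set depending only on the pattern \<open>\<tau>\<close>. So the restrictions
  to \<open>Ev\<close> have total weight at most the product of the \<open>sum lam (I u)\<close>,
  and it remains to bound this product times the weight of the odd completions, for each single
  colouring.\<close>

lemma fixed_pattern_weight_le:
  assumes d: "d \<ge> 1"
    and LK: "\<And>I Q. I \<subseteq> W \<Longrightarrow> Q \<subseteq> W \<Longrightarrow> sum lam I * sum lam (cn Q) \<le> eta H lam * exp (psi L \<kappa> ideal I Q)"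
    and smp: "\<And>u. u \<in> Ev \<Longrightarrow> smp u \<noteq> {}" "\<And>u i. u \<in> Ev \<Longrightarrow> i \<in> smp u \<Longrightarrow> i < d \<and> nb i 1 u \<in> T"
    and N: "N \<subseteq> Homs" "\<And>f v. f \<in> N \<Longrightarrow> v \<in> T \<Longrightarrow> cset f v = \<tau> v"
      "\<And>f. f \<in> N \<Longrightarrow> Psi L \<kappa> ideal smp (cset f) \<le> - R * real (d * card Sg)"
  shows "set_weight G lam N \<le> eta H lam ^ card Ev * exp (- R)"
proof (cases "N = {}")
  case True
  then show ?thesis using eta_pos by (simp add: set_weight_def)
next
  case False
  define I where "I u = (\<Inter>i\<in>smp u. \<tau> (nb i 1 u))" for u
  define D where "D = real (d * card Sg)"
  have D: "D > 0" using d card_Sg(1) by (simp add: D_def)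
  have Ieq: "(\<Inter>i\<in>smp u. cset f (nb i 1 u)) = I u" if "f \<in> N" "u \<in> Ev" for f u
    unfolding I_def using N(2)[OF that(1)] smp(2)[OF that(2)] by simp
  have fI: "f u \<in> I u" if f: "f \<in> N" and u: "u \<in> Ev" for f u
  proof -
    have "f u \<in> cset f (nb i 1 u)" if "i \<in> smp u" for i
      unfolding cset_def
      using nbrs_sym[OF Ev_V[OF u] nbrs_I[OF _ Sg_one]] smp(2)[OF u that] by blast
    then show ?thesis using Ieq[OF f u] by blast
  qed
  have IW: "I u \<subseteq> W" if u: "u \<in> Ev" for u
  proof -
    obtain f where f: "f \<in> N" using False by blast
    obtain i where i: "i \<in> smp u" using smp(1)[OF u] by blast
    have "cset f (nb i 1 u) \<subseteq> W"
      using f N(1) smp(2)[OF u i] Ev_V[OF u] Hom_iff by (intro cset_sub nb_in_V) blast+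
    then show ?thesis using Ieq[OF f u] i by blast
  qed
  have Ipos: "sum lam (I u) > 0" if "u \<in> Ev" for u
  proof -
    obtain f where "f \<in> N" using False by blast
    then show ?thesis using fI[OF _ that] IW[OF that] by (intro lam_sum_pos) auto
  qed
  define U where "U = eta H lam ^ card Ev * exp (- R)"
  have main: "(\<Prod>u\<in>Ev. sum lam (I u)) * (\<Prod>v\<in>Od. sum lam (cn (cset f v))) \<le> U" if f: "f \<in> N" for f
  proof -
    have fH: "f \<in> V \<rightarrow>\<^sub>E W" "\<And>v. v \<in> Od \<Longrightarrow> f v \<in> cn (cset f v)" using f N(1) Hom_iff by auto
    have cpos: "sum lam (cn (cset f v)) > 0" if "v \<in> Od" for v
      using fH(2)[OF that] cn_sub by (intro lam_sum_pos) auto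
    \<comment> \<open>In the sum over all edges each vertex is counted \<open>D\<close> times. The
      estimate for one edge, averaged over all of them, therefore bounds the whole product.\<close>
    have edge: "ln (sum lam (I u)) + ln (sum lam (cn (cset f (nb j s u)))) \<le> ln (eta H lam) + psi L \<kappa> ideal (I u) (cset f (nb j s u))"
      if u: "u \<in> Ev" and j: "j < d" and s: "s \<in> Sg" for u j s
    proof -
      have o: "nb j s u \<in> Od" using nb_Ev[OF u j s] .
      have "ln (sum lam (I u)) + ln (sum lam (cn (cset f (nb j s u)))) = ln (sum lam (I u) * sum lam (cn (cset f (nb j s u))))"
        using Ipos[OF u] cpos[OF o] by (simp add: ln_mult)
      also have "\<dots> \<le> ln (eta H lam * exp (psi L \<kappa> ideal (I u) (cset f (nb j s u))))"
        using LK[OF IW[OF u] cset_sub[OF fH(1) Od_V[OF o]]] Ipos[OF u] cpos[OF o] eta_pos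
        by (subst ln_le_cancel_iff) auto
      also have "\<dots> = ln (eta H lam) + psi L \<kappa> ideal (I u) (cset f (nb j s u))"
        using eta_pos by (simp add: ln_mult)
      finally show ?thesis .
    qed
    have "D * ((\<Sum>u\<in>Ev. ln (sum lam (I u))) + (\<Sum>v\<in>Od. ln (sum lam (cn (cset f v)))))
        = (\<Sum>u\<in>Ev. \<Sum>j<d. \<Sum>s\<in>Sg. ln (sum lam (I u)) + ln (sum lam (cn (cset f (nb j s u)))))"
      unfolding D_def by (rule sum_over_edges[symmetric])
    also have "\<dots> \<le> (\<Sum>u\<in>Ev. \<Sum>j<d. \<Sum>s\<in>Sg. ln (eta H lam) + psi L \<kappa> ideal (I u) (cset f (nb j s u)))"
      using edge by (intro sum_mono) auto
    also have "\<dots> = D * (card Ev * ln (eta H lam)) + Psi L \<kappa> ideal smp (cset f)"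
      unfolding Psi_def D_def using Ieq[OF f] by (simp add: sum.distrib algebra_simps)
    also have "\<dots> \<le> D * (card Ev * ln (eta H lam)) - R * D" using N(3)[OF f] by (simp add: D_def)
    also have "\<dots> = D * (card Ev * ln (eta H lam) - R)" by (simp add: algebra_simps)
    finally have le: "(\<Sum>u\<in>Ev. ln (sum lam (I u))) + (\<Sum>v\<in>Od. ln (sum lam (cn (cset f v)))) \<le> card Ev * ln (eta H lam) - R"
      using D by simp
    have "(\<Prod>u\<in>Ev. sum lam (I u)) * (\<Prod>v\<in>Od. sum lam (cn (cset f v)))
        = exp ((\<Sum>u\<in>Ev. ln (sum lam (I u))) + (\<Sum>v\<in>Od. ln (sum lam (cn (cset f v)))))"
      unfolding exp_add exp_sum[OF finite_Ev] exp_sum[OF finite_Od] using Ipos cpos by simp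
    also have "\<dots> \<le> exp (card Ev * ln (eta H lam) - R)" using le by simp
    also have "\<dots> = U"
      using eta_pos by (simp add: U_def exp_diff exp_minus exp_of_nat_mult divide_inverse)
    finally show ?thesis .
  qed
  \<comment> \<open>\<open>PI\<close> is the same for all colourings in \<open>N\<close>. Dividing
    by it bounds the odd completions uniformly, and summing the even weights over the whole box
    \<open>PiE Ev I\<close> restores it.\<close>
  define PI where "PI = (\<Prod>u\<in>Ev. sum lam (I u))"
  have PI: "PI > 0" unfolding PI_def using Ipos by (intro prod_pos) auto
  define NE where "NE = (\<lambda>f. restrict f Ev) ` N"
  have NE: "a \<in> PiE Ev I" "a \<in> Ev \<rightarrow>\<^sub>E W" "(\<Prod>v\<in>Od. sum lam (cn (cset a v))) \<le> U / PI" if a: "a \<in> NE" for a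
  proof -
    obtain f where f: "f \<in> N" "a = restrict f Ev" using a by (auto simp: NE_def)
    show "a \<in> PiE Ev I" unfolding f(2) using fI[OF f(1)] by auto
    then show "a \<in> Ev \<rightarrow>\<^sub>E W" using IW by (auto simp: PiE_iff)
    have "(\<Prod>v\<in>Od. sum lam (cn (cset a v))) = (\<Prod>v\<in>Od. sum lam (cn (cset f v)))"
      unfolding f(2) by (intro prod.cong) (auto simp: cset_restrict)
    then show "(\<Prod>v\<in>Od. sum lam (cn (cset a v))) \<le> U / PI"
      using main[OF f(1)] PI by (simp add: PI_def field_simps)
  qed
  have finI: "finite (PiE Ev I)" using finite_Ev IW fin_sub by (intro finite_PiE) auto
  have wtpos: "wt Ev a \<ge> 0" if "a \<in> PiE Ev I" for a
    using that IW lam_pos by (intro prod_nonneg) (auto simp: PiE_iff intro!: less_imp_le)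
  have "set_weight G lam N \<le> set_weight G lam {f \<in> Homs. restrict f Ev \<in> NE}"
    using N(1) by (intro set_weight_mono) (auto simp: NE_def)
  also have "\<dots> = (\<Sum>a\<in>Ev \<rightarrow>\<^sub>E W. of_bool (a \<in> NE) * (wt Ev a * (\<Prod>v\<in>Od. sum lam (cn (cset a v)))))"
    by (rule set_weight_factor_Ev)
  also have "\<dots> = (\<Sum>a\<in>NE. wt Ev a * (\<Prod>v\<in>Od. sum lam (cn (cset a v))))"
  proof -
    have "finite (Ev \<rightarrow>\<^sub>E W)" using finite_Ev finite_W by (intro finite_PiE) auto
    then show ?thesis using NE(2)
      by (intro sum.mono_neutral_cong_right) auto
  qed
  also have "\<dots> \<le> (\<Sum>a\<in>NE. wt Ev a * (U / PI))"
    using NE wtpos by (intro sum_mono mult_left_mono) auto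
  also have "\<dots> \<le> (\<Sum>a\<in>PiE Ev I. wt Ev a * (U / PI))"
    using NE(1) finI wtpos PI eta_pos by (intro sum_mono2) (auto simp: U_def)
  also have "\<dots> = U"
    using wt_PiE[where B = I, OF finite_Ev IW] PI
    by (simp only: sum_distrib_right[symmetric] PI_def[symmetric]) simp
  finally show ?thesis by (simp add: U_def)
qed

text \<open>The colourings are split by their pattern: the sets at \<open>v0\<close>, on
  \<open>S\<close> and on \<open>T\<close>. Each prediction error costs a factor
  \<open>exp (- \<theta>)\<close>, and the summation goes from the inside out: over \<open>T\<close>
  with the pattern on \<open>S\<close> as prediction, over \<open>S\<close> with the value at
  \<open>v0\<close> as prediction, finally over the \<open>2 ^ card W\<close> values at
  \<open>v0\<close>.\<close>

lemma nice_weight_le: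
  assumes d: "d \<ge> 1"
    and LK: "\<And>I Q. I \<subseteq> W \<Longrightarrow> Q \<subseteq> W \<Longrightarrow> sum lam I * sum lam (cn Q) \<le> eta H lam * exp (psi L \<kappa> ideal I Q)"
    and smp: "\<And>u. u \<in> Ev \<Longrightarrow> smp u \<noteq> {}" "\<And>u i. u \<in> Ev \<Longrightarrow> i \<in> smp u \<Longrightarrow> i < d \<and> nb i 1 u \<in> T"
    and T: "T \<subseteq> Od" "S \<subseteq> Od" "v0 \<in> Od" "\<And>v. v \<in> T \<Longrightarrow> s0 v \<in> S"
  shows "set_weight G lam {f \<in> Homs. Psi L \<kappa> ideal smp (cset f)
        + \<theta> * real (d * card Sg) * penalty s0 T S v0 (cset f) \<le> - R * real (d * card Sg)}
    \<le> eta H lam ^ card Ev * exp (- R) * 2 ^ card W * (1 + 2 ^ card W * exp (- \<theta>)) ^ (card T + card S)"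
    (is "set_weight G lam ?N \<le> _")
proof -
  define \<Omega> where "\<Omega> = Pow W"
  have fin\<Omega>: "finite \<Omega>" "card \<Omega> = 2 ^ card W" using finite_W by (auto simp: \<Omega>_def card_Pow)
  have fin: "finite T" "finite S" using finite_subset[OF _ finite_Od] T(1,2) by auto
  have finPi: "finite (S \<rightarrow>\<^sub>E \<Omega>)" "finite (T \<rightarrow>\<^sub>E \<Omega>)" using fin fin\<Omega> by (auto intro: finite_PiE)
  define pat where "pat f = (cset f v0, restrict (cset f) S, restrict (cset f) T)" for f
  define PP where "PP = \<Omega> \<times> (S \<rightarrow>\<^sub>E \<Omega>) \<times> (T \<rightarrow>\<^sub>E \<Omega>)"
  have finPP: "finite PP" using fin\<Omega> finPi by (simp add: PP_def)
  have finN: "finite ?N" using finite_Homs by simp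
  have patPP: "pat ` ?N \<subseteq> PP"
  proof -
    have "cset f v \<in> \<Omega>" if "f \<in> Homs" "v \<in> Od" for f v
      using cset_sub[of f v] that Od_V by (auto simp: Hom_iff \<Omega>_def)
    then show ?thesis using T by (auto simp: pat_def PP_def)
  qed
  define U where "U = eta H lam ^ card Ev * exp (- R)"
  have U: "U > 0" using eta_pos by (simp add: U_def)
  have each: "set_weight G lam {f \<in> ?N. pat f = (A, \<sigma>, \<tau>)}
      \<le> U * (exp (- \<theta> * real (card {v \<in> S. \<sigma> v \<noteq> A})) * exp (- \<theta> * real (card {v \<in> T. \<tau> v \<noteq> \<sigma> (s0 v)})))"
    for A \<sigma> \<tau>
  proof -
    \<comment> \<open>On one pattern the penalty is constant, so the condition becomes a pure bound
      on \<open>Psi\<close>, with the prices added to the gain.\<close>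
    define R' where "R' = R + \<theta> * (real (card {v \<in> T. \<tau> v \<noteq> \<sigma> (s0 v)}) + real (card {v \<in> S. \<sigma> v \<noteq> A}))"
    have "set_weight G lam {f \<in> ?N. pat f = (A, \<sigma>, \<tau>)} \<le> eta H lam ^ card Ev * exp (- R')"
    proof (rule fixed_pattern_weight_le[where \<tau> = \<tau> and T = T and smp = smp, OF d LK smp])
      show "{f \<in> ?N. pat f = (A, \<sigma>, \<tau>)} \<subseteq> Homs" by auto
      fix f assume "f \<in> {f \<in> ?N. pat f = (A, \<sigma>, \<tau>)}"
      then have f: "f \<in> ?N" "cset f v0 = A" "restrict (cset f) S = \<sigma>" "restrict (cset f) T = \<tau>"
        by (auto simp: pat_def)
      show "cset f v = \<tau> v" if "v \<in> T" for v using f(4) that by auto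
      have "{v \<in> T. cset f v \<noteq> cset f (s0 v)} = {v \<in> T. \<tau> v \<noteq> \<sigma> (s0 v)}"
        using f(3,4) T(4) by auto
      moreover have "{v \<in> S. cset f v \<noteq> cset f v0} = {v \<in> S. \<sigma> v \<noteq> A}"
        unfolding f(2)[symmetric] f(3)[symmetric] by auto
      ultimately show "Psi L \<kappa> ideal smp (cset f) \<le> - R' * real (d * card Sg)"
        using f(1) by (simp add: penalty_def R'_def algebra_simps)
    qed auto
    also have "\<dots> = U * (exp (- \<theta> * real (card {v \<in> S. \<sigma> v \<noteq> A})) * exp (- \<theta> * real (card {v \<in> T. \<tau> v \<noteq> \<sigma> (s0 v)})))"
      unfolding U_def R'_def by (simp add: algebra_simps flip: exp_add)
    finally show ?thesis .
  qed
  let ?E = "1 + 2 ^ card W * exp (- \<theta>)"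
  have "set_weight G lam ?N = (\<Sum>p\<in>PP. set_weight G lam {f \<in> ?N. pat f = p})"
    unfolding set_weight_def using sum.group[OF finN finPP patPP, of "col_weight G lam"] by simp
  also have "\<dots> \<le> (\<Sum>(A, \<sigma>, \<tau>)\<in>PP. U * (exp (- \<theta> * real (card {v \<in> S. \<sigma> v \<noteq> A})) * exp (- \<theta> * real (card {v \<in> T. \<tau> v \<noteq> \<sigma> (s0 v)}))))"
    using each by (intro sum_mono) (auto split: prod.split)
  also have "\<dots> = U * (\<Sum>A\<in>\<Omega>. \<Sum>\<sigma>\<in>S \<rightarrow>\<^sub>E \<Omega>. exp (- \<theta> * real (card {v \<in> S. \<sigma> v \<noteq> A})) *
      (\<Sum>\<tau>\<in>T \<rightarrow>\<^sub>E \<Omega>. exp (- \<theta> * real (card {v \<in> T. \<tau> v \<noteq> \<sigma> (s0 v)}))))"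
    unfolding PP_def by (simp add: sum.cartesian_product[symmetric] sum_distrib_left)
  also have "\<dots> \<le> U * (\<Sum>A\<in>\<Omega>. \<Sum>\<sigma>\<in>S \<rightarrow>\<^sub>E \<Omega>. exp (- \<theta> * real (card {v \<in> S. \<sigma> v \<noteq> A})) * ?E ^ card T)"
    using sum_exp_mismatch_le[OF fin(1) fin\<Omega>(1), where \<theta> = \<theta>] U fin\<Omega>(2)
    by (intro mult_left_mono sum_mono) auto
  also have "\<dots> = U * (\<Sum>A\<in>\<Omega>. (\<Sum>\<sigma>\<in>S \<rightarrow>\<^sub>E \<Omega>. exp (- \<theta> * real (card {v \<in> S. \<sigma> v \<noteq> A}))) * ?E ^ card T)"
    by (simp only: sum_distrib_right)
  also have "\<dots> \<le> U * (\<Sum>A\<in>\<Omega>. ?E ^ card S * ?E ^ card T)"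
    using sum_exp_mismatch_le[OF fin(2) fin\<Omega>(1), where \<theta> = \<theta> and c = "\<lambda>_. _"] U fin\<Omega>(2)
    by (intro mult_left_mono sum_mono mult_right_mono) auto
  also have "\<dots> = U * 2 ^ card W * ?E ^ (card T + card S)"
    using fin\<Omega>(2) by (simp add: power_add algebra_simps)
  finally show ?thesis by (simp add: U_def)
qed

end

section \<open>From a small defect to one dominant ideal set\<close>

context even_torus
begin

lemma Psi_cong:
  assumes "\<And>v. v \<in> Od \<Longrightarrow> X v = Y v" "\<And>u. u \<in> Ev \<Longrightarrow> smp u \<subseteq> {..<d}"
  shows "Psi L \<kappa> P smp X = Psi L \<kappa> P smp Y"
proof -
  have "X (nb i s u) = Y (nb i s u)" if "u \<in> Ev" "i < d" "s \<in> Sg" for u i s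
    using assms(1) nb_Ev that by blast
  moreover have "(\<Inter>i\<in>smp u. X (nb i 1 u)) = (\<Inter>i\<in>smp u. Y (nb i 1 u))" if "u \<in> Ev" for u
    using assms(1) nb_Ev[OF that _ Sg_one] assms(2)[OF that] by (intro INF_cong refl) auto
  ultimately show ?thesis unfolding Psi_def by (intro sum.cong refl) auto
qed

lemma penalty_cong:
  assumes "\<And>v. v \<in> Od \<Longrightarrow> X v = Y v" "T \<subseteq> Od" "S \<subseteq> Od" "v0 \<in> Od" "\<And>v. v \<in> T \<Longrightarrow> s0 v \<in> Od"
  shows "penalty s0 T S v0 X = penalty s0 T S v0 Y"
proof -
  have "X v = Y v" "X (s0 v) = Y (s0 v)" if "v \<in> T" for v using assms(1)[of v] assms(1)[of "s0 v"] assms(2,5) that by auto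
  then have "{v \<in> T. X v \<noteq> X (s0 v)} = {v \<in> T. Y v \<noteq> Y (s0 v)}" by auto
  moreover have "X v = Y v" if "v \<in> S" for v using assms(1)[of v] assms(3) that by auto
  then have "{v \<in> S. X v \<noteq> X v0} = {v \<in> S. Y v \<noteq> Y v0}" using assms(1)[OF assms(4)] by auto
  ultimately show ?thesis by (simp add: penalty_def)
qed

text \<open>By transitivity the count is the same for every odd vertex; exchanging the sums then
  shows that a random automorphism sends \<open>v\<close> to a uniform vertex of
  \<open>Od\<close>.\<close>

lemma card_autos_uniform:
  assumes v: "v \<in> Od"
  shows "card {g \<in> autos. P (g v)} * card Od = card autos * card {w \<in> Od. P w}"
proof -
  have eq: "card {g \<in> autos. P (g w)} = card {g \<in> autos. P (g v)}" if w: "w \<in> Od" for w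
  proof -
    have "even (sum_list v) \<longleftrightarrow> even (sum_list w)" using v w by (simp add: odd_class_def)
    from transitive_auto[OF Od_V[OF v] Od_V[OF w] this] obtain h where h: "h \<in> autos" "h v = w" by blast
    show ?thesis using card_autos_pair_shift[OF h(1) Od_V[OF v] Od_V[OF v], of "\<lambda>a b. P a"] h(2) by simp
  qed
  have "real (card {g \<in> autos. P (g v)} * card Od) = (\<Sum>w\<in>Od. real (card {g \<in> autos. P (g w)}))"
    using eq by simp
  also have "\<dots> = (\<Sum>w\<in>Od. \<Sum>g\<in>autos. of_bool (P (g w)))"
    by (simp only: card_filter_eq_sum[OF finite_autos])
  also have "\<dots> = (\<Sum>g\<in>autos. \<Sum>w\<in>Od. of_bool (P (g w)))" by (rule sum.swap)
  also have "\<dots> = (\<Sum>g\<in>autos. \<Sum>w\<in>Od. of_bool (P w))"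
    by (intro sum.cong refl sum.reindex_bij_betw[OF autos_bij_Od])
  also have "\<dots> = real (card autos * card {w \<in> Od. P w})"
    by (simp add: card_filter_eq_sum[OF finite_Od])
  finally show ?thesis by (simp only: of_nat_eq_iff)
qed

text \<open>The majority value holds off a fraction \<open>\<epsilon>\<close>. If it failed
  \<open>P\<close>, every odd vertex would either miss the majority or fail \<open>P\<close>; the
  latter fraction is below \<open>q0 \<le> \<epsilon>\<close> by the second alternative in
  \<open>defect\<close>, so the two cannot fill \<open>Od\<close> when
  \<open>\<epsilon> < 1 / 2\<close>.\<close>

lemma ex_dominant:
  fixes q0 \<epsilon> :: real
  assumes d: "d \<ge> 2" and q: "real (defect X P) < q0 * card autos"
    and e: "real m * real d * q0 \<le> \<epsilon>" "\<epsilon> < 1 / 2"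
  shows "\<exists>A. P A \<and> real (card {v \<in> Od. X v \<noteq> A}) \<le> \<epsilon> * card Od"
proof -
  obtain v where v: "v \<in> Od" "card autos * card {w \<in> Od. X w \<noteq> X v} \<le> m * d * defect X P * card Od"
    using ex_majority[OF d] by blast
  have ca: "real (card autos) > 0" using card_autos_pos by simp
  have cO: "real (card Od) > 0" using v(1) finite_Od by (auto simp: card_gt_0_iff)
  have q0: "q0 \<ge> 0"
  proof (rule ccontr)
    assume "\<not> q0 \<ge> 0"
    then have "q0 * card autos \<le> 0" by (intro mult_nonpos_nonneg) auto
    then show False using q by simp
  qed
  have "q0 \<le> real m * real d * q0"
  proof -
    have "1 \<le> m * d" using d m_ge2 by simp
    then have "real 1 \<le> real (m * d)" by (simp only: of_nat_le_iff)
    then have "1 \<le> real m * real d" by simp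
    then show ?thesis using mult_right_mono[of 1 "real m * real d" q0] q0 by simp
  qed
  then have q0e: "q0 \<le> \<epsilon>" using e by simp
  have "real (card autos * card {w \<in> Od. X w \<noteq> X v}) \<le> real (m * d * defect X P * card Od)"
    using v(2) by (simp only: of_nat_le_iff)
  then have "real (card autos) * card {w \<in> Od. X w \<noteq> X v} \<le> real m * real d * real (defect X P) * card Od"
    by simp
  also have "\<dots> \<le> real m * real d * (q0 * card autos) * card Od"
    using q by (intro mult_right_mono mult_left_mono) auto
  also have "\<dots> = (real m * real d * q0) * (card autos * real (card Od))" by simp
  also have "\<dots> \<le> \<epsilon> * (card autos * real (card Od))" using e by (intro mult_right_mono) auto
  finally have "real (card autos) * card {w \<in> Od. X w \<noteq> X v} \<le> card autos * (\<epsilon> * card Od)"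
    by (simp add: algebra_simps)
  then have dom: "real (card {w \<in> Od. X w \<noteq> X v}) \<le> \<epsilon> * card Od" using ca by simp
  have "P (X v)"
  proof (rule ccontr)
    assume nP: "\<not> P (X v)"
    let ?v1 = "nb 0 1 (replicate d 0)"
    have v1: "?v1 \<in> Od" using nb_Ev[OF zero_in_Ev _ Sg_one] d by simp
    have "card {g \<in> autos. \<not> P (X (g ?v1))} \<le> defect X P"
      unfolding defect_def using finite_autos by (intro card_mono) auto
    then have "real (card {g \<in> autos. \<not> P (X (g ?v1))}) < q0 * card autos" using q by linarith
    then have "real (card {g \<in> autos. \<not> P (X (g ?v1))}) * card Od < q0 * card autos * card Od"
      using cO by simp
    moreover have "real (card {g \<in> autos. \<not> P (X (g ?v1))}) * card Od = real (card autos) * card {w \<in> Od. \<not> P (X w)}"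
      using arg_cong[OF card_autos_uniform[OF v1, of "\<lambda>w. \<not> P (X w)"], of real] by simp
    ultimately have "real (card autos) * card {w \<in> Od. \<not> P (X w)} < card autos * (q0 * card Od)"
      by (simp add: algebra_simps)
    then have "real (card {w \<in> Od. \<not> P (X w)}) < q0 * card Od" using ca by simp
    moreover have "card Od \<le> card {w \<in> Od. X w \<noteq> X v} + card {w \<in> Od. \<not> P (X w)}"
    proof -
      have "Od \<subseteq> {w \<in> Od. X w \<noteq> X v} \<union> {w \<in> Od. \<not> P (X w)}" using nP by auto
      then have "card Od \<le> card ({w \<in> Od. X w \<noteq> X v} \<union> {w \<in> Od. \<not> P (X w)})"
        using finite_Od by (intro card_mono) auto
      then show ?thesis using card_Un_le order_trans by blast
    qed
    ultimately have "real (card Od) < \<epsilon> * card Od + q0 * card Od" using dom by linarith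
    also have "\<dots> \<le> \<epsilon> * card Od + \<epsilon> * card Od" using q0e cO by simp
    finally have "real (card Od) * 1 < real (card Od) * (2 * \<epsilon>)" by (simp add: algebra_simps)
    then have "1 < 2 * \<epsilon>" using cO by (simp only: mult_less_cancel_left_pos)
    then show False using e by simp
  qed
  then show ?thesis using dom by blast
qed

end

section \<open>The tail bound for the defect\<close>

context torus_colouring
begin

lemma set_weight_Un_le:
  assumes "S \<subseteq> Homs" "S' \<subseteq> Homs"
  shows "set_weight G lam (S \<union> S') \<le> set_weight G lam S + set_weight G lam S'"
proof -
  have "finite S" "finite S'" using assms finite_Homs finite_subset by auto
  then have "set_weight G lam (S \<union> S') + set_weight G lam (S \<inter> S') = set_weight G lam S + set_weight G lam S'"
    unfolding set_weight_def by (rule sum.union_inter)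
  moreover have "set_weight G lam (S \<inter> S') \<ge> 0" using assms by (intro set_weight_nonneg) auto
  ultimately show ?thesis by linarith
qed

lemma set_weight_UN_le:
  assumes "finite J" "\<And>i. i \<in> J \<Longrightarrow> S i \<subseteq> Homs"
  shows "set_weight G lam (\<Union>i\<in>J. S i) \<le> (\<Sum>i\<in>J. set_weight G lam (S i))"
  using assms
proof (induction J)
  case empty
  then show ?case by (simp add: set_weight_def)
next
  case (insert i J)
  have "set_weight G lam (S i \<union> (\<Union>i\<in>J. S i)) \<le> set_weight G lam (S i) + set_weight G lam (\<Union>i\<in>J. S i)"
    using insert.prems by (intro set_weight_Un_le) auto
  then show ?case using insert by simp
qed

text \<open>A colouring of large defect becomes \<open>nice\<close> after composition with some
  automorphism, and composition preserves weights, so the union bound costs only the factor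
  \<open>card autos\<close>. In the exponent the pattern cost, of order \<open>exp (- c * d)\<close>
  per even vertex, competes with the gain \<open>\<kappa> / (4 * k) * q0\<close>.\<close>

lemma defect_tail:
  fixes q0 :: real
  assumes LK: "\<And>I Q. I \<subseteq> W \<Longrightarrow> Q \<subseteq> W \<Longrightarrow> sum lam I * sum lam (cn Q) \<le> eta H lam * exp (psi L \<kappa> ideal I Q)"
    and L: "L \<ge> 0" "\<kappa> > 0" "real (card W) * L + \<kappa> \<le> \<kappa> * (real k - real (card W))" and k: "k \<ge> 3"
    and dk: "real k * (L + \<kappa>) \<le> real d * (\<kappa> / (2 * real k))" "d \<ge> 2" "d \<ge> k"
    and c: "c = \<kappa> / (4 * real k * (real m * real k + 9 * real m ^ 3))"
  shows "set_weight G lam {f \<in> Homs. q0 * card autos \<le> real (defect (cset f) ideal)}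
    \<le> (2 * real m * real d) ^ d * 2 ^ card W
       * exp (card Ev * (2 * 2 ^ card W * exp (- c * real d) - \<kappa> / (4 * real k) * q0))
       * partition_fun G H lam"
proof -
  \<comment> \<open>By the two code densities, \<open>c * d\<close> times the expected error count
    per unit of defect is at most \<open>c * (m * k + 9 * m ^ 3) * card Od\<close>. The constant
    \<open>c\<close> makes this bound equal to the allowance
    \<open>\<kappa> / (4 * k) * card Ev\<close>.\<close>
  define \<theta> where "\<theta> = c * real d"
  define D where "D = real (d * card Sg)"
  define R where "R = \<kappa> / (4 * real k) * card Ev * q0"
  have den: "real m * real k + 9 * real m ^ 3 > 0" using m_ge2 by (intro add_nonneg_pos) auto
  have cpos: "c > 0" unfolding c using L k den by (intro divide_pos_pos mult_pos_pos) auto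
  have d1: "d \<ge> 1" using dk by simp
  have cE: "card Ev = card Od" using card_Ev_Od[OF d1] by simp
  obtain T where T: "T \<subseteq> Od" "card T * d \<le> card Od * (m * (k - 1))"
    "\<And>u. u \<in> Ev \<Longrightarrow> k - 1 \<le> card {i. i < d \<and> nb i 1 u \<in> T}"
  proof -
    have "1 \<le> k - 1" "k - 1 \<le> d" using k dk by auto
    from ex_sample_code[OF this] show ?thesis using that by blast
  qed
  obtain S where S: "S \<subseteq> Od" "card S * d ^ 2 \<le> card Od * (9 * m ^ 2)"
    "\<And>v. v \<in> Od \<Longrightarrow> \<exists>i<d. \<exists>j<d. i \<noteq> j \<and> nb j 1 (nb i 1 v) \<in> S"
    using ex_sparse_code[OF dk(2)] by blast
  have "\<exists>B. B \<subseteq> {i. i < d \<and> nb i 1 u \<in> T} \<and> card B = k - 1" if "u \<in> Ev" for u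
    using obtain_subset_with_card_n[OF T(3)[OF that]] by metis
  then obtain smp where smp: "\<And>u. u \<in> Ev \<Longrightarrow> smp u \<subseteq> {i. i < d \<and> nb i 1 u \<in> T} \<and> card (smp u) = k - 1"
    by metis
  have smp1: "smp u \<subseteq> {..<d} \<and> Suc (card (smp u)) = k" if "u \<in> Ev" for u
    using smp[OF that] k by auto
  have smp2: "smp u \<noteq> {}" if "u \<in> Ev" for u using smp[OF that] k by auto
  have smp3: "i < d \<and> nb i 1 u \<in> T" if "u \<in> Ev" "i \<in> smp u" for u i using smp[OF that(1)] that(2) by auto
  have "\<forall>v\<in>Od. \<exists>w. w \<in> S \<and> (\<exists>i<d. \<exists>j<d. i \<noteq> j \<and> w = nb j 1 (nb i 1 v))" using S(3) by blast
  then obtain s0 where s0: "\<And>v. v \<in> Od \<Longrightarrow> s0 v \<in> S \<and> (\<exists>i<d. \<exists>j<d. i \<noteq> j \<and> s0 v = nb j 1 (nb i 1 v))"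
    by metis
  have s0T: "s0 v \<in> S" "\<exists>i<d. \<exists>j<d. i \<noteq> j \<and> s0 v = nb j 1 (nb i 1 v)" if "v \<in> T" for v
    using s0 T(1) that by auto
  define v0 where "v0 = nb 0 1 (replicate d 0)"
  have v0: "v0 \<in> Od" unfolding v0_def using nb_Ev[OF zero_in_Ev _ Sg_one] d1 by simp
  have tT: "real (card T) * real d \<le> card Od * (real m * real k)"
  proof -
    have "card T * d \<le> card Od * (m * k)" using T(2) by (rule order_trans) simp
    then have "real (card T * d) \<le> real (card Od * (m * k))" by (simp only: of_nat_le_iff)
    then show ?thesis by simp
  qed
  have tS: "real (card S) * real d ^ 2 \<le> card Od * (9 * real m ^ 2)"
  proof -
    have "real (card S * d ^ 2) \<le> real (card Od * (9 * m ^ 2))" using S(2) by (simp only: of_nat_le_iff)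
    then show ?thesis by simp
  qed
  have \<theta>: "\<theta> \<ge> 0" "\<theta> * (card T + card S * (real m * real d)) \<le> \<kappa> / (4 * real k) * card Ev"
  proof -
    show "\<theta> \<ge> 0" using cpos by (simp add: \<theta>_def)
    have "\<theta> * (card T + card S * (real m * real d)) = c * (card T * real d + real m * (card S * real d ^ 2))"
      by (simp add: \<theta>_def algebra_simps power2_eq_square)
    also have "\<dots> \<le> c * (card Od * (real m * real k) + real m * (card Od * (9 * real m ^ 2)))"
      using cpos tT tS by (intro mult_left_mono add_mono) auto
    also have "\<dots> = c * (real m * real k + 9 * real m ^ 3) * card Od"
      by (simp add: algebra_simps power2_eq_square power3_eq_cube)
    also have "c * (real m * real k + 9 * real m ^ 3) = \<kappa> / (4 * real k)"
    proof -
      have "\<kappa> / (a * b) * b = \<kappa> / a" if "b > 0" for a b :: real using that by simp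
      from this[OF den] show ?thesis unfolding c .
    qed
    finally show "\<theta> * (card T + card S * (real m * real d)) \<le> \<kappa> / (4 * real k) * card Ev" by (simp add: cE)
  qed
  define nice where "nice f \<longleftrightarrow> Psi L \<kappa> ideal smp (cset f) + \<theta> * real (d * card Sg) * penalty s0 T S v0 (cset f)
      \<le> - R * real (d * card Sg)" for f
  have "{f \<in> Homs. q0 * card autos \<le> real (defect (cset f) ideal)} \<subseteq> (\<Union>g\<in>autos. {f \<in> Homs. nice (compose V f g)})"
  proof
    fix f assume "f \<in> {f \<in> Homs. q0 * card autos \<le> real (defect (cset f) ideal)}"
    then have f: "f \<in> Homs" "q0 * card autos \<le> real (defect (cset f) ideal)" by auto
    have fW: "cset f v \<subseteq> W" if "v \<in> Od" for v using cset_sub[of f v] f(1) that Od_V Hom_iff by blast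
    have "\<exists>g\<in>autos. Psi L \<kappa> ideal smp (cset f \<circ> g) + \<theta> * real (d * card Sg) * penalty s0 T S v0 (cset f \<circ> g)
       \<le> - (\<kappa> / (4 * real k)) * real (d * card Sg) * card Ev * (defect (cset f) ideal / card autos)"
      by (rule ex_good_auto[where W = W]) (fact smp1 k finite_W fW L dk T(1) s0T(2) S(1) v0 \<theta>)+
    then obtain g where g: "g \<in> autos" "Psi L \<kappa> ideal smp (cset f \<circ> g) + \<theta> * D * penalty s0 T S v0 (cset f \<circ> g)
       \<le> - (\<kappa> / (4 * real k)) * D * card Ev * (defect (cset f) ideal / card autos)"
      unfolding D_def by blast
    have eq: "cset (compose V f g) v = (cset f \<circ> g) v" if "v \<in> Od" for v
      using cset_compose[OF Od_V[OF that] autos_nbrs[OF g(1) Od_V[OF that]]] by simp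
    have "Psi L \<kappa> ideal smp (cset (compose V f g)) = Psi L \<kappa> ideal smp (cset f \<circ> g)"
      using eq smp1 by (intro Psi_cong) auto
    moreover have "penalty s0 T S v0 (cset (compose V f g)) = penalty s0 T S v0 (cset f \<circ> g)"
      using eq T(1) S(1) v0 s0T(1) by (intro penalty_cong) auto
    moreover have "- (\<kappa> / (4 * real k)) * D * card Ev * (defect (cset f) ideal / card autos) \<le> - R * D"
    proof -
      have "q0 \<le> defect (cset f) ideal / card autos" using f(2) card_autos_pos by (simp add: field_simps)
      then have "\<kappa> / (4 * real k) * D * card Ev * q0 \<le> \<kappa> / (4 * real k) * D * card Ev * (defect (cset f) ideal / card autos)"
        using L by (intro mult_left_mono) (auto simp: D_def)
      then show ?thesis by (simp add: R_def algebra_simps)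
    qed
    ultimately have "nice (compose V f g)" using g(2) unfolding nice_def D_def by (simp only:)
    then show "f \<in> (\<Union>g\<in>autos. {f \<in> Homs. nice (compose V f g)})" using f(1) g(1) by blast
  qed
  then have "set_weight G lam {f \<in> Homs. q0 * card autos \<le> real (defect (cset f) ideal)}
      \<le> set_weight G lam (\<Union>g\<in>autos. {f \<in> Homs. nice (compose V f g)})"
    by (rule set_weight_mono) auto
  also have "\<dots> \<le> (\<Sum>g\<in>autos. set_weight G lam {f \<in> Homs. nice (compose V f g)})"
    by (rule set_weight_UN_le[OF finite_autos]) auto
  also have "\<dots> = (\<Sum>g\<in>autos. set_weight G lam {f \<in> Homs. nice f})"
    using set_weight_compose[OF autos_bij autos_nbrs] by (intro sum.cong refl) blast
  also have "\<dots> = card autos * set_weight G lam {f \<in> Homs. nice f}" by simp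
  also have "\<dots> \<le> (2 * real m * real d) ^ d * (eta H lam ^ card Ev * exp (- R) * 2 ^ card W * (1 + 2 ^ card W * exp (- \<theta>)) ^ (card T + card S))"
  proof (rule mult_mono)
    have "real (card autos) \<le> real ((2 * m * d) ^ d)" using card_autos by (simp only: of_nat_le_iff)
    then show "real (card autos) \<le> (2 * real m * real d) ^ d" by simp
    show "set_weight G lam {f \<in> Homs. nice f} \<le> eta H lam ^ card Ev * exp (- R) * 2 ^ card W * (1 + 2 ^ card W * exp (- \<theta>)) ^ (card T + card S)"
      unfolding nice_def
      by (rule nice_weight_le[where smp = smp, OF d1 LK smp2 smp3 T(1) S(1) v0 s0T(1)])
  qed (auto intro: set_weight_nonneg)
  \<comment> \<open>Even the crude \<open>card T + card S \<le> 2 * card Ev\<close> suffices,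
    because \<open>exp (- \<theta>)\<close> is exponentially small in \<open>d\<close>.\<close>
  also have "(1 + 2 ^ card W * exp (- \<theta>)) ^ (card T + card S) \<le> exp (card Ev * (2 * 2 ^ card W * exp (- \<theta>)))"
  proof -
    define x where "x = 2 ^ card W * exp (- \<theta>)"
    have x: "x \<ge> 0" by (simp add: x_def)
    have "(1 + x) ^ (card T + card S) \<le> exp x ^ (card T + card S)"
      using x by (intro power_mono) auto
    also have "\<dots> = exp (real (card T + card S) * x)" by (simp only: exp_of_nat_mult)
    also have "\<dots> \<le> exp (real (2 * card Ev) * x)"
    proof -
      have "card T + card S \<le> 2 * card Ev"
        using card_mono[OF finite_Od T(1)] card_mono[OF finite_Od S(1)] cE by simp
      then show ?thesis using x by (intro exp_le_cancel_iff[THEN iffD2] mult_right_mono) (simp_all only: of_nat_le_iff)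
    qed
    finally show ?thesis by (simp add: x_def algebra_simps)
  qed
  also have "(2 * real m * real d) ^ d * (eta H lam ^ card Ev * exp (- R) * 2 ^ card W * exp (card Ev * (2 * 2 ^ card W * exp (- \<theta>))))
      = (2 * real m * real d) ^ d * 2 ^ card W * exp (card Ev * (2 * 2 ^ card W * exp (- c * real d) - \<kappa> / (4 * real k) * q0)) * eta H lam ^ card Ev"
    unfolding R_def \<theta>_def by (simp add: algebra_simps flip: exp_add)
  also have "\<dots> \<le> (2 * real m * real d) ^ d * 2 ^ card W * exp (card Ev * (2 * 2 ^ card W * exp (- c * real d) - \<kappa> / (4 * real k) * q0)) * partition_fun G H lam"
    using partition_fun_ge[OF d1] by (intro mult_left_mono) auto
  finally show ?thesis using eta_pos by (simp add: mult_left_mono)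
qed

end

subsection \<open>Colour frequencies\<close>

definition cls_prop :: "'a set \<Rightarrow> ('a \<Rightarrow> 'b) \<Rightarrow> 'b \<Rightarrow> real" where
  "cls_prop S f k = real (card {v \<in> S. f v = k}) / real (card S)"

context weighted_target
begin

text \<open>The product weight makes the coordinates independent: a mixed term contains the
  vanishing factor of a centred variable, and a diagonal term is at most the total weight. Weights
  stay unnormalised, so factors of total weight zero cause no trouble.\<close>

lemma second_moment_le:
  fixes \<phi> :: "'a \<Rightarrow> 'b \<Rightarrow> real"
  assumes S: "finite S" and B: "\<And>v. v \<in> S \<Longrightarrow> B v \<subseteq> W"
    and cent: "\<And>v. v \<in> S \<Longrightarrow> (\<Sum>b\<in>B v. lam b * \<phi> v b) = 0"
    and bd: "\<And>v b. v \<in> S \<Longrightarrow> b \<in> B v \<Longrightarrow> \<bar>\<phi> v b\<bar> \<le> 1"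
  shows "(\<Sum>b\<in>PiE S B. (\<Prod>v\<in>S. lam (b v)) * (\<Sum>v\<in>S. \<phi> v (b v))\<^sup>2) \<le> card S * (\<Prod>v\<in>S. sum lam (B v))"
proof -
  have finB: "finite (B v)" if "v \<in> S" for v using B[OF that] fin_sub by blast
  \<comment> \<open>\<open>F v w\<close> places one deviation at \<open>v\<close> and one at
    \<open>w\<close>; for \<open>v = w\<close> both land on the same coordinate and form the
    square.\<close>
  define F where "F v w x y = lam y * ((if x = v then \<phi> v y else 1) * (if x = w then \<phi> w y else 1))" for v w x y
  have pair: "(\<Sum>b\<in>PiE S B. (\<Prod>v\<in>S. lam (b v)) * (\<phi> v (b v) * \<phi> w (b w))) = (\<Prod>x\<in>S. \<Sum>y\<in>B x. F v w x y)"
    if "v \<in> S" "w \<in> S" for v w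
  proof -
    have "(\<Prod>x\<in>S. F v w x (b x)) = (\<Prod>v\<in>S. lam (b v)) * (\<phi> v (b v) * \<phi> w (b w))" for b
    proof -
      have "(\<Prod>x\<in>S. if x = v then \<phi> v (b x) else 1) = \<phi> v (b v)" using S that by (simp add: prod.delta)
      moreover have "(\<Prod>x\<in>S. if x = w then \<phi> w (b x) else 1) = \<phi> w (b w)" using S that by (simp add: prod.delta)
      ultimately show ?thesis unfolding F_def prod.distrib by simp
    qed
    then show ?thesis using sum_prod_PiE[where B = B and F = "F v w", OF S finB] by simp
  qed
  have off: "(\<Prod>x\<in>S. \<Sum>y\<in>B x. F v w x y) = 0" if "v \<in> S" "w \<in> S" "v \<noteq> w" for v w
  proof -
    have "(\<Sum>y\<in>B v. F v w v y) = 0" using cent[OF that(1)] that(3) by (simp add: F_def)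
    then show ?thesis using S that(1) by (intro prod_zero) auto
  qed
  have diag: "(\<Prod>x\<in>S. \<Sum>y\<in>B x. F v v x y) \<le> (\<Prod>v\<in>S. sum lam (B v))" if v: "v \<in> S" for v
  proof (rule prod_mono, intro conjI)
    fix x assume x: "x \<in> S"
    have pos: "lam y \<ge> 0" if "y \<in> B x" for y using B[OF x] lam_pos that by (auto intro: less_imp_le)
    have sq: "\<phi> v y * \<phi> v y \<ge> 0" for y by simp
    have "F v v x y \<ge> 0" if "y \<in> B x" for y
      unfolding F_def using pos[OF that] sq by (cases "x = v") auto
    then show "0 \<le> (\<Sum>y\<in>B x. F v v x y)" by (rule sum_nonneg)
    show "(\<Sum>y\<in>B x. F v v x y) \<le> sum lam (B x)"
    proof (rule sum_mono)
      fix y assume y: "y \<in> B x"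
      have "(if x = v then \<phi> v y else 1) * (if x = v then \<phi> v y else 1) \<le> 1"
        using bd[OF v, of y] y abs_square_le_1[of "\<phi> v y"] by (auto simp: power2_eq_square)
      from mult_left_mono[OF this pos[OF y]] show "F v v x y \<le> lam y" by (simp add: F_def)
    qed
  qed
  have "(\<Sum>b\<in>PiE S B. (\<Prod>v\<in>S. lam (b v)) * (\<Sum>v\<in>S. \<phi> v (b v))\<^sup>2)
      = (\<Sum>b\<in>PiE S B. \<Sum>v\<in>S. \<Sum>w\<in>S. (\<Prod>v\<in>S. lam (b v)) * (\<phi> v (b v) * \<phi> w (b w)))"
    by (simp only: power2_eq_square sum_product) (simp only: sum_distrib_left)
  also have "\<dots> = (\<Sum>v\<in>S. \<Sum>b\<in>PiE S B. \<Sum>w\<in>S. (\<Prod>v\<in>S. lam (b v)) * (\<phi> v (b v) * \<phi> w (b w)))"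
    by (rule sum.swap)
  also have "\<dots> = (\<Sum>v\<in>S. \<Sum>w\<in>S. \<Sum>b\<in>PiE S B. (\<Prod>v\<in>S. lam (b v)) * (\<phi> v (b v) * \<phi> w (b w)))"
    by (intro sum.cong refl sum.swap)
  also have "\<dots> = (\<Sum>v\<in>S. \<Sum>w\<in>S. \<Prod>x\<in>S. \<Sum>y\<in>B x. F v w x y)"
    using pair by (intro sum.cong refl) auto
  also have "\<dots> = (\<Sum>v\<in>S. \<Prod>x\<in>S. \<Sum>y\<in>B x. F v v x y)"
  proof (rule sum.cong[OF refl])
    fix v assume v: "v \<in> S"
    have "(\<Sum>w\<in>S. \<Prod>x\<in>S. \<Sum>y\<in>B x. F v w x y) = (\<Prod>x\<in>S. \<Sum>y\<in>B x. F v v x y) + (\<Sum>w\<in>S - {v}. \<Prod>x\<in>S. \<Sum>y\<in>B x. F v w x y)"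
      using S v by (rule sum.remove)
    also have "(\<Sum>w\<in>S - {v}. \<Prod>x\<in>S. \<Sum>y\<in>B x. F v w x y) = 0"
      using off[OF v] by (intro sum.neutral) auto
    finally show "(\<Sum>w\<in>S. \<Prod>x\<in>S. \<Sum>y\<in>B x. F v w x y) = (\<Prod>x\<in>S. \<Sum>y\<in>B x. F v v x y)" by simp
  qed
  also have "\<dots> \<le> (\<Sum>v\<in>S. \<Prod>v\<in>S. sum lam (B v))" using diag by (rule sum_mono)
  finally show ?thesis by simp
qed

lemma chebyshev_PiE:
  assumes S: "finite S" and B: "\<And>v. v \<in> S \<Longrightarrow> B v \<subseteq> W" and s: "s > 0"
  shows "(\<Sum>b\<in>PiE S B. of_bool (s \<le> \<bar>real (card {v \<in> S. b v = l})
        - (\<Sum>v\<in>S. if l \<in> B v then lam l / sum lam (B v) else 0)\<bar>) * (\<Prod>v\<in>S. lam (b v)))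
    \<le> card S / s\<^sup>2 * (\<Prod>v\<in>S. sum lam (B v))"
proof (cases "\<exists>v\<in>S. B v = {}")
  case True
  then have "PiE S B = {}" by (simp add: PiE_eq_empty_iff)
  moreover have "(\<Prod>v\<in>S. sum lam (B v)) \<ge> 0" using B by (intro prod_nonneg lam_sum_nonneg)
  ultimately show ?thesis by simp
next
  case False
  then have Bpos: "sum lam (B v) > 0" if "v \<in> S" for v using B[OF that] that by (intro lam_sum_pos) auto
  define p where "p v = (if l \<in> B v then lam l / sum lam (B v) else 0)" for v
  define \<phi> where "\<phi> v b = of_bool (b = l) - p v" for v b
  have p01: "0 \<le> p v" "p v \<le> 1" if "v \<in> S" for v
  proof -
    have "lam l \<le> sum lam (B v)" if "l \<in> B v"
      using lam_sum_mono[of "{l}" "B v"] B[OF \<open>v \<in> S\<close>] that by simp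
    moreover have "lam l \<ge> 0" if "l \<in> B v" using B[OF \<open>v \<in> S\<close>] lam_pos that by (auto intro: less_imp_le)
    ultimately show "0 \<le> p v" "p v \<le> 1" using Bpos[OF that] by (auto simp: p_def)
  qed
  have cent: "(\<Sum>b\<in>B v. lam b * \<phi> v b) = 0" if v: "v \<in> S" for v
  proof -
    have "(\<Sum>b\<in>B v. lam b * \<phi> v b) = (\<Sum>b\<in>B v. lam b * of_bool (b = l)) - p v * sum lam (B v)"
      by (simp add: \<phi>_def algebra_simps sum_subtractf sum_distrib_left)
    also have "(\<Sum>b\<in>B v. lam b * of_bool (b = l)) = (if l \<in> B v then lam l else 0)"
    proof -
      have "(\<Sum>b\<in>B v. lam b * of_bool (b = l)) = (\<Sum>b\<in>B v. if b = l then lam b else 0)"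
        by (intro sum.cong) auto
      then show ?thesis using fin_sub[OF B[OF v]] by simp
    qed
    also have "\<dots> = p v * sum lam (B v)" using Bpos[OF v] by (simp add: p_def)
    finally show ?thesis by simp
  qed
  have bd: "\<bar>\<phi> v b\<bar> \<le> 1" if "v \<in> S" for v b
    using p01[OF that] by (simp add: \<phi>_def abs_le_iff)
  have dev: "real (card {v \<in> S. b v = l}) - (\<Sum>v\<in>S. p v) = (\<Sum>v\<in>S. \<phi> v (b v))" for b
    unfolding card_filter_eq_sum[OF S] \<phi>_def by (simp add: sum_subtractf)
  have wtnn: "(\<Prod>v\<in>S. lam (b v)) \<ge> 0" if "b \<in> PiE S B" for b
    using that B lam_pos by (intro prod_nonneg) (auto simp: PiE_iff intro!: less_imp_le)
  have "(\<Sum>b\<in>PiE S B. of_bool (s \<le> \<bar>\<Sum>v\<in>S. \<phi> v (b v)\<bar>) * (\<Prod>v\<in>S. lam (b v)))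
      \<le> (\<Sum>b\<in>PiE S B. (\<Prod>v\<in>S. lam (b v)) * (\<Sum>v\<in>S. \<phi> v (b v))\<^sup>2 / s\<^sup>2)"
  proof (rule sum_mono)
    fix b assume b: "b \<in> PiE S B"
    let ?x = "\<Sum>v\<in>S. \<phi> v (b v)"
    have "of_bool (s \<le> \<bar>?x\<bar>) \<le> ?x\<^sup>2 / s\<^sup>2"
    proof (cases "s \<le> \<bar>?x\<bar>")
      case True
      then have "s\<^sup>2 \<le> \<bar>?x\<bar>\<^sup>2" using s by (intro power_mono) auto
      then show ?thesis using True s by (simp add: le_divide_eq)
    qed simp
    from mult_right_mono[OF this wtnn[OF b]]
    show "of_bool (s \<le> \<bar>?x\<bar>) * (\<Prod>v\<in>S. lam (b v)) \<le> (\<Prod>v\<in>S. lam (b v)) * ?x\<^sup>2 / s\<^sup>2"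
      by (simp add: algebra_simps)
  qed
  also have "\<dots> = (\<Sum>b\<in>PiE S B. (\<Prod>v\<in>S. lam (b v)) * (\<Sum>v\<in>S. \<phi> v (b v))\<^sup>2) / s\<^sup>2"
    by (rule sum_divide_distrib[symmetric])
  also have "\<dots> \<le> card S * (\<Prod>v\<in>S. sum lam (B v)) / s\<^sup>2"
    using bd by (intro divide_right_mono second_moment_le S B cent) auto
  finally show ?thesis by (simp add: dev[symmetric] p_def)
qed

text \<open>Probabilistic method: by Chebyshev a given colour is off by \<open>\<epsilon>\<close>
  with probability at most \<open>1 / (\<epsilon>^2 * card S)\<close>, and there are at most
  \<open>card W\<close> colours. It serves to show that the classes are nonempty, so that
  conditioning on them makes sense.\<close>

lemma ex_balanced:
  fixes \<epsilon> :: real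
  assumes S: "finite S" and A: "A \<subseteq> W" "A \<noteq> {}" and e: "\<epsilon> > 0" "real (card W) < \<epsilon>\<^sup>2 * card S"
  shows "\<exists>b\<in>S \<rightarrow>\<^sub>E A. \<forall>k\<in>A. \<bar>cls_prop S b k - lam k / sum lam A\<bar> \<le> \<epsilon>"
proof (rule ccontr)
  assume neg: "\<not> ?thesis"
  have cS: "real (card S) > 0" using e by (cases "card S = 0") auto
  define tot where "tot = sum lam A ^ card S"
  have tot: "tot > 0" using lam_sum_pos[OF A] by (simp add: tot_def)
  define bad where "bad k b \<longleftrightarrow> \<epsilon> * card S \<le> \<bar>real (card {v \<in> S. b v = k}) - card S * (lam k / sum lam A)\<bar>" for k b
  have finA: "finite A" using fin_sub A by blast
  have each: "(\<Sum>b\<in>S \<rightarrow>\<^sub>E A. of_bool (bad k b) * (\<Prod>v\<in>S. lam (b v))) \<le> 1 / (\<epsilon>\<^sup>2 * card S) * tot" if "k \<in> A" for k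
  proof -
    have "(\<Sum>b\<in>S \<rightarrow>\<^sub>E A. of_bool (bad k b) * (\<Prod>v\<in>S. lam (b v))) \<le> card S / (\<epsilon> * card S)\<^sup>2 * tot"
      using chebyshev_PiE[OF S, of "\<lambda>_. A" "\<epsilon> * card S" k] A that e cS by (simp add: bad_def tot_def)
    also have "card S / (\<epsilon> * card S)\<^sup>2 = 1 / (\<epsilon>\<^sup>2 * card S)" using cS by (simp add: power2_eq_square)
    finally show ?thesis .
  qed
  have wtnn: "(\<Prod>v\<in>S. lam (b v)) \<ge> 0" if "b \<in> S \<rightarrow>\<^sub>E A" for b
    using PiE_mem[OF that] A(1) lam_pos by (intro prod_nonneg) (meson less_imp_le subsetD)
  have "tot = (\<Sum>b\<in>S \<rightarrow>\<^sub>E A. (\<Prod>v\<in>S. lam (b v)))"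
    using sum_prod_PiE[OF S, of "\<lambda>_. A" "\<lambda>_. lam"] finA by (simp add: tot_def)
  also have "\<dots> \<le> (\<Sum>b\<in>S \<rightarrow>\<^sub>E A. \<Sum>k\<in>A. of_bool (bad k b) * (\<Prod>v\<in>S. lam (b v)))"
  proof (rule sum_mono)
    fix b assume b: "b \<in> S \<rightarrow>\<^sub>E A"
    then obtain k where k: "k \<in> A" "\<epsilon> < \<bar>cls_prop S b k - lam k / sum lam A\<bar>" using neg by force
    have "bad k b"
    proof -
      have "real (card {v \<in> S. b v = k}) - card S * (lam k / sum lam A) = card S * (cls_prop S b k - lam k / sum lam A)"
        using cS by (simp add: cls_prop_def algebra_simps)
      then have "\<bar>real (card {v \<in> S. b v = k}) - card S * (lam k / sum lam A)\<bar> = card S * \<bar>cls_prop S b k - lam k / sum lam A\<bar>"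
        by (simp add: abs_mult)
      then show ?thesis using k(2) cS by (simp add: bad_def mult.commute)
    qed
    then have "(\<Prod>v\<in>S. lam (b v)) = of_bool (bad k b) * (\<Prod>v\<in>S. lam (b v))" by simp
    also have "\<dots> \<le> (\<Sum>k\<in>A. of_bool (bad k b) * (\<Prod>v\<in>S. lam (b v)))"
      using k(1) finA wtnn[OF b] by (intro member_le_sum) auto
    finally show "(\<Prod>v\<in>S. lam (b v)) \<le> (\<Sum>k\<in>A. of_bool (bad k b) * (\<Prod>v\<in>S. lam (b v)))" .
  qed
  also have "\<dots> = (\<Sum>k\<in>A. \<Sum>b\<in>S \<rightarrow>\<^sub>E A. of_bool (bad k b) * (\<Prod>v\<in>S. lam (b v)))" by (rule sum.swap)
  also have "\<dots> \<le> (\<Sum>k\<in>A. 1 / (\<epsilon>\<^sup>2 * card S) * tot)" using each by (rule sum_mono)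
  also have "\<dots> = card A / (\<epsilon>\<^sup>2 * card S) * tot" by simp
  also have "\<dots> \<le> card W / (\<epsilon>\<^sup>2 * card S) * tot"
    using card_mono[OF finite_W A(1)] tot by (intro mult_right_mono divide_right_mono) auto
  also have "\<dots> < 1 * tot" using e cS tot by (intro mult_strict_right_mono) (auto simp: divide_less_eq)
  finally show False by simp
qed

end

context torus_colouring
begin

text \<open>Given the even colours, the mean frequency of \<open>l\<close> differs from the target
  by at most the fraction of vertices with \<open>cset f v \<noteq> A\<close>, that is by
  \<open>\<epsilon>\<close>. A further \<open>\<epsilon>\<close> is left to Chebyshev, whence the
  factor \<open>2\<close>.\<close>

lemma odd_deviation_weight_le:
  fixes \<epsilon> :: real
  assumes d: "d \<ge> 1" and A: "ideal A" "l \<in> cn A" and e: "\<epsilon> > 0"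
  shows "set_weight G lam {f \<in> Homs. real (card {v \<in> Od. cset f v \<noteq> A}) \<le> \<epsilon> * card Od
        \<and> 2 * \<epsilon> < \<bar>cls_prop Od f l - lam l / sum lam (cn A)\<bar>}
    \<le> 1 / (\<epsilon>\<^sup>2 * card Od) * partition_fun G H lam"
proof -
  have cO: "real (card Od) > 0"
    using nb_Ev[OF zero_in_Ev, of 0 1] Sg_one d finite_Od by (auto simp: card_gt_0_iff simp del: One_nat_def)
  define P where "P a \<longleftrightarrow> real (card {v \<in> Od. cset a v \<noteq> A}) \<le> \<epsilon> * card Od" for a
  define Q where "Q b \<longleftrightarrow> 2 * \<epsilon> < \<bar>cls_prop Od b l - lam l / sum lam (cn A)\<bar>" for b :: "nat list \<Rightarrow> 'b"
  define p where "p a v = (if l \<in> cn (cset a v) then lam l / sum lam (cn (cset a v)) else 0)" for a v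
  have p01: "0 \<le> p a v" "p a v \<le> 1" for a v
  proof -
    have "lam l \<le> sum lam (cn (cset a v))" if "l \<in> cn (cset a v)"
      using lam_sum_mono[of "{l}" "cn (cset a v)"] cn_sub that by simp
    moreover have "lam l > 0" using A(2) cn_sub lam_pos by blast
    ultimately show "0 \<le> p a v" "p a v \<le> 1" by (auto simp: p_def)
  qed
  have inner: "(\<Sum>b\<in>PiE Od (\<lambda>v. cn (cset a v)). of_bool (P a \<and> Q b) * (wt Ev a * wt Od b))
      \<le> 1 / (\<epsilon>\<^sup>2 * card Od) * (wt Ev a * (\<Prod>v\<in>Od. sum lam (cn (cset a v))))" if a: "a \<in> Ev \<rightarrow>\<^sub>E W" for a
  proof -
    have wa: "wt Ev a \<ge> 0" using a lam_pos by (intro prod_nonneg) (auto simp: PiE_iff intro!: less_imp_le)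
    have dev: "\<epsilon> * card Od \<le> \<bar>real (card {v \<in> Od. b v = l}) - (\<Sum>v\<in>Od. p a v)\<bar>" if PQ: "P a" "Q b" for b
    proof -
      let ?r = "lam l / sum lam (cn A)"
      have r01: "0 \<le> ?r" "?r \<le> 1"
      proof -
        have "lam l \<le> sum lam (cn A)" using lam_sum_mono[of "{l}" "cn A"] cn_sub A(2) by simp
        moreover have "lam l > 0" using A(2) cn_sub lam_pos by blast
        ultimately show "0 \<le> ?r" "?r \<le> 1" by auto
      qed
      have "\<bar>(\<Sum>v\<in>Od. p a v) - card Od * ?r\<bar> = \<bar>\<Sum>v\<in>Od. p a v - ?r\<bar>" by (simp add: sum_subtractf)
      also have "\<dots> \<le> (\<Sum>v\<in>Od. \<bar>p a v - ?r\<bar>)" by (rule sum_abs)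
      also have "\<dots> \<le> (\<Sum>v\<in>Od. of_bool (cset a v \<noteq> A))"
      proof (rule sum_mono)
        fix v
        show "\<bar>p a v - ?r\<bar> \<le> of_bool (cset a v \<noteq> A)"
        proof (cases "cset a v = A")
          case True
          then show ?thesis using A(2) by (simp add: p_def)
        next
          case False
          then show ?thesis using p01[of a v] r01 by (simp add: abs_le_iff)
        qed
      qed
      also have "\<dots> = real (card {v \<in> Od. cset a v \<noteq> A})" by (simp only: card_filter_eq_sum[OF finite_Od])
      also have "\<dots> \<le> \<epsilon> * card Od" using PQ(1) by (simp add: P_def)
      finally have 1: "\<bar>(\<Sum>v\<in>Od. p a v) - card Od * ?r\<bar> \<le> \<epsilon> * card Od" .
      have "real (card {v \<in> Od. b v = l}) - card Od * ?r = card Od * (cls_prop Od b l - ?r)"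
        using cO by (simp add: cls_prop_def algebra_simps)
      then have "\<bar>real (card {v \<in> Od. b v = l}) - card Od * ?r\<bar> = card Od * \<bar>cls_prop Od b l - ?r\<bar>"
        by (simp add: abs_mult)
      also have "\<dots> \<ge> card Od * (2 * \<epsilon>)" using PQ(2) by (intro mult_left_mono) (auto simp: Q_def)
      finally have "card Od * (2 * \<epsilon>) \<le> \<bar>real (card {v \<in> Od. b v = l}) - card Od * ?r\<bar>" .
      moreover have "card Od * (2 * \<epsilon>) = 2 * (\<epsilon> * card Od)" by simp
      moreover have "e \<le> \<bar>x - y\<bar>" if "2 * e \<le> \<bar>x - z\<bar>" "\<bar>y - z\<bar> \<le> e" for e x y z :: real
        using that by linarith
      ultimately show ?thesis using 1 by metis
    qed
    have wb: "wt Od b \<ge> 0" if "b \<in> PiE Od (\<lambda>v. cn (cset a v))" for b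
      using that cn_sub lam_pos by (intro prod_nonneg) (auto simp: PiE_iff intro!: less_imp_le)
    have "(\<Sum>b\<in>PiE Od (\<lambda>v. cn (cset a v)). of_bool (P a \<and> Q b) * (wt Ev a * wt Od b))
        \<le> (\<Sum>b\<in>PiE Od (\<lambda>v. cn (cset a v)). wt Ev a * (of_bool (\<epsilon> * card Od \<le> \<bar>real (card {v \<in> Od. b v = l}) - (\<Sum>v\<in>Od. p a v)\<bar>) * wt Od b))"
      using dev wa wb by (intro sum_mono) auto
    also have "\<dots> = wt Ev a * (\<Sum>b\<in>PiE Od (\<lambda>v. cn (cset a v)). of_bool (\<epsilon> * card Od \<le> \<bar>real (card {v \<in> Od. b v = l}) - (\<Sum>v\<in>Od. p a v)\<bar>) * wt Od b)"
      by (rule sum_distrib_left[symmetric])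
    also have "\<dots> \<le> wt Ev a * (card Od / (\<epsilon> * card Od)\<^sup>2 * (\<Prod>v\<in>Od. sum lam (cn (cset a v))))"
      unfolding p_def using wa e cO cn_sub by (intro mult_left_mono chebyshev_PiE finite_Od) auto
    also have "card Od / (\<epsilon> * card Od)\<^sup>2 = 1 / (\<epsilon>\<^sup>2 * card Od)" using cO by (simp add: power2_eq_square)
    finally show ?thesis by (simp add: algebra_simps)
  qed
  have "{f \<in> Homs. real (card {v \<in> Od. cset f v \<noteq> A}) \<le> \<epsilon> * card Od
        \<and> 2 * \<epsilon> < \<bar>cls_prop Od f l - lam l / sum lam (cn A)\<bar>} = {f \<in> Homs. P (restrict f Ev) \<and> Q (restrict f Od)}"
  proof -
    have "{v \<in> Od. cset (restrict f Ev) v \<noteq> A} = {v \<in> Od. cset f v \<noteq> A}" for f using cset_restrict by auto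
    moreover have "cls_prop Od (restrict f Od) l = cls_prop Od f l" for f :: "nat list \<Rightarrow> 'b"
    proof -
      have "{v \<in> Od. restrict f Od v = l} = {v \<in> Od. f v = l}" by auto
      then show ?thesis by (simp add: cls_prop_def)
    qed
    ultimately show ?thesis by (simp add: P_def Q_def)
  qed
  then have "set_weight G lam {f \<in> Homs. real (card {v \<in> Od. cset f v \<noteq> A}) \<le> \<epsilon> * card Od
        \<and> 2 * \<epsilon> < \<bar>cls_prop Od f l - lam l / sum lam (cn A)\<bar>}
      = (\<Sum>a\<in>Ev \<rightarrow>\<^sub>E W. \<Sum>b\<in>PiE Od (\<lambda>v. cn (cset a v)). of_bool (P a \<and> Q b) * (wt Ev a * wt Od b))"
    using set_weight_factor[of "\<lambda>a b. P a \<and> Q b"] by simp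
  also have "\<dots> \<le> (\<Sum>a\<in>Ev \<rightarrow>\<^sub>E W. 1 / (\<epsilon>\<^sup>2 * card Od) * (wt Ev a * (\<Prod>v\<in>Od. sum lam (cn (cset a v)))))"
    using inner by (rule sum_mono)
  also have "\<dots> = 1 / (\<epsilon>\<^sup>2 * card Od) * partition_fun G H lam"
    using set_weight_factor_Ev[of "\<lambda>_. True"] by (simp add: partition_fun_def sum_distrib_left)
  finally show ?thesis .
qed

end

subsection \<open>The classes\<close>

text \<open>The frequencies add up to at most one, and those in \<open>A\<close> already account for
  all but \<open>card A * tol\<close>.\<close>

lemma cls_prop_outside_le:
  fixes lam :: "'b \<Rightarrow> real" and tol :: real
  assumes S: "finite S" "S \<noteq> {}" and A: "finite A" "sum lam A > 0" "a \<notin> A"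
    and close: "\<And>k. k \<in> A \<Longrightarrow> \<bar>cls_prop S f k - lam k / sum lam A\<bar> \<le> tol"
  shows "cls_prop S f a \<le> card A * tol"
proof -
  have cS: "real (card S) > 0" using S by (simp add: card_gt_0_iff)
  have "card (\<Union>k\<in>insert a A. {v \<in> S. f v = k}) = (\<Sum>k\<in>insert a A. card {v \<in> S. f v = k})"
    using S A by (intro card_UN_disjoint) auto
  moreover have "card (\<Union>k\<in>insert a A. {v \<in> S. f v = k}) \<le> card S" using S by (intro card_mono) auto
  ultimately have "(\<Sum>k\<in>insert a A. card {v \<in> S. f v = k}) \<le> card S" by simp
  then have "real (\<Sum>k\<in>insert a A. card {v \<in> S. f v = k}) \<le> real (card S)" by (simp only: of_nat_le_iff)
  then have "(\<Sum>k\<in>insert a A. real (card {v \<in> S. f v = k})) / card S \<le> 1" using cS by simp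
  then have "(\<Sum>k\<in>insert a A. cls_prop S f k) \<le> 1" unfolding cls_prop_def by (simp only: sum_divide_distrib)
  then have 1: "cls_prop S f a + (\<Sum>k\<in>A. cls_prop S f k) \<le> 1" using A by simp
  have "(\<Sum>k\<in>A. lam k / sum lam A - tol) \<le> (\<Sum>k\<in>A. cls_prop S f k)"
    using close by (intro sum_mono) (force simp: abs_le_iff)
  moreover have "(\<Sum>k\<in>A. lam k / sum lam A - tol) = 1 - card A * tol"
    using A by (simp add: sum_subtractf flip: sum_divide_distrib)
  ultimately show ?thesis using 1 by linarith
qed

context weighted_target
begin

text \<open>A lower bound for all target frequencies at once (\<open>pmin_le\<close>): the scale on
  which classes are told apart and additive errors become relative ones.\<close>

definition pmin :: real where "pmin = Min (lam ` W) / sum lam W"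

lemma W_ne: "W \<noteq> {}"
  using has_edge fin_graph by (auto simp: finite_loop_graph_def)

lemma pmin_pos: "pmin > 0"
  unfolding pmin_def using finite_W W_ne lam_pos lam_sum_pos[of W]
  by (intro divide_pos_pos) (auto simp: Min_gr_iff)

lemma pmin_le:
  assumes "A \<subseteq> W" "k \<in> A"
  shows "pmin \<le> lam k / sum lam A"
  unfolding pmin_def
proof (rule frac_le)
  show "0 \<le> lam k" using assms lam_pos less_imp_le by blast
  show "Min (lam ` W) \<le> lam k" using assms finite_W by (intro Min_le) auto
  show "0 < sum lam A" using assms by (intro lam_sum_pos) auto
  show "sum lam A \<le> sum lam W" using assms by (intro lam_sum_mono) auto
qed

end

context torus_colouring
begin

definition near :: "real \<Rightarrow> 'b set \<times> 'b set \<Rightarrow> (nat list \<Rightarrow> 'b) \<Rightarrow> bool" where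
  "near tol P f \<longleftrightarrow> (\<forall>k\<in>fst P. \<bar>cls_prop Ev f k - lam k / sum lam (fst P)\<bar> \<le> tol) \<and>
     (\<forall>l\<in>snd P. \<bar>cls_prop Od f l - lam l / sum lam (snd P)\<bar> \<le> tol)"

definition cls :: "real \<Rightarrow> 'b set \<times> 'b set \<Rightarrow> (nat list \<Rightarrow> 'b) set" where
  "cls tol P = {f \<in> Homs. near tol P f}"

text \<open>What the analysis yields from the odd side alone; the frequencies on \<open>Ev\<close>
  are still open at this stage.\<close>

definition good :: "real \<Rightarrow> (nat list \<Rightarrow> 'b) \<Rightarrow> 'b set \<Rightarrow> bool" where
  "good \<epsilon> f A \<longleftrightarrow> ideal A \<and> real (card {v \<in> Od. cset f v \<noteq> A}) \<le> \<epsilon> * card Od \<and>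
     (\<forall>l\<in>cn A. \<bar>cls_prop Od f l - lam l / sum lam (cn A)\<bar> \<le> 2 * \<epsilon>)"

lemma Z_nonneg: "partition_fun G H lam \<ge> 0"
  unfolding partition_fun_def by (intro set_weight_nonneg) simp

text \<open>Either the defect is large, or a dominant ideal set exists and some colour of its common
  neighbourhood has a wrong frequency. The latter events are indexed by at most
  \<open>2 ^ card W * card W\<close> pairs of a set and a colour.\<close>

lemma not_good_weight_le:
  fixes q0 \<epsilon> t :: real
  assumes tail: "set_weight G lam {f \<in> Homs. q0 * card autos \<le> real (defect (cset f) ideal)} \<le> t * partition_fun G H lam"
    and d: "d \<ge> 2" and e: "real m * real d * q0 \<le> \<epsilon>" "\<epsilon> > 0" "\<epsilon> < 1 / 2"
  shows "set_weight G lam {f \<in> Homs. \<not> (\<exists>A. good \<epsilon> f A)}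
     \<le> (t + 2 ^ card W * card W / (\<epsilon>\<^sup>2 * card Od)) * partition_fun G H lam"
proof -
  define J where "J = {(A, l). ideal A \<and> l \<in> cn A}"
  define Dv where "Dv p = {f \<in> Homs. real (card {v \<in> Od. cset f v \<noteq> fst p}) \<le> \<epsilon> * card Od
        \<and> 2 * \<epsilon> < \<bar>cls_prop Od f (snd p) - lam (snd p) / sum lam (cn (fst p))\<bar>}" for p
  have JP: "J \<subseteq> Pow W \<times> W" using cn_sub by (auto simp: J_def ideal_def)
  have finP: "finite (Pow W \<times> W)" using finite_W by simp
  have finJ: "finite J" using JP finP finite_subset by blast
  have "card J \<le> card (Pow W \<times> W)" using JP finP by (intro card_mono)
  then have "card J \<le> 2 ^ card W * card W" using finite_W by (simp add: card_cartesian_product card_Pow)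
  then have "real (card J) \<le> real (2 ^ card W * card W)" by (simp only: of_nat_le_iff)
  then have cJ: "real (card J) \<le> 2 ^ card W * card W" by simp
  have sub: "{f \<in> Homs. \<not> (\<exists>A. good \<epsilon> f A)}
      \<subseteq> {f \<in> Homs. q0 * card autos \<le> real (defect (cset f) ideal)} \<union> (\<Union>p\<in>J. Dv p)"
  proof
    fix f assume "f \<in> {f \<in> Homs. \<not> (\<exists>A. good \<epsilon> f A)}"
    then have f: "f \<in> Homs" "\<And>A. \<not> good \<epsilon> f A" by auto
    show "f \<in> {f \<in> Homs. q0 * card autos \<le> real (defect (cset f) ideal)} \<union> (\<Union>p\<in>J. Dv p)"
    proof (cases "q0 * card autos \<le> real (defect (cset f) ideal)")
      case False
      then have "real (defect (cset f) ideal) < q0 * card autos" by simp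
      from ex_dominant[OF d this e(1) e(3)]
      obtain A where A: "ideal A" "real (card {v \<in> Od. cset f v \<noteq> A}) \<le> \<epsilon> * card Od" by blast
      then obtain l where l: "l \<in> cn A" "2 * \<epsilon> < \<bar>cls_prop Od f l - lam l / sum lam (cn A)\<bar>"
        using f(2)[of A] by (auto simp: good_def not_le)
      then have "f \<in> Dv (A, l)" "(A, l) \<in> J" using f(1) A by (auto simp: Dv_def J_def)
      then show ?thesis by blast
    qed (use f(1) in simp)
  qed
  have "set_weight G lam {f \<in> Homs. \<not> (\<exists>A. good \<epsilon> f A)}
      \<le> set_weight G lam ({f \<in> Homs. q0 * card autos \<le> real (defect (cset f) ideal)} \<union> (\<Union>p\<in>J. Dv p))"
    using sub by (rule set_weight_mono) (auto simp: Dv_def)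
  also have "\<dots> \<le> set_weight G lam {f \<in> Homs. q0 * card autos \<le> real (defect (cset f) ideal)} + set_weight G lam (\<Union>p\<in>J. Dv p)"
    by (rule set_weight_Un_le) (auto simp: Dv_def)
  also have "\<dots> \<le> t * partition_fun G H lam + (\<Sum>p\<in>J. set_weight G lam (Dv p))"
    using tail by (intro add_mono set_weight_UN_le finJ) (auto simp: Dv_def)
  also have "\<dots> \<le> t * partition_fun G H lam + (\<Sum>p\<in>J. 1 / (\<epsilon>\<^sup>2 * card Od) * partition_fun G H lam)"
  proof (intro add_left_mono sum_mono)
    fix p assume "p \<in> J"
    then show "set_weight G lam (Dv p) \<le> 1 / (\<epsilon>\<^sup>2 * card Od) * partition_fun G H lam"
      unfolding Dv_def using d e by (intro odd_deviation_weight_le) (auto simp: J_def)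
  qed
  also have "\<dots> = (t + card J / (\<epsilon>\<^sup>2 * card Od)) * partition_fun G H lam" by (simp add: algebra_simps)
  also have "\<dots> \<le> (t + 2 ^ card W * card W / (\<epsilon>\<^sup>2 * card Od)) * partition_fun G H lam"
    using cJ Z_nonneg by (intro mult_right_mono add_left_mono divide_right_mono) auto
  finally show ?thesis .
qed

lemma cls_prop_compose:
  assumes "bij_betw g S S'" "S \<subseteq> V"
  shows "cls_prop S (compose V f g) k = cls_prop S' f k"
proof -
  have "{v \<in> S. compose V f g v = k} = {v \<in> S. f (g v) = k}" using assms(2) by (auto simp: compose_eq)
  moreover have "bij_betw g {v \<in> S. f (g v) = k} {w \<in> S'. f w = k}"
    using assms(1) by (auto simp: bij_betw_def inj_on_def)
  from bij_betw_same_card[OF this]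
  have "card {v \<in> S. f (g v) = k} = card {w \<in> S'. f w = k}" .
  ultimately show ?thesis
    using bij_betw_same_card[OF assms(1)] by (simp add: cls_prop_def)
qed

text \<open>Goodness of \<open>f\<close> controls the colours of \<open>cn A\<close> on
  \<open>Od\<close>; goodness of the swapped colouring controls those of \<open>cn A'\<close> on
  \<open>Ev\<close>. The work lies in showing \<open>cn A' = A\<close>, so that both describe one
  maximising pair.\<close>

lemma good_pair_near:
  fixes \<epsilon> :: real
  assumes d: "d \<ge> 1" and f: "f \<in> Homs"
    and t: "bij_betw t V V" "\<And>v. v \<in> V \<Longrightarrow> t ` nbrs v = nbrs (t v)" "bij_betw t Ev Od" "bij_betw t Od Ev"
    and gA: "good \<epsilon> f A" and gB: "good \<epsilon> (compose V f t) A'"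
    and e: "\<epsilon> > 0" "\<epsilon> < 1 / 2" "8 * real (card W) * real d * \<epsilon> < 1" "3 * \<epsilon> < pmin"
  shows "near (2 * \<epsilon>) (A, cn A) f"
proof -
  have neE: "Ev \<noteq> {}" using zero_in_Ev by blast
  have cE: "card Ev = card Od" using card_Ev_Od[OF d] by simp
  have cEp: "real (card Ev) > 0" using neE finite_Ev by (simp add: card_gt_0_iff)
  have cE0: "card Ev \<noteq> 0" using cEp by simp
  have idA: "ideal A" and QA: "real (card {v \<in> Od. cset f v \<noteq> A}) \<le> \<epsilon> * card Od"
    and OA: "\<And>l. l \<in> cn A \<Longrightarrow> \<bar>cls_prop Od f l - lam l / sum lam (cn A)\<bar> \<le> 2 * \<epsilon>"
    using gA by (auto simp: good_def)
  have idA': "ideal A'" using gB by (auto simp: good_def)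
  have EA': "\<bar>cls_prop Ev f k - lam k / sum lam (cn A')\<bar> \<le> 2 * \<epsilon>" if "k \<in> cn A'" for k
  proof -
    have "Od \<subseteq> V" using Od_V by blast
    from cls_prop_compose[OF t(4) this, of f k] show ?thesis using gB that by (auto simp: good_def)
  qed
  define A'' where "A'' = cn A'"
  note mp = max_pairD[OF ideal_max_pair[OF idA'], folded A''_def]
  have subA: "A \<subseteq> W" using idA by (simp add: ideal_def)
  \<comment> \<open>A colour \<open>k\<close> outside \<open>A''\<close> is rare on
    \<open>Ev\<close>. Yet each odd vertex with \<open>cset f v = A\<close> has a neighbour coloured
    \<open>k\<close>, and an even vertex serves at most \<open>2 * d\<close> of them. This is why
    \<open>\<epsilon>\<close> has to be small compared with \<open>1 / d\<close>.\<close>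
  have 1: "A \<subseteq> A''"
  proof (rule subsetI, rule ccontr)
    fix k assume k: "k \<in> A" "k \<notin> A''"
    have "cls_prop Ev f k \<le> card A'' * (2 * \<epsilon>)"
      using EA' by (intro cls_prop_outside_le[OF finite_Ev neE fin_sub[OF mp(2)] mp(6) k(2)]) (simp add: A''_def)
    also have "\<dots> \<le> card W * (2 * \<epsilon>)" using card_mono[OF finite_W mp(2)] e by (intro mult_right_mono) auto
    finally have "real (card {u \<in> Ev. f u = k}) \<le> card W * (2 * \<epsilon>) * card Ev"
      using cEp by (simp add: cls_prop_def divide_le_eq)
    moreover have "card {v \<in> Od. cset f v = A} \<le> card {u \<in> Ev. f u = k} * (2 * d)"
    proof -
      have "{v \<in> Od. cset f v = A} \<subseteq> (\<Union>u\<in>{u \<in> Ev. f u = k}. nbrs u)"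
      proof
        fix v assume v: "v \<in> {v \<in> Od. cset f v = A}"
        then have "k \<in> f ` nbrs v" using k(1) by (auto simp: cset_def)
        then obtain u where u: "u \<in> nbrs v" "f u = k" by auto
        then have "u \<in> Ev" "v \<in> nbrs u" using v nbrs_Od nbrs_sym Od_V by blast+
        then show "v \<in> (\<Union>u\<in>{u \<in> Ev. f u = k}. nbrs u)" using u by blast
      qed
      then have "card {v \<in> Od. cset f v = A} \<le> card (\<Union>u\<in>{u \<in> Ev. f u = k}. nbrs u)"
        using finite_Ev finite_nbrs by (intro card_mono) auto
      also have "\<dots> \<le> (\<Sum>u\<in>{u \<in> Ev. f u = k}. card (nbrs u))" using finite_Ev by (intro card_UN_le) auto
      also have "\<dots> \<le> (\<Sum>u\<in>{u \<in> Ev. f u = k}. 2 * d)" using card_nbrs_le by (intro sum_mono)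
      finally show ?thesis by simp
    qed
    then have "real (card {v \<in> Od. cset f v = A}) \<le> real (card {u \<in> Ev. f u = k} * (2 * d))" by (simp only: of_nat_le_iff)
    moreover have "real (card Od) = real (card {v \<in> Od. cset f v = A}) + real (card {v \<in> Od. cset f v \<noteq> A})"
    proof -
      have "card ({v \<in> Od. cset f v = A} \<union> {v \<in> Od. cset f v \<noteq> A}) = card {v \<in> Od. cset f v = A} + card {v \<in> Od. cset f v \<noteq> A}"
        using finite_Od by (intro card_Un_disjoint) auto
      moreover have "{v \<in> Od. cset f v = A} \<union> {v \<in> Od. cset f v \<noteq> A} = Od" by auto
      ultimately show ?thesis by simp
    qed
    moreover have "real (card {u \<in> Ev. f u = k} * (2 * d)) \<le> card W * (2 * \<epsilon>) * card Ev * (2 * real d)"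
      if "real (card {u \<in> Ev. f u = k}) \<le> card W * (2 * \<epsilon>) * card Ev"
      using mult_right_mono[OF that, of "2 * real d"] by simp
    ultimately have "real (card Od) \<le> card W * (2 * \<epsilon>) * card Ev * (2 * real d) + \<epsilon> * card Od"
      using QA by linarith
    then have "real (card Ev) * 1 \<le> card Ev * (4 * real (card W) * real d * \<epsilon> + \<epsilon>)"
      unfolding cE[symmetric] by (simp add: algebra_simps)
    then have "1 \<le> 4 * real (card W) * real d * \<epsilon> + \<epsilon>" using cEp by (simp only: mult_le_cancel_left_pos)
    then show False using e by linarith
  qed
  \<comment> \<open>Conversely, a colour of \<open>A''\<close> has frequency at least
    \<open>pmin - 2 * \<epsilon>\<close> on \<open>Ev\<close>, while \<open>nb 0 1\<close> injects
    the vertices so coloured into the few odd vertices whose set is not \<open>A\<close>.\<close>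
  have 2: "A'' \<subseteq> A"
  proof (rule subsetI, rule ccontr)
    fix k assume k: "k \<in> A''" "k \<notin> A"
    have inj: "inj_on (nb 0 1) {u \<in> Ev. f u = k}"
      using bij_nb_Ev[of 0 1] d Sg_one by (auto simp: bij_betw_def intro: inj_on_subset)
    have "nb 0 1 ` {u \<in> Ev. f u = k} \<subseteq> {v \<in> Od. cset f v \<noteq> A}"
    proof (rule image_subsetI)
      fix u assume u: "u \<in> {u \<in> Ev. f u = k}"
      have "nb 0 1 u \<in> nbrs u" using d Sg_one by (intro nbrs_I) auto
      then have "u \<in> nbrs (nb 0 1 u)" using u nbrs_sym Ev_V by blast
      then have "k \<in> cset f (nb 0 1 u)" using u by (auto simp: cset_def)
      moreover have "nb 0 1 u \<in> Od" using u d Sg_one by (intro nb_Ev) auto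
      ultimately show "nb 0 1 u \<in> {v \<in> Od. cset f v \<noteq> A}" using k(2) by auto
    qed
    from card_inj_on_le[OF inj this] have "card {u \<in> Ev. f u = k} \<le> card {v \<in> Od. cset f v \<noteq> A}"
      using finite_Od by simp
    then have "real (card {u \<in> Ev. f u = k}) \<le> \<epsilon> * card Ev" using QA unfolding cE by linarith
    then have "cls_prop Ev f k \<le> \<epsilon>" using cEp by (simp add: cls_prop_def divide_le_eq)
    moreover have "pmin \<le> lam k / sum lam A''" using pmin_le[OF mp(2) k(1)] .
    ultimately show False using EA'[of k] k(1) e unfolding A''_def by (auto simp: abs_le_iff)
  qed
  have eq: "A'' = A" using 1 2 by blast
  show ?thesis unfolding near_def using OA EA' eq A''_def by auto
qed

text \<open>A colouring outside all classes fails to be good either itself or after the exchange of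
  the parities. The exchange preserves weights, whence the factor \<open>2\<close>.\<close>

lemma exceptional_weight_le:
  fixes q0 \<epsilon> t :: real
  assumes tail: "set_weight G lam {f \<in> Homs. q0 * card autos \<le> real (defect (cset f) ideal)} \<le> t * partition_fun G H lam"
    and d: "d \<ge> 2" and q: "real m * real d * q0 \<le> \<epsilon>"
    and e: "\<epsilon> > 0" "\<epsilon> < 1 / 2" "8 * real (card W) * real d * \<epsilon> < 1" "3 * \<epsilon> < pmin"
  shows "set_weight G lam (Homs - (\<Union>P\<in>max_pairs H lam. cls (2 * \<epsilon>) P))
     \<le> 2 * (t + 2 ^ card W * card W / (\<epsilon>\<^sup>2 * card Od)) * partition_fun G H lam"
proof -
  have d1: "d \<ge> 1" using d by simp
  obtain s where s: "bij_betw s V V" "\<And>v. v \<in> V \<Longrightarrow> s ` nbrs v = nbrs (s v)" "bij_betw s Ev Od" "bij_betw s Od Ev"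
  proof (rule ex_class_swap[OF d1], goal_cases)
    case (1 t)
    show ?case by (rule that[of t]) (fact 1)+
  qed
  define N where "N = {f \<in> Homs. \<not> (\<exists>A. good \<epsilon> f A)}"
  define N' where "N' = {f \<in> Homs. \<not> (\<exists>A. good \<epsilon> (compose V f s) A)}"
  have "Homs - (\<Union>P\<in>max_pairs H lam. cls (2 * \<epsilon>) P) \<subseteq> N \<union> N'"
  proof
    fix f assume f: "f \<in> Homs - (\<Union>P\<in>max_pairs H lam. cls (2 * \<epsilon>) P)"
    show "f \<in> N \<union> N'"
    proof (rule ccontr)
      assume "f \<notin> N \<union> N'"
      then obtain A A' where g: "good \<epsilon> f A" "good \<epsilon> (compose V f s) A'" using f by (auto simp: N_def N'_def)
      have "near (2 * \<epsilon>) (A, cn A) f" using good_pair_near[OF d1 _ s g e] f by blast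
      moreover have "(A, cn A) \<in> max_pairs H lam" using g(1) ideal_max_pair by (auto simp: good_def)
      ultimately show False using f by (auto simp: cls_def)
    qed
  qed
  then have "set_weight G lam (Homs - (\<Union>P\<in>max_pairs H lam. cls (2 * \<epsilon>) P)) \<le> set_weight G lam (N \<union> N')"
    by (rule set_weight_mono) (auto simp: N_def N'_def)
  also have "\<dots> \<le> set_weight G lam N + set_weight G lam N'"
    by (rule set_weight_Un_le) (auto simp: N_def N'_def)
  also have "set_weight G lam N' = set_weight G lam N"
    unfolding N_def N'_def using set_weight_compose[OF s(1,2), of "\<lambda>f. \<not> (\<exists>A. good \<epsilon> f A)"] by blast
  finally show ?thesis
    using not_good_weight_le[OF tail d q e(1,2)] unfolding N_def by (simp add: algebra_simps)
qed

end

section \<open>Disjointness, symmetries and marginals of the classes\<close>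

context torus_colouring
begin

text \<open>A colour of \<open>A\<close> outside \<open>A'\<close> would have frequency at least
  \<open>pmin - tol\<close> on \<open>Ev\<close> by the first closeness and at most
  \<open>card W * tol\<close> by the second.\<close>

lemma near_sub:
  assumes P: "(A, B) \<in> max_pairs H lam" "(A', B') \<in> max_pairs H lam"
    and f: "near tol (A, B) f" "near tol (A', B') f" and tol: "tol \<ge> 0" "(real (card W) + 1) * tol < pmin"
  shows "A \<subseteq> A'"
proof (rule subsetI, rule ccontr)
  fix a assume a: "a \<in> A" "a \<notin> A'"
  note mp = max_pairD[OF P(1)] and mp' = max_pairD[OF P(2)]
  have neE: "Ev \<noteq> {}" using zero_in_Ev by blast
  have "cls_prop Ev f a \<le> card A' * tol"
    using f(2) by (intro cls_prop_outside_le[OF finite_Ev neE fin_sub[OF mp'(1)] mp'(5) a(2)]) (simp add: near_def)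
  also have "\<dots> \<le> card W * tol" using card_mono[OF finite_W mp'(1)] tol by (intro mult_right_mono) auto
  finally have "cls_prop Ev f a \<le> card W * tol" .
  moreover have "\<bar>cls_prop Ev f a - lam a / sum lam A\<bar> \<le> tol" using f(1) a(1) by (simp add: near_def)
  moreover have "pmin \<le> lam a / sum lam A" using pmin_le[OF mp(1) a(1)] .
  moreover have "(real (card W) + 1) * tol = card W * tol + tol" by (simp add: algebra_simps)
  ultimately show False using tol(2) by linarith
qed

lemma cls_disjoint:
  assumes tol: "tol \<ge> 0" "(real (card W) + 1) * tol < pmin"
  shows "disjoint_family_on (cls tol) (max_pairs H lam)"
unfolding disjoint_family_on_def
proof (intro ballI impI)
  fix P P' assume P: "P \<in> max_pairs H lam" "P' \<in> max_pairs H lam" "P \<noteq> P'"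
  obtain A B where AB: "P = (A, B)" by (cases P)
  obtain A' B' where AB': "P' = (A', B')" by (cases P')
  have "A = A' \<and> B = B'" if "near tol P f" "near tol P' f" for f
  proof -
    have "A = A'" using near_sub[of A B A' B' tol f] near_sub[of A' B' A B tol f] P AB AB' that tol by blast
    then show ?thesis using max_pairD(7)[of A B] max_pairD(7)[of A' B'] P AB AB' by simp
  qed
  then show "cls tol P \<inter> cls tol P' = {}" using P(3) AB AB' by (auto simp: cls_def)
qed

lemma near_compose:
  assumes "g \<in> autos"
  shows "near tol P (compose V f g) \<longleftrightarrow> near tol P f"
proof -
  have inj: "inj_on g Ev" using autos_bij[OF assms] Ev_V by (meson bij_betw_def inj_on_subset subsetI)
  have "g ` Ev = Ev" using autos_Ev[OF assms] by (intro endo_inj_surj[OF finite_Ev _ inj]) auto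
  then have bE: "bij_betw g Ev Ev" using inj by (simp add: bij_betw_def)
  have sub: "Ev \<subseteq> V" "Od \<subseteq> V" using Ev_V Od_V by auto
  show ?thesis
    unfolding near_def cls_prop_compose[OF bE sub(1)] cls_prop_compose[OF autos_bij_Od[OF assms] sub(2)] ..
qed

lemma cls_swap_weight:
  assumes "d \<ge> 1"
  shows "set_weight G lam (cls tol (A, B)) = set_weight G lam (cls tol (B, A))"
proof -
  obtain s where s: "bij_betw s V V" "\<And>v. v \<in> V \<Longrightarrow> s ` nbrs v = nbrs (s v)" "bij_betw s Ev Od" "bij_betw s Od Ev"
  proof (rule ex_class_swap[OF assms], goal_cases)
    case (1 t)
    show ?case by (rule that[of t]) (fact 1)+
  qed
  have sub: "Ev \<subseteq> V" "Od \<subseteq> V" using Ev_V Od_V by auto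
  have "near tol (A, B) (compose V f s) \<longleftrightarrow> near tol (B, A) f" for f
    unfolding near_def cls_prop_compose[OF s(3) sub(1)] cls_prop_compose[OF s(4) sub(2)] by auto
  then show ?thesis
    unfolding cls_def using set_weight_compose[OF s(1,2), of "near tol (A, B)"] by simp
qed

lemma cls_automorphism_weight:
  assumes \<phi>: "weight_preserving_automorphism H lam \<phi>" and AB: "A \<subseteq> W" "B \<subseteq> W"
  shows "set_weight G lam (cls tol (A, B)) = set_weight G lam (cls tol (\<phi> ` A, \<phi> ` B))"
proof -
  have bij: "bij_betw \<phi> W W" and ed: "\<And>u v. u \<in> W \<Longrightarrow> v \<in> W \<Longrightarrow> {\<phi> u, \<phi> v} \<in> edges H \<longleftrightarrow> {u, v} \<in> edges H"
    and lm: "\<And>i. i \<in> W \<Longrightarrow> lam (\<phi> i) = lam i"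
    using \<phi> by (auto simp: weight_preserving_automorphism_def automorphism_def)
  have inj: "inj_on \<phi> W" and im: "\<phi> ` W = W" using bij by (auto simp: bij_betw_def)
  define \<Phi> where "\<Phi> f = compose V \<phi> f" for f :: "nat list \<Rightarrow> 'b"
  have fW: "f v \<in> W" if "f \<in> Homs" "v \<in> V" for f v using that Hom_iff PiE_mem by blast
  have \<Phi>H: "\<Phi> f \<in> Homs" if f: "f \<in> Homs" for f
  proof -
    have "\<Phi> f \<in> V \<rightarrow>\<^sub>E W" unfolding \<Phi>_def compose_def using fW[OF f] im by auto
    moreover have "{\<Phi> f u, \<Phi> f v} \<in> edges H" if e: "{u, v} \<in> edges G" for u v
    proof -
      have uv: "u \<in> V" "v \<in> V" using e edge_iff nbrs_V by blast+
      have "{f u, f v} \<in> edges H" using f e by (simp add: Hom_def)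
      then show ?thesis using uv ed fW[OF f] by (simp add: \<Phi>_def compose_eq)
    qed
    ultimately show ?thesis by (simp add: Hom_def verts_torus)
  qed
  have injH: "inj_on \<Phi> Homs"
  proof (rule inj_onI)
    fix f f' assume f: "f \<in> Homs" "f' \<in> Homs" "\<Phi> f = \<Phi> f'"
    show "f = f'"
    proof (rule extensionalityI[of _ V])
      show "f \<in> extensional V" "f' \<in> extensional V" using f(1,2) by (auto simp: Hom_iff PiE_iff)
      fix v assume v: "v \<in> V"
      have "\<phi> (f v) = \<phi> (f' v)" using fun_cong[OF f(3), of v] v by (simp add: \<Phi>_def compose_eq)
      then show "f v = f' v" using inj fW[OF f(1) v] fW[OF f(2) v] by (auto dest: inj_onD)
    qed
  qed
  have "\<Phi> ` Homs = Homs" by (rule endo_inj_surj[OF finite_Homs _ injH]) (use \<Phi>H in auto)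
  then have bijH: "bij_betw \<Phi> Homs Homs" using injH by (simp add: bij_betw_def)
  have cw: "col_weight G lam (\<Phi> f) = col_weight G lam f" if f: "f \<in> Homs" for f
    unfolding col_weight_def verts_torus \<Phi>_def
    using fW[OF f] lm by (intro prod.cong) (auto simp: compose_eq)
  have pr: "cls_prop S (\<Phi> f) (\<phi> k) = cls_prop S f k" if f: "f \<in> Homs" and S: "S \<subseteq> V" and k: "k \<in> W" for f S k
  proof -
    have "\<Phi> f v = \<phi> k \<longleftrightarrow> f v = k" if "v \<in> S" for v
    proof -
      have v: "v \<in> V" using that S by blast
      then have "\<Phi> f v = \<phi> (f v)" by (simp add: \<Phi>_def compose_eq)
      then show ?thesis using inj_on_eq_iff[OF inj fW[OF f v] k] by simp
    qed
    then have "{v \<in> S. \<Phi> f v = \<phi> k} = {v \<in> S. f v = k}" by auto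
    then show ?thesis by (simp add: cls_prop_def)
  qed
  have sums: "sum lam (\<phi> ` C) = sum lam C" if C: "C \<subseteq> W" for C
    using inj_on_subset[OF inj C] lm C by (subst sum.reindex) (auto intro!: sum.cong)
  have sub: "Ev \<subseteq> V" "Od \<subseteq> V" using Ev_V Od_V by auto
  have nr: "near tol (\<phi> ` A, \<phi> ` B) (\<Phi> f) \<longleftrightarrow> near tol (A, B) f" if f: "f \<in> Homs" for f
  proof -
    have "\<bar>cls_prop Ev (\<Phi> f) (\<phi> k) - lam (\<phi> k) / sum lam (\<phi> ` A)\<bar> = \<bar>cls_prop Ev f k - lam k / sum lam A\<bar>" if "k \<in> A" for k
      using pr[OF f sub(1)] lm sums[OF AB(1)] that AB(1) by auto
    moreover have "\<bar>cls_prop Od (\<Phi> f) (\<phi> l) - lam (\<phi> l) / sum lam (\<phi> ` B)\<bar> = \<bar>cls_prop Od f l - lam l / sum lam B\<bar>" if "l \<in> B" for l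
      using pr[OF f sub(2)] lm sums[OF AB(2)] that AB(2) by auto
    ultimately show ?thesis by (simp add: near_def)
  qed
  have "set_weight G lam (cls tol (A, B)) = (\<Sum>f\<in>Homs. if near tol (A, B) f then col_weight G lam f else 0)"
    unfolding set_weight_def cls_def using finite_Homs by (simp add: sum.inter_filter)
  also have "\<dots> = (\<Sum>f\<in>Homs. if near tol (\<phi> ` A, \<phi> ` B) (\<Phi> f) then col_weight G lam (\<Phi> f) else 0)"
    using nr cw by (intro sum.cong) auto
  also have "\<dots> = (\<Sum>f\<in>Homs. if near tol (\<phi> ` A, \<phi> ` B) f then col_weight G lam f else 0)"
    by (rule sum.reindex_bij_betw[OF bijH])
  also have "\<dots> = set_weight G lam (cls tol (\<phi> ` A, \<phi> ` B))"
    unfolding set_weight_def cls_def using finite_Homs by (simp add: sum.inter_filter)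
  finally show ?thesis .
qed

text \<open>Any colouring of \<open>Ev\<close> by \<open>A\<close> glued to any colouring of
  \<open>Od\<close> by \<open>B\<close> is a homomorphism, so a balanced one can be chosen on each
  side separately.\<close>

lemma cls_nonempty:
  fixes tol :: real
  assumes d: "d \<ge> 1" and AB: "(A, B) \<in> max_pairs H lam" and tol: "tol > 0" "real (card W) < tol\<^sup>2 * card Ev"
  shows "cls tol (A, B) \<noteq> {}"
proof -
  note mp = max_pairD[OF AB]
  obtain a where a: "a \<in> Ev \<rightarrow>\<^sub>E A" "\<And>k. k \<in> A \<Longrightarrow> \<bar>cls_prop Ev a k - lam k / sum lam A\<bar> \<le> tol"
    using ex_balanced[OF finite_Ev mp(1,3) tol] by blast
  have tol': "real (card W) < tol\<^sup>2 * card Od" using tol card_Ev_Od[OF d] by simp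
  obtain b where b: "b \<in> Od \<rightarrow>\<^sub>E B" "\<And>l. l \<in> B \<Longrightarrow> \<bar>cls_prop Od b l - lam l / sum lam B\<bar> \<le> tol"
    using ex_balanced[OF finite_Od mp(2,4) tol(1) tol'] by blast
  define f where "f = (\<lambda>v\<in>V. if v \<in> Ev then a v else b v)"
  have fE: "f v = a v" if "v \<in> Ev" for v using that Ev_V by (simp add: f_def)
  have fO: "f v = b v" if "v \<in> Od" for v using that Od_V Od_not_Ev by (simp add: f_def)
  have "f v \<in> W" if "v \<in> V" for v
  proof -
    from that consider "v \<in> Ev" | "v \<in> Od" using Ev_Od(1) by blast
    then show ?thesis
    proof cases
      case 1
      then show ?thesis using fE PiE_mem[OF a(1) 1] mp(1) by auto
    next
      case 2
      then show ?thesis using fO PiE_mem[OF b(1) 2] mp(2) by auto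
    qed
  qed
  then have fV: "f \<in> V \<rightarrow>\<^sub>E W" by (auto simp: f_def)
  have "f v \<in> cn (cset f v)" if v: "v \<in> Od" for v
  proof -
    have "cset f v \<subseteq> A" using nbrs_Od[OF v] fE PiE_mem[OF a(1)] by (auto simp: cset_def)
    then have "cn A \<subseteq> cn (cset f v)" by (rule cn_antimono)
    moreover have "f v \<in> cn A" using fO[OF v] PiE_mem[OF b(1) v] mp(7) by simp
    ultimately show ?thesis by blast
  qed
  then have "f \<in> Homs" using fV Hom_iff by blast
  moreover have "cls_prop Ev f k = cls_prop Ev a k" for k
  proof -
    have "{v \<in> Ev. f v = k} = {v \<in> Ev. a v = k}" using fE by auto
    then show ?thesis by (simp add: cls_prop_def)
  qed
  moreover have "cls_prop Od f k = cls_prop Od b k" for k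
  proof -
    have "{v \<in> Od. f v = k} = {v \<in> Od. b v = k}" using fO by auto
    then show ?thesis by (simp add: cls_prop_def)
  qed
  ultimately have "f \<in> cls tol (A, B)" using a(2) b(2) by (simp add: cls_def near_def)
  then show ?thesis by blast
qed

text \<open>The class is invariant under \<open>autos\<close>, which acts transitively on each
  parity class, so the weight of its members with \<open>f x = k\<close> is the same for all
  \<open>x\<close> in \<open>S\<close>. Averaging over \<open>x\<close> replaces the marginal by the
  mean of the frequency of \<open>k\<close>, and this frequency is within \<open>tol\<close> of
  \<open>r\<close> for every member.\<close>

lemma cond_prob_close:
  assumes S: "S = Ev \<or> S = Od" and x: "x \<in> S" and ne: "cls tol P \<noteq> {}"
    and close: "\<And>f. f \<in> cls tol P \<Longrightarrow> \<bar>cls_prop S f k - r\<bar> \<le> tol"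
  shows "\<bar>col_cond_prob G H lam {f. f x = k} (cls tol P) - r\<bar> \<le> tol"
proof -
  let ?C = "cls tol P"
  have CH: "?C \<subseteq> Homs" by (auto simp: cls_def)
  have finC: "finite ?C" using CH finite_Homs finite_subset by blast
  have finS: "finite S" using S finite_Ev finite_Od by auto
  have SV: "v \<in> V" if "v \<in> S" for v using S that Ev_V Od_V by auto
  have cS: "real (card S) > 0" using x finS by (auto simp: card_gt_0_iff)
  define w where "w y = set_weight G lam {f \<in> Homs. near tol P f \<and> f y = k}" for y
  have weq: "w y = w x" if y: "y \<in> S" for y
  proof -
    have "even (sum_list x) \<longleftrightarrow> even (sum_list y)" using S x y by (auto simp: even_class_def odd_class_def)
    from transitive_auto[OF SV[OF x] SV[OF y] this] obtain g where g: "g \<in> autos" "g x = y" by blast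
    have "w x = set_weight G lam {f \<in> Homs. near tol P (compose V f g) \<and> compose V f g x = k}"
      unfolding w_def using set_weight_compose[OF autos_bij[OF g(1)] autos_nbrs[OF g(1)], of "\<lambda>f. near tol P f \<and> f x = k"] by simp
    also have "\<dots> = w y" unfolding w_def near_compose[OF g(1)] using SV[OF x] g(2) by (simp add: compose_eq)
    finally show ?thesis by simp
  qed
  have wC: "w y = (\<Sum>f\<in>?C. col_weight G lam f * of_bool (f y = k))" for y
  proof -
    have "{f \<in> Homs. near tol P f \<and> f y = k} = {f \<in> ?C. f y = k}" by (auto simp: cls_def)
    then have "w y = (\<Sum>f\<in>?C. if f y = k then col_weight G lam f else 0)"
      unfolding w_def set_weight_def using finC by (simp add: sum.inter_filter)
    also have "\<dots> = (\<Sum>f\<in>?C. col_weight G lam f * of_bool (f y = k))" by (intro sum.cong) auto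
    finally show ?thesis .
  qed
  have "card S * w x = (\<Sum>y\<in>S. w y)" using weq by simp
  also have "\<dots> = (\<Sum>f\<in>?C. \<Sum>y\<in>S. col_weight G lam f * of_bool (f y = k))"
    unfolding wC by (rule sum.swap)
  also have "\<dots> = (\<Sum>f\<in>?C. col_weight G lam f * (card S * cls_prop S f k))"
  proof (rule sum.cong[OF refl])
    fix f
    have "(\<Sum>y\<in>S. col_weight G lam f * of_bool (f y = k)) = col_weight G lam f * real (card {y \<in> S. f y = k})"
      unfolding card_filter_eq_sum[OF finS] by (rule sum_distrib_left[symmetric])
    then show "(\<Sum>y\<in>S. col_weight G lam f * of_bool (f y = k)) = col_weight G lam f * (card S * cls_prop S f k)"
      using cS by (simp add: cls_prop_def)
  qed
  also have "\<dots> = card S * (\<Sum>f\<in>?C. col_weight G lam f * cls_prop S f k)"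
    unfolding sum_distrib_left by (intro sum.cong) auto
  finally have wx: "w x = (\<Sum>f\<in>?C. col_weight G lam f * cls_prop S f k)" using cS by simp
  define z where "z = set_weight G lam ?C"
  have pos: "col_weight G lam f > 0" if "f \<in> ?C" for f using col_weight_pos CH that by blast
  have z: "z > 0" unfolding z_def set_weight_def using finC ne pos by (intro sum_pos) auto
  have "\<bar>w x - r * z\<bar> = \<bar>\<Sum>f\<in>?C. col_weight G lam f * (cls_prop S f k - r)\<bar>"
    unfolding wx z_def set_weight_def by (simp add: algebra_simps sum_subtractf sum_distrib_left)
  also have "\<dots> \<le> (\<Sum>f\<in>?C. \<bar>col_weight G lam f * (cls_prop S f k - r)\<bar>)" by (rule sum_abs)
  also have "\<dots> \<le> (\<Sum>f\<in>?C. col_weight G lam f * tol)"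
  proof (rule sum_mono)
    fix f assume f: "f \<in> ?C"
    have "\<bar>col_weight G lam f * (cls_prop S f k - r)\<bar> = col_weight G lam f * \<bar>cls_prop S f k - r\<bar>"
      using pos[OF f] by (simp add: abs_mult)
    also have "\<dots> \<le> col_weight G lam f * tol" using pos[OF f] close[OF f] by (intro mult_left_mono) auto
    finally show "\<bar>col_weight G lam f * (cls_prop S f k - r)\<bar> \<le> col_weight G lam f * tol" .
  qed
  also have "\<dots> = tol * z" unfolding z_def set_weight_def
    by (subst sum_distrib_right[symmetric]) (rule mult.commute)
  finally have dev: "\<bar>w x - r * z\<bar> \<le> tol * z" .
  define Z where "Z = partition_fun G H lam"
  have "z \<le> Z" unfolding z_def Z_def partition_fun_def by (rule set_weight_mono[OF CH]) simp
  then have Z: "Z > 0" using z by simp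
  have cp: "col_prob G H lam Q = set_weight G lam (Q \<inter> Homs) / Z" for Q
    unfolding col_prob_def set_weight_def Z_def by (simp add: sum_divide_distrib)
  have s1: "({f. f x = k} \<inter> ?C) \<inter> Homs = {f \<in> Homs. near tol P f \<and> f x = k}" by (auto simp: cls_def)
  have s2: "?C \<inter> Homs = ?C" using CH by blast
  have "col_cond_prob G H lam {f. f x = k} ?C = w x / z"
    unfolding col_cond_prob_def cp s1 s2 using Z by (simp add: w_def z_def)
  moreover have "\<bar>w x / z - r\<bar> = \<bar>w x - r * z\<bar> / z" 
  proof -
    have "w x / z - r = (w x - r * z) / z" using z by (simp add: diff_divide_distrib)
    then show ?thesis using z by (simp add: abs_divide)
  qed
  ultimately show ?thesis using dev z by (simp add: divide_le_eq)
qed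

lemma approx_factor_close:
  assumes "\<bar>x - r\<bar> \<le> tol" "pmin \<le> r" "tol \<le> \<delta> * pmin" "\<delta> \<ge> 0"
  shows "approx_factor \<delta> x r"
proof -
  have r: "r > 0" using assms pmin_pos by simp
  have "\<bar>(x - r) / r\<bar> = \<bar>x - r\<bar> / r" using r by simp
  also have "\<dots> \<le> \<delta>"
  proof -
    have "\<bar>x - r\<bar> \<le> \<delta> * r" using assms mult_left_mono[OF assms(2,4)] by linarith
    then show ?thesis using r by (simp add: divide_le_eq)
  qed
  finally have "\<bar>(x - r) / r\<bar> \<le> \<delta>" .
  moreover have "x = r * (1 + (x - r) / r)" using r by (simp add: field_simps)
  ultimately show ?thesis unfolding approx_factor_def by blast
qed

end

section \<open>Choice of the rates and assembly\<close>

lemma asymptotic_choice: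
  fixes m k h :: nat and L \<kappa> pm c0 :: real
  assumes m: "m \<ge> 2" and k: "k \<ge> 1" and pos: "\<kappa> > 0" "pm > 0" "c0 > 0"
  shows "\<exists>c1>0. \<forall>\<^sub>F d::nat in sequentially. \<forall>\<epsilon> n. \<epsilon> = real m * real d * exp (- c1 * real d) \<longrightarrow> 2 * n = real m ^ d \<longrightarrow>
    d \<ge> 2 \<and> d \<ge> k \<and> real k * (L + \<kappa>) \<le> real d * (\<kappa> / (2 * real k)) \<and>
    \<epsilon> > 0 \<and> \<epsilon> < 1 / 2 \<and> 8 * real h * real d * \<epsilon> < 1 \<and> 3 * \<epsilon> < pm \<and> (real h + 1) * (2 * \<epsilon>) < pm \<and>
    2 * \<epsilon> \<le> exp (- (c1 / 2) * real d) * pm \<and> 2 * \<epsilon> \<le> exp (- (c1 / 2) * real d) \<and> real h < (2 * \<epsilon>)\<^sup>2 * n \<and>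
    2 * ((2 * real m * real d) ^ d * 2 ^ h * exp (n * (2 * 2 ^ h * exp (- c0 * real d) - \<kappa> / (4 * real k) * exp (- c1 * real d)))
       + 2 ^ h * real h / (\<epsilon>\<^sup>2 * n)) \<le> exp (- (c1 / 2) * real d)"
proof -
  \<comment> \<open>\<open>exp (- c1 * d)\<close> is the threshold for the defect, and the diameter
    bound turns it into \<open>\<epsilon> = m * d * exp (- c1 * d)\<close>. Being below
    \<open>c0\<close>, the rate \<open>c1\<close> lets the threshold dominate the pattern cost
    \<open>exp (- c0 * d)\<close>; being small against \<open>ln 2\<close>, it lets
    \<open>\<epsilon>^2 * m^d\<close> outgrow \<open>exp (c1 * d / 2)\<close>.\<close>
  define c1 where "c1 = min (c0 / 2) (ln 2 / 8)"
  have ln2: "ln (2::real) > 0" by simp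
  have c1: "c1 > 0" "2 * c1 \<le> c0" "8 * c1 \<le> ln 2" using pos ln2 by (auto simp: c1_def min_def)
  define K where "K = \<kappa> / (16 * real k)"
  have K: "K > 0" using pos k by (simp add: K_def)
  define M where "M = real m"
  have M: "M \<ge> 2" using m by (simp add: M_def)
  \<comment> \<open>The rate finally claimed is \<open>c1 / 2\<close>; the other half absorbs
    polynomial factors, collected in \<open>u\<close> through
    \<open>d * \<epsilon> = m * u d * exp (- (c1 / 2) * d)\<close>.\<close>
  define u where "u d = real d ^ 2 * exp (- (c1 / 2) * real d)" for d :: nat
  have u: "u \<longlonglongrightarrow> 0" unfolding u_def using c1(1) by real_asymp
  \<comment> \<open>One threshold for \<open>u d\<close> that implies all linear smallness
    conditions on \<open>\<epsilon>\<close> together; hence the generous coefficient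
    \<open>8 * h + 8\<close>.\<close>
  define b where "b = min (min 1 pm) 1 / (M * (8 * real h + 8))"
  have b: "b > 0" unfolding b_def using pos M by (intro divide_pos_pos mult_pos_pos) auto
  have a1: "ln 2 - 2 * c1 > 0" "ln 2 - 5 / 2 * c1 > 0" "ln 2 - c1 > 0" "c0 - c1 > 0" using c1 ln2 by linarith+
  have "\<forall>\<^sub>F d in sequentially. u d < b" using order_tendstoD(2)[OF u b] .
  moreover have "\<forall>\<^sub>F d::nat in sequentially. d \<ge> 2 + k" by (rule eventually_ge_at_top)
  moreover have "\<forall>\<^sub>F d::nat in sequentially. real k * (L + \<kappa>) \<le> real d * (\<kappa> / (2 * real k))"
  proof -
    have "\<kappa> / (2 * real k) > 0" using pos k by simp
    then have "filterlim (\<lambda>d::nat. real d * (\<kappa> / (2 * real k))) at_top sequentially" by real_asymp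
    then show ?thesis by (simp add: filterlim_at_top)
  qed
  moreover have "\<forall>\<^sub>F d::nat in sequentially. real h + 1 \<le> 2 * exp ((ln 2 - 2 * c1) * real d)"
  proof -
    have "filterlim (\<lambda>d::nat. 2 * exp ((ln 2 - 2 * c1) * real d)) at_top sequentially" using a1(1) by real_asymp
    then show ?thesis by (simp add: filterlim_at_top)
  qed
  moreover have "\<forall>\<^sub>F d::nat in sequentially. 8 * 2 ^ h * real h \<le> exp ((ln 2 - 5 / 2 * c1) * real d)"
  proof -
    have "filterlim (\<lambda>d::nat. exp ((ln 2 - 5 / 2 * c1) * real d)) at_top sequentially" using a1(2) by real_asymp
    then show ?thesis by (simp add: filterlim_at_top)
  qed
  moreover have "\<forall>\<^sub>F d::nat in sequentially. 2 * 2 ^ h / (\<kappa> / (8 * real k)) \<le> exp ((c0 - c1) * real d)"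
  proof -
    have "filterlim (\<lambda>d::nat. exp ((c0 - c1) * real d)) at_top sequentially" using a1(4) by real_asymp
    then show ?thesis by (simp add: filterlim_at_top)
  qed
  moreover have "\<forall>\<^sub>F d::nat in sequentially. 0 \<le> K * exp ((ln 2 - c1) * real d) - real d * ln (2 * M * real d) - (real h * ln 2 + ln 4) - (c1 / 2) * real d"
  proof -
    have "M > 0" using M by simp
    then have "filterlim (\<lambda>d::nat. K * exp ((ln 2 - c1) * real d) - real d * ln (2 * M * real d) - (real h * ln 2 + ln 4) - (c1 / 2) * real d) at_top sequentially"
      using K a1(3) by real_asymp
    then show ?thesis unfolding filterlim_at_top by (rule spec)
  qed
  ultimately have "\<forall>\<^sub>F d::nat in sequentially. \<forall>\<epsilon> n. \<epsilon> = real m * real d * exp (- c1 * real d) \<longrightarrow> 2 * n = real m ^ d \<longrightarrow>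
    d \<ge> 2 \<and> d \<ge> k \<and> real k * (L + \<kappa>) \<le> real d * (\<kappa> / (2 * real k)) \<and>
    \<epsilon> > 0 \<and> \<epsilon> < 1 / 2 \<and> 8 * real h * real d * \<epsilon> < 1 \<and> 3 * \<epsilon> < pm \<and> (real h + 1) * (2 * \<epsilon>) < pm \<and>
    2 * \<epsilon> \<le> exp (- (c1 / 2) * real d) * pm \<and> 2 * \<epsilon> \<le> exp (- (c1 / 2) * real d) \<and> real h < (2 * \<epsilon>)\<^sup>2 * n \<and>
    2 * ((2 * real m * real d) ^ d * 2 ^ h * exp (n * (2 * 2 ^ h * exp (- c0 * real d) - \<kappa> / (4 * real k) * exp (- c1 * real d)))
       + 2 ^ h * real h / (\<epsilon>\<^sup>2 * n)) \<le> exp (- (c1 / 2) * real d)"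
  proof (eventually_elim, intro allI impI, goal_cases)
    case (1 d \<epsilon> n)
    note ub = 1(1) and dk = 1(2) and dL = 1(3) and e2 = 1(4) and e3 = 1(5) and e4 = 1(6) and e5 = 1(7)
    have eps: "\<epsilon> = M * real d * exp (- c1 * real d)" using 1(15) by (simp add: M_def)
    have n: "2 * n = M ^ d" using 1(16) by (simp add: M_def)
    define \<delta> where "\<delta> = exp (- (c1 / 2) * real d)"
    have d1: "real d \<ge> 1" "d \<ge> 2" "d \<ge> k" using dk by auto
    have \<delta>01: "\<delta> > 0" "\<delta> \<le> 1" using c1 by (auto simp: \<delta>_def)
    have \<delta>2: "exp (- c1 * real d) = \<delta> * \<delta>" unfolding \<delta>_def by (simp flip: exp_add)
    have eps_pos: "\<epsilon> > 0" using M d1 by (simp add: eps)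
    have de: "real d * \<epsilon> = M * u d * \<delta>" unfolding eps u_def \<delta>2 by (simp add: \<delta>_def power2_eq_square)
    have Mu: "M * u d \<ge> 0" using M by (simp add: u_def)
    have Mu2: "M * u d * (8 * real h + 8) < min 1 pm"
    proof -
      have "u d * (M * (8 * real h + 8)) < min 1 pm"
        using ub M unfolding b_def by (subst (asm) pos_less_divide_eq) auto
      then show ?thesis by (simp add: algebra_simps)
    qed
    have x8: "8 * (M * u d) < min 1 pm" "8 * real h * (M * u d) < min 1 pm" "(8 * real h + 2) * (M * u d) < min 1 pm"
    proof -
      have "(M * u d) * 8 \<le> M * u d * (8 * real h + 8)" "(M * u d) * (8 * real h) \<le> M * u d * (8 * real h + 8)"
        "(M * u d) * (8 * real h + 2) \<le> M * u d * (8 * real h + 8)"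
        using Mu by (intro mult_left_mono; simp)+
      then show "8 * (M * u d) < min 1 pm" "8 * real h * (M * u d) < min 1 pm" "(8 * real h + 2) * (M * u d) < min 1 pm"
        using Mu2 by (auto simp: mult.commute)
    qed
    have ed: "\<epsilon> \<le> real d * \<epsilon>" using d1 eps_pos by simp
    have dMu: "real d * \<epsilon> \<le> M * u d" using de Mu \<delta>01 by (simp add: mult_left_le)
    have eMu: "\<epsilon> \<le> M * u d * \<delta>" using ed de by simp
    have g1: "\<epsilon> < 1 / 2" using ed dMu x8(1) by linarith
    have g2: "8 * real h * real d * \<epsilon> < 1"
    proof -
      have "8 * real h * (real d * \<epsilon>) \<le> 8 * real h * (M * u d)" using dMu by (intro mult_left_mono) auto
      then show ?thesis using x8(2) by (simp add: mult.assoc)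
    qed
    have g3: "3 * \<epsilon> < pm" using ed dMu x8(1) Mu by linarith
    have g4: "(real h + 1) * (2 * \<epsilon>) < pm"
    proof -
      have "(real h + 1) * (2 * \<epsilon>) = (2 * real h + 2) * \<epsilon>" by (simp add: algebra_simps)
      also have "\<dots> \<le> (2 * real h + 2) * (M * u d)" using ed dMu by (intro mult_left_mono) auto
      also have "\<dots> \<le> (8 * real h + 2) * (M * u d)" using Mu by (intro mult_right_mono) auto
      finally show ?thesis using x8(3) by simp
    qed
    have g5: "2 * \<epsilon> \<le> \<delta> * pm"
    proof -
      have "2 * \<epsilon> \<le> (2 * (M * u d)) * \<delta>" using eMu by simp
      also have "\<dots> \<le> pm * \<delta>" using x8(1) Mu \<delta>01 by (intro mult_right_mono) linarith+
      finally show ?thesis by (simp add: mult.commute)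
    qed
    have g5': "2 * \<epsilon> \<le> \<delta>"
    proof -
      have "2 * \<epsilon> \<le> (2 * (M * u d)) * \<delta>" using eMu by simp
      also have "\<dots> \<le> 1 * \<delta>" using x8(1) Mu \<delta>01 by (intro mult_right_mono) linarith+
      finally show ?thesis by simp
    qed
    define Y where "Y = exp ((ln 2 - 2 * c1) * real d)"
    have Y0: "Y > 0" by (simp add: Y_def)
    have Md: "M ^ d \<ge> exp (ln 2 * real d)"
    proof -
      have "exp (ln 2 * real d) = 2 ^ d" by (simp add: exp_of_nat2_mult)
      also have "\<dots> \<le> M ^ d" using M by (intro power_mono) auto
      finally show ?thesis .
    qed
    have Yn: "Y \<le> \<epsilon>\<^sup>2 * (2 * n)"
    proof -
      have "Y = exp (- c1 * real d) ^ 2 * exp (ln 2 * real d)"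
        unfolding Y_def by (simp add: power2_eq_square algebra_simps flip: exp_add)
      also have "\<dots> \<le> \<epsilon>\<^sup>2 * M ^ d"
      proof (rule mult_mono)
        have "1 * exp (- c1 * real d) \<le> \<epsilon>" unfolding eps using M d1
          by (intro mult_right_mono) (auto intro: order_trans[of 1 "M * 1"] mult_left_mono)
        then show "exp (- c1 * real d) ^ 2 \<le> \<epsilon>\<^sup>2" by (intro power_mono) auto
      qed (use Md in auto)
      finally show ?thesis using n by simp
    qed
    have npos: "n > 0"
    proof -
      have "M ^ d > 0" using M by simp
      then show ?thesis using n by linarith
    qed
    have g6: "real h < (2 * \<epsilon>)\<^sup>2 * n"
    proof -
      have "(2 * \<epsilon>)\<^sup>2 * n = 2 * (\<epsilon>\<^sup>2 * (2 * n))" by (simp add: power2_eq_square)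
      then show ?thesis using Yn e2 unfolding Y_def by linarith
    qed
    have t2: "2 ^ h * real h / (\<epsilon>\<^sup>2 * n) \<le> \<delta> / 4"
    proof -
      have "2 ^ h * real h / (\<epsilon>\<^sup>2 * n) \<le> 2 ^ h * real h / (Y / 2)"
        using Yn Y0 eps_pos npos by (intro divide_left_mono) auto
      also have "\<dots> = (8 * 2 ^ h * real h) / (4 * Y)" by simp
      also have "\<dots> \<le> exp ((ln 2 - 5 / 2 * c1) * real d) / (4 * Y)" using e3 Y0 by (intro divide_right_mono) auto
      also have "exp ((ln 2 - 5 / 2 * c1) * real d) = Y * \<delta>"
        unfolding Y_def \<delta>_def by (simp add: algebra_simps flip: exp_add)
      finally show ?thesis using Y0 by simp
    qed
    \<comment> \<open>After the pattern cost has taken half of the gain, the exponent is still at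
      most \<open>- K * exp ((ln 2 - c1) * d)\<close>, which swallows
      \<open>(2 * M * d) ^ d\<close>, a mere \<open>exp (O (d ln d))\<close>.\<close>
    have t1: "(2 * M * real d) ^ d * 2 ^ h * exp (n * (2 * 2 ^ h * exp (- c0 * real d) - \<kappa> / (4 * real k) * exp (- c1 * real d))) \<le> \<delta> / 4"
    proof -
      define a where "a = \<kappa> / (8 * real k)"
      have a: "a > 0" "\<kappa> / (4 * real k) = 2 * a" "K = a / 2" using pos k by (auto simp: a_def K_def)
      have "2 * 2 ^ h \<le> exp ((c0 - c1) * real d) * a" using e4 a(1) unfolding a_def[symmetric] by (simp add: divide_le_eq)
      then have "2 * 2 ^ h * exp (- c0 * real d) \<le> exp ((c0 - c1) * real d) * a * exp (- c0 * real d)"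
        by (intro mult_right_mono) auto
      also have "\<dots> = a * exp (- c1 * real d)" by (simp add: algebra_simps flip: exp_add)
      finally have "2 * 2 ^ h * exp (- c0 * real d) - \<kappa> / (4 * real k) * exp (- c1 * real d) \<le> - (a * exp (- c1 * real d))"
        unfolding a(2) by simp
      then have "n * (2 * 2 ^ h * exp (- c0 * real d) - \<kappa> / (4 * real k) * exp (- c1 * real d)) \<le> n * (- (a * exp (- c1 * real d)))"
        using npos by (intro mult_left_mono) auto
      also have "\<dots> = - (a / 2 * exp (- c1 * real d) * M ^ d)" using n by simp
      also have "\<dots> \<le> - (a / 2 * exp (- c1 * real d) * exp (ln 2 * real d))"
        using Md a(1) by (simp add: mult_left_mono)
      also have "\<dots> = - (K * exp ((ln 2 - c1) * real d))"
        unfolding a(3) by (simp add: algebra_simps flip: exp_add)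
      finally have ex: "n * (2 * 2 ^ h * exp (- c0 * real d) - \<kappa> / (4 * real k) * exp (- c1 * real d)) \<le> - (K * exp ((ln 2 - c1) * real d))" .
      have p1: "(2 * M * real d) ^ d = exp (real d * ln (2 * M * real d))"
      proof -
        have "2 * M * real d > 0" using M d1 by simp
        then show ?thesis by (simp add: exp_of_nat_mult)
      qed
      have p2: "(2::real) ^ h = exp (real h * ln 2)" by (simp add: exp_of_nat_mult)
      have "(2 * M * real d) ^ d * 2 ^ h * exp (n * (2 * 2 ^ h * exp (- c0 * real d) - \<kappa> / (4 * real k) * exp (- c1 * real d)))
          \<le> (2 * M * real d) ^ d * 2 ^ h * exp (- (K * exp ((ln 2 - c1) * real d)))"
        using ex M by (intro mult_left_mono) auto
      also have "\<dots> = exp (real d * ln (2 * M * real d) + real h * ln 2 - K * exp ((ln 2 - c1) * real d))"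
        unfolding p1 p2 by (simp flip: exp_add)
      also have "\<dots> \<le> exp (- (c1 / 2) * real d - ln 4)" using e5 by (intro exp_le_cancel_iff[THEN iffD2]) linarith
      also have "\<dots> = \<delta> / 4" by (simp add: \<delta>_def exp_diff)
      finally show ?thesis .
    qed
    have "2 * ((2 * M * real d) ^ d * 2 ^ h * exp (n * (2 * 2 ^ h * exp (- c0 * real d) - \<kappa> / (4 * real k) * exp (- c1 * real d)))
       + 2 ^ h * real h / (\<epsilon>\<^sup>2 * n)) \<le> \<delta>"
    proof -
      have "2 * (x + y) \<le> z" if "x \<le> z / 4" "y \<le> z / 4" "z > 0" for x y z :: real
        using add_mono[OF that(1,2)] by simp
      from this[OF t1 t2 \<delta>01(1)] show ?thesis .
    qed
    then show ?case
      using d1(2,3) dL eps_pos g1 g2 g3 g4 g5 g5' g6 unfolding \<delta>_def M_def[symmetric] by blast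
  qed
  then show ?thesis using c1(1) by blast
qed

lemma (in even_torus) Hom_empty_if_no_edges:
  assumes "edges H = {}" "d \<ge> 1"
  shows "Hom (torus m d) H = {}"
proof -
  have "{replicate d 0, nb 0 1 (replicate d 0)} \<in> edges (torus m d)"
    using edge_iff Ev_V[OF zero_in_Ev] nbrs_I[of 0 1] assms(2) Sg_one by simp
  then show ?thesis using assms(1) by (auto simp: Hom_def)
qed

text \<open>\<open>c\<close> and \<open>d0\<close> are fixed before \<open>d\<close>, while the
  tolerance \<open>tol = 2 * \<epsilon>\<close> defining the classes varies with \<open>d\<close>.
  The inequalities on \<open>tol\<close> are those that make the classes accurate, disjoint and
  nonempty.\<close>

lemma (in weighted_target) torus_structure:
  assumes m: "even m" "m \<ge> 2"
  shows "\<exists>c>0. \<exists>d0::nat. \<forall>d\<ge>d0. \<exists>tol.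
    set_weight (torus m d) lam (Hom (torus m d) H - (\<Union>P\<in>max_pairs H lam. torus_colouring.cls m d H lam tol P))
      \<le> 2 powr (- c * real d) * partition_fun (torus m d) H lam \<and>
    d \<ge> 1 \<and> tol > 0 \<and> tol \<le> 2 powr (- c * real d) \<and> tol \<le> 2 powr (- c * real d) * pmin \<and>
    (real (card W) + 1) * tol < pmin \<and> real (card W) < tol\<^sup>2 * card (even_class m d)"
proof -
  obtain L \<kappa> :: real where L: "L \<ge> 0" "\<kappa> > 0"
    and LK: "\<And>I Q. I \<subseteq> W \<Longrightarrow> Q \<subseteq> W \<Longrightarrow> sum lam I * sum lam (cn Q) \<le> eta H lam * exp (psi L \<kappa> ideal I Q)"
  proof (rule ex_psi_constants, goal_cases)
    case (1 L \<kappa>)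
    show ?case by (rule that[of L \<kappa>]) (fact 1)+
  qed
  define h where "h = card W"
  \<comment> \<open>Solves the requirement of \<open>sum_psi_leave_one_out\<close> for the number of
    compared neighbours: at most \<open>card W\<close> violating indices cost \<open>L\<close> each
    and must be outweighed by the others. The extra \<open>3\<close> in \<open>k\<close> secures a
    second sampled direction.\<close>
  obtain k0 :: nat where k0: "real h + 1 + real h * L / \<kappa> \<le> real k0" using real_arch_simple by blast
  define k where "k = k0 + 3"
  have k3: "k \<ge> 3" by (simp add: k_def)
  have kL: "real (card W) * L + \<kappa> \<le> \<kappa> * (real k - real (card W))"
  proof -
    have "\<kappa> * (1 + real h * L / \<kappa>) \<le> \<kappa> * (real k - real h)"
      using k0 L by (intro mult_left_mono) (auto simp: k_def)
    then show ?thesis using L by (simp add: h_def algebra_simps)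
  qed
  define c0 where "c0 = \<kappa> / (4 * real k * (real m * real k + 9 * real m ^ 3))"
  have c0: "c0 > 0"
  proof -
    have "real m * real k + 9 * real m ^ 3 > 0" using m by (intro add_nonneg_pos) auto
    then show ?thesis unfolding c0_def using L k3 by (intro divide_pos_pos mult_pos_pos) auto
  qed
  have k1: "k \<ge> 1" using k3 by simp
  from asymptotic_choice[OF m(2) k1 L(2) pmin_pos c0, of L h]
  obtain c1 d0 where c1: "c1 > 0" and d0: "\<And>d \<epsilon> n. d \<ge> d0 \<Longrightarrow> \<epsilon> = real m * real d * exp (- c1 * real d) \<Longrightarrow> 2 * n = real m ^ d \<Longrightarrow>
    d \<ge> 2 \<and> d \<ge> k \<and> real k * (L + \<kappa>) \<le> real d * (\<kappa> / (2 * real k)) \<and>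
    \<epsilon> > 0 \<and> \<epsilon> < 1 / 2 \<and> 8 * real h * real d * \<epsilon> < 1 \<and> 3 * \<epsilon> < pmin \<and> (real h + 1) * (2 * \<epsilon>) < pmin \<and>
    2 * \<epsilon> \<le> exp (- (c1 / 2) * real d) * pmin \<and> 2 * \<epsilon> \<le> exp (- (c1 / 2) * real d) \<and> real h < (2 * \<epsilon>)\<^sup>2 * n \<and>
    2 * ((2 * real m * real d) ^ d * 2 ^ h * exp (n * (2 * 2 ^ h * exp (- c0 * real d) - \<kappa> / (4 * real k) * exp (- c1 * real d)))
       + 2 ^ h * real h / (\<epsilon>\<^sup>2 * n)) \<le> exp (- (c1 / 2) * real d)"
    unfolding eventually_sequentially by blast
  \<comment> \<open>Converts the rate \<open>exp (- (c1 / 2) * d)\<close> to base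
    \<open>2\<close>.\<close>
  define c where "c = c1 / (2 * ln 2)"
  have c: "c > 0" using c1 by (simp add: c_def)
  have \<delta>: "2 powr (- c * real d) = exp (- (c1 / 2) * real d)" for d by (simp add: powr_def c_def)
  have "\<exists>tol. set_weight (torus m d) lam (Hom (torus m d) H - (\<Union>P\<in>max_pairs H lam. torus_colouring.cls m d H lam tol P))
      \<le> 2 powr (- c * real d) * partition_fun (torus m d) H lam \<and>
    d \<ge> 1 \<and> tol > 0 \<and> tol \<le> 2 powr (- c * real d) \<and> tol \<le> 2 powr (- c * real d) * pmin \<and>
    (real (card W) + 1) * tol < pmin \<and> real (card W) < tol\<^sup>2 * card (even_class m d)" if d: "d \<ge> d0" for d
  proof -
    interpret torus_colouring m d H lam by unfold_locales (rule m)+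
    define \<epsilon> where "\<epsilon> = real m * real d * exp (- c1 * real d)"
    have "d \<ge> 2" using d0[OF d refl, of "real m ^ d / 2"] by simp
    then have d1: "d \<ge> 1" by simp
    have "real (2 * card Ev) = real (m ^ d)" using card_Ev_Od(2)[OF d1] by (simp only:)
    then have n: "2 * real (card Ev) = real m ^ d" by simp
    have cE: "card Od = card Ev" using card_Ev_Od(1)[OF d1] by simp
    note F = d0[OF d \<epsilon>_def n]
    let ?t = "(2 * real m * real d) ^ d * 2 ^ card W
       * exp (card Ev * (2 * 2 ^ card W * exp (- c0 * real d) - \<kappa> / (4 * real k) * exp (- c1 * real d)))"
    have F1: "real k * (L + \<kappa>) \<le> real d * (\<kappa> / (2 * real k))" "d \<ge> 2" "d \<ge> k" using F by blast+
    have tail: "set_weight G lam {f \<in> Homs. exp (- c1 * real d) * card autos \<le> real (defect (cset f) ideal)}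
        \<le> ?t * partition_fun G H lam"
      by (rule defect_tail[OF LK L kL k3 F1 c0_def])
    have F2: "real m * real d * exp (- c1 * real d) \<le> \<epsilon>" by (simp add: \<epsilon>_def)
    have F3: "\<epsilon> > 0" "\<epsilon> < 1 / 2" "8 * real (card W) * real d * \<epsilon> < 1" "3 * \<epsilon> < pmin"
      using F unfolding h_def by blast+
    from exceptional_weight_le[OF tail F1(2) F2 F3]
    have "set_weight G lam (Homs - (\<Union>P\<in>max_pairs H lam. cls (2 * \<epsilon>) P))
        \<le> 2 * (?t + 2 ^ card W * card W / (\<epsilon>\<^sup>2 * card Od)) * partition_fun G H lam" .
    also have "\<dots> \<le> 2 powr (- c * real d) * partition_fun G H lam"
    proof (rule mult_right_mono[OF _ Z_nonneg])
      show "2 * (?t + 2 ^ card W * card W / (\<epsilon>\<^sup>2 * card Od)) \<le> 2 powr (- c * real d)"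
        using F unfolding \<delta> by (simp add: h_def cE)
    qed
    finally have main: "set_weight G lam (Homs - (\<Union>P\<in>max_pairs H lam. cls (2 * \<epsilon>) P)) \<le> 2 powr (- c * real d) * partition_fun G H lam" .
    have "2 * \<epsilon> > 0" using F3 by simp
    moreover have "2 * \<epsilon> \<le> 2 powr (- c * real d)" "2 * \<epsilon> \<le> 2 powr (- c * real d) * pmin"
      "(real (card W) + 1) * (2 * \<epsilon>) < pmin" "real (card W) < (2 * \<epsilon>)\<^sup>2 * card Ev"
      using F unfolding h_def \<delta> by blast+
    ultimately show ?thesis using main d1 by (intro exI[of _ "2 * \<epsilon>"]) blast
  qed
  then show ?thesis using c by (intro exI[of _ c] conjI exI[of _ d0]) auto
qed

theorem theorem1p2:
  fixes H :: "'b ugraph" and lam :: "'b \<Rightarrow> real" and m :: nat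
  assumes "finite_loop_graph H"
    and "\<And>i. i \<in> verts H \<Longrightarrow> lam i > 0 \<and> lam i \<in> \<rat>"
    and "even m" and "m \<ge> 2"
  shows "\<exists>c>0. \<exists>d0::nat. \<forall>d\<ge>1.
    \<exists>(C0 :: (nat list \<Rightarrow> 'b) set) (C :: 'b set \<times> 'b set \<Rightarrow> (nat list \<Rightarrow> 'b) set).
      Hom (torus m d) H = C0 \<union> (\<Union>P\<in>max_pairs H lam. C P) \<and>
      disjoint_family_on C (max_pairs H lam) \<and>
      (\<forall>P\<in>max_pairs H lam. C0 \<inter> C P = {}) \<and>
      (d \<ge> d0 \<longrightarrow>
        set_weight (torus m d) lam C0
          \<le> 2 powr (- c * real d) * partition_fun (torus m d) H lam \<and>
        (\<forall>A B. (A, B) \<in> max_pairs H lam \<longrightarrow>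
          (\<forall>f\<in>C (A, B). \<forall>k\<in>A. \<forall>l\<in>B.
            \<bar>real (card {v \<in> even_class m d. f v = k}) / real (card (even_class m d))
               - lam k / sum lam A\<bar> \<le> 2 powr (- c * real d) \<and>
            \<bar>real (card {v \<in> odd_class m d. f v = l}) / real (card (odd_class m d))
               - lam l / sum lam B\<bar> \<le> 2 powr (- c * real d))) \<and>
        (\<forall>A B. A \<noteq> B \<and> (A, B) \<in> max_pairs H lam \<and> (B, A) \<in> max_pairs H lam \<longrightarrow>
          approx_factor (2 powr (- c * real d))
            (set_weight (torus m d) lam (C (A, B))) (set_weight (torus m d) lam (C (B, A)))) \<and>
        (\<forall>A B A' B' \<phi>.
          (A, B) \<in> max_pairs H lam \<and> (A', B') \<in> max_pairs H lam \<and>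
          weight_preserving_automorphism H lam \<phi> \<and> \<phi> ` A = A' \<and> \<phi> ` B = B' \<longrightarrow>
          approx_factor (2 powr (- c * real d))
            (set_weight (torus m d) lam (C (A, B))) (set_weight (torus m d) lam (C (A', B')))) \<and>
        (\<forall>A B. (A, B) \<in> max_pairs H lam \<longrightarrow>
          (\<forall>x\<in>even_class m d. \<forall>y\<in>odd_class m d. \<forall>k\<in>A. \<forall>l\<in>B.
            approx_factor (2 powr (- c * real d))
              (col_cond_prob (torus m d) H lam {f. f x = k} (C (A, B))) (lam k / sum lam A) \<and>
            approx_factor (2 powr (- c * real d))
              (col_cond_prob (torus m d) H lam {f. f y = l} (C (A, B))) (lam l / sum lam B))))"
proof (cases "edges H = {}")
  case True
  have E: "Hom (torus m d) H = {}" if "d \<ge> 1" for d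
    using even_torus.Hom_empty_if_no_edges[of m H d] assms(3,4) True that by (simp add: even_torus_def)
  \<comment> \<open>Without edges a maximising pair has an empty component, so the clause on
    marginals, which takes \<open>k\<close> in \<open>A\<close> and \<open>l\<close> in
    \<open>B\<close> together, is vacuous. There are no colourings, and the weight comparisons read
    \<open>0\<close> against \<open>0\<close>.\<close>
  have M: "A = {} \<or> B = {}" if "(A, B) \<in> max_pairs H lam" for A B
    using that True by (auto simp: max_pairs_def fully_adjacent_def)
  show ?thesis
  proof (rule exI[of _ 1], rule conjI[OF zero_less_one], rule exI[of _ 0], intro allI impI, goal_cases)
    case (1 d)
    have Z: "approx_factor (2 powr (- 1 * real d)) 0 0" by (auto simp: approx_factor_def intro: exI[of _ 0])
    show ?case
      by (intro exI[of _ "{}"] exI[of _ "\<lambda>_. {}"])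
        (use E[OF 1] M in \<open>auto simp: disjoint_family_on_def set_weight_def partition_fun_def Z[simplified]\<close>)
  qed
next
  case False
  interpret weighted_target H lam
    using assms(1,2) False by unfold_locales auto
  obtain c d0 where c: "c > 0" and main: "\<And>d. d \<ge> d0 \<Longrightarrow> \<exists>tol.
    set_weight (torus m d) lam (Hom (torus m d) H - (\<Union>P\<in>max_pairs H lam. torus_colouring.cls m d H lam tol P))
      \<le> 2 powr (- c * real d) * partition_fun (torus m d) H lam \<and>
    d \<ge> 1 \<and> tol > 0 \<and> tol \<le> 2 powr (- c * real d) \<and> tol \<le> 2 powr (- c * real d) * pmin \<and>
    (real (card W) + 1) * tol < pmin \<and> real (card W) < tol\<^sup>2 * card (even_class m d)"
    using torus_structure[OF assms(3,4)] by blast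
  show ?thesis
  proof (rule exI[of _ c], rule conjI[OF c], rule exI[of _ d0], intro allI impI, goal_cases)
    case (1 d)
    show ?case
    proof (cases "d \<ge> d0")
      case False
      \<comment> \<open>Below \<open>d0\<close> only the partition is claimed, so all colourings may
        go into \<open>C0\<close>.\<close>
      then show ?thesis
        by (intro exI[of _ "Hom (torus m d) H"] exI[of _ "\<lambda>_. {}"]) (auto simp: disjoint_family_on_def)
    next
      case True
      interpret torus_colouring m d H lam by unfold_locales (rule assms(3,4))+
      define \<delta> where "\<delta> = 2 powr (- c * real d)"
      have \<delta>: "\<delta> \<ge> 0" by (simp add: \<delta>_def)
      obtain tol where tol: "set_weight G lam (Homs - (\<Union>P\<in>max_pairs H lam. cls tol P)) \<le> \<delta> * partition_fun G H lam"
        "d \<ge> 1" "tol > 0" "tol \<le> \<delta>" "tol \<le> \<delta> * pmin" "(real (card W) + 1) * tol < pmin"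
        "real (card W) < tol\<^sup>2 * card Ev"
        unfolding \<delta>_def using main[OF True] by blast
      have refl_approx: "approx_factor \<delta> x x" for x
        unfolding approx_factor_def using \<delta> by (intro exI[of _ 0]) auto
      have nE: "\<bar>cls_prop Ev f k - lam k / sum lam A\<bar> \<le> tol" if "f \<in> cls tol (A, B)" "k \<in> A" for f k A B
        using that by (auto simp: cls_def near_def)
      have nO: "\<bar>cls_prop Od f l - lam l / sum lam B\<bar> \<le> tol" if "f \<in> cls tol (A, B)" "l \<in> B" for f l A B
        using that by (auto simp: cls_def near_def)
      have p1: "Homs = (Homs - (\<Union>P\<in>max_pairs H lam. cls tol P)) \<union> (\<Union>P\<in>max_pairs H lam. cls tol P)"
        by (auto simp: cls_def)
      have p2: "disjoint_family_on (cls tol) (max_pairs H lam)" using tol by (intro cls_disjoint) auto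
      have p3: "\<forall>P\<in>max_pairs H lam. (Homs - (\<Union>P\<in>max_pairs H lam. cls tol P)) \<inter> cls tol P = {}" by blast
      have p4: "\<forall>A B. (A, B) \<in> max_pairs H lam \<longrightarrow>
          (\<forall>f\<in>cls tol (A, B). \<forall>k\<in>A. \<forall>l\<in>B.
            \<bar>real (card {v \<in> Ev. f v = k}) / real (card Ev) - lam k / sum lam A\<bar> \<le> \<delta> \<and>
            \<bar>real (card {v \<in> Od. f v = l}) / real (card Od) - lam l / sum lam B\<bar> \<le> \<delta>)"
        using nE nO tol(4) unfolding cls_prop_def by (meson order_trans)
      have p5: "\<forall>A B. A \<noteq> B \<and> (A, B) \<in> max_pairs H lam \<and> (B, A) \<in> max_pairs H lam \<longrightarrow>
          approx_factor \<delta> (set_weight G lam (cls tol (A, B))) (set_weight G lam (cls tol (B, A)))"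
        using cls_swap_weight[OF tol(2)] refl_approx by metis
      have p6: "\<forall>A B A' B' \<phi>.
          (A, B) \<in> max_pairs H lam \<and> (A', B') \<in> max_pairs H lam \<and>
          weight_preserving_automorphism H lam \<phi> \<and> \<phi> ` A = A' \<and> \<phi> ` B = B' \<longrightarrow>
          approx_factor \<delta> (set_weight G lam (cls tol (A, B))) (set_weight G lam (cls tol (A', B')))"
      proof (intro allI impI, elim conjE)
        fix A B A' B' \<phi>
        assume a: "(A, B) \<in> max_pairs H lam" "weight_preserving_automorphism H lam \<phi>" "\<phi> ` A = A'" "\<phi> ` B = B'"
        have "set_weight G lam (cls tol (A, B)) = set_weight G lam (cls tol (\<phi> ` A, \<phi> ` B))"
          using a(2) max_pairD(1,2)[OF a(1)] by (rule cls_automorphism_weight)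
        then show "approx_factor \<delta> (set_weight G lam (cls tol (A, B))) (set_weight G lam (cls tol (A', B')))"
          using a(3,4) refl_approx by simp
      qed
      have p7: "\<forall>A B. (A, B) \<in> max_pairs H lam \<longrightarrow>
          (\<forall>x\<in>Ev. \<forall>y\<in>Od. \<forall>k\<in>A. \<forall>l\<in>B.
            approx_factor \<delta> (col_cond_prob G H lam {f. f x = k} (cls tol (A, B))) (lam k / sum lam A) \<and>
            approx_factor \<delta> (col_cond_prob G H lam {f. f y = l} (cls tol (A, B))) (lam l / sum lam B))"
      proof (intro allI impI ballI conjI)
        fix A B x y k l
        assume a: "(A, B) \<in> max_pairs H lam" "x \<in> Ev" "y \<in> Od" "k \<in> A" "l \<in> B"
        note mp = max_pairD[OF a(1)]
        have ne: "cls tol (A, B) \<noteq> {}" using tol(2) a(1) tol(3,7) by (rule cls_nonempty)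
        have "\<bar>col_cond_prob G H lam {f. f x = k} (cls tol (A, B)) - lam k / sum lam A\<bar> \<le> tol"
          by (rule cond_prob_close[OF disjI1[OF refl] a(2) ne nE[OF _ a(4)]])
        then show "approx_factor \<delta> (col_cond_prob G H lam {f. f x = k} (cls tol (A, B))) (lam k / sum lam A)"
          using pmin_le[OF mp(1) a(4)] tol(5) \<delta> by (rule approx_factor_close)
        have "\<bar>col_cond_prob G H lam {f. f y = l} (cls tol (A, B)) - lam l / sum lam B\<bar> \<le> tol"
          by (rule cond_prob_close[OF disjI2[OF refl] a(3) ne nO[OF _ a(5)]])
        then show "approx_factor \<delta> (col_cond_prob G H lam {f. f y = l} (cls tol (A, B))) (lam l / sum lam B)"
          using pmin_le[OF mp(2) a(5)] tol(5) \<delta> by (rule approx_factor_close)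
      qed
      show ?thesis
        unfolding \<delta>_def[symmetric]
        by (rule exI[of _ "Homs - (\<Union>P\<in>max_pairs H lam. cls tol P)"], rule exI[of _ "cls tol"],
            intro conjI impI) (rule p1 p2 p3 tol(1) p4 p5 p6 p7)+
    qed
  qed
qed

end
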